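(* Let $A\in\mathbb C^{d\times d}$, $b\in\mathbb C^d$ and $\varphi(z)=Az+b$ be such that $C_\varphi$ is a bounded operator on $\mathcal F(\mathbb C^d)$. Then $C_\varphi$ is cyclic if and only if all of the following hold: (i) $A$ is invertible; (ii) either $A$ is diagonalizable, or its Jordan canonical form consists of exactly one Jordan block of size $2$ and all other Jordan blocks have size $1$; (iii) if $\lambda=(\lambda_j)_{j=1}^{\hat d}$ denotes the sequence of eigenvalues of $A$ repeated according to geometric multiplicity (so $\hat d=d$ in the diagonalizable case and $\hat d=d-1$ otherwise), then $\lambda^\alpha:=\prod_{j=1}^{\hat d}\lambda_j^{\alpha_j}\neq 1$ for every $\alpha\in\mathbb Z^{\hat d}\setminus\{0\}$.
   Context: $\mathcal F(\mathbb C^d)$ ($d\ge1$) is the Fock space of entire functions $f$ on $\mathbb C^d$ with $\|f\|^2=(2\pi)^{-d}\int_{\mathbb C^d}|f(z)|^2e^{-|z|^2/2}\,dA(z)<\infty$, where $dA$ is Lebesgue measure, $\langle z,w\rangle=\sum_j z_j\overline{w_j}$ and $|z|^2=\langle z,z\rangle$; it is a Hilbert space. For holomorphic $\varphi:\mathbb C^d\to\mathbb C^d$, the composition operator is $C_\varphi f=f\circ\varphi$. It is known that $C_\varphi$ is bounded on $\mathcal F(\mathbb C^d)$ iff $\varphi(z)=Az+b$ with $\|A\|\le 1$ (Euclidean operator norm) and $\langle Av,b\rangle=0$ for all $v$ with $|Av|=|v|$, and compact iff moreover $\|A\|<1$. A bounded operator $T$ on a separable Banach space $X$ is cyclic if there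 is $x\in X$ with $\mathrm{span}\{T^nx:n\ge0\}$ dense in $X$; such $x$ is a cyclic vector. *)

theory Defs
  imports "HOL-Analysis.Analysis"
begin

text \<open>Entire functions on C^d: complex Frechet-differentiable at every point,
  i.e. the (real) derivative is of the complex-linear form h |-> sum_j c_j h_j.\<close>
definition entire_fun :: "(complex^'n \<Rightarrow> complex) \<Rightarrow> bool" where
  "entire_fun f \<longleftrightarrow>
     (\<forall>z. \<exists>c::complex^'n. (f has_derivative (\<lambda>h. \<Sum>j\<in>UNIV. c$j * h$j)) (at z))"

definition fock_weight :: "complex^'n \<Rightarrow> real" where
  "fock_weight z = exp (- (norm z)\<^sup>2 / 2)"

definition fock_space :: "(complex^'n \<Rightarrow> complex) set" where
  "fock_space = {f. entire_fun f \<and>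
      integrable lborel (\<lambda>z. (cmod (f z))\<^sup>2 * fock_weight z)}"

definition fock_norm :: "(complex^'n \<Rightarrow> complex) \<Rightarrow> real" where
  "fock_norm f = sqrt (inverse ((2 * pi) ^ CARD('n)) *
      integral\<^sup>L lborel (\<lambda>z. (cmod (f z))\<^sup>2 * fock_weight z))"

definition affine_map :: "complex^'n^'n \<Rightarrow> complex^'n \<Rightarrow> complex^'n \<Rightarrow> complex^'n" where
  "affine_map A b z = A *v z + b"

definition comp_op :: "('a \<Rightarrow> 'a) \<Rightarrow> ('a \<Rightarrow> complex) \<Rightarrow> ('a \<Rightarrow> complex)" where
  "comp_op \<phi> f = f \<circ> \<phi>"

definition fock_bounded_op ::
    "((complex^'n \<Rightarrow> complex) \<Rightarrow> (complex^'n \<Rightarrow> complex)) \<Rightarrow> bool" where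
  "fock_bounded_op T \<longleftrightarrow> (\<forall>f\<in>fock_space. T f \<in> fock_space) \<and>
     (\<exists>M. \<forall>f\<in>fock_space. fock_norm (T f) \<le> M * fock_norm f)"

definition fock_cyclic ::
    "((complex^'n \<Rightarrow> complex) \<Rightarrow> (complex^'n \<Rightarrow> complex)) \<Rightarrow> bool" where
  "fock_cyclic T \<longleftrightarrow> (\<exists>f\<in>fock_space. \<forall>g\<in>fock_space. \<forall>\<epsilon>>0.
      \<exists>N::nat. \<exists>c::nat \<Rightarrow> complex.
        fock_norm (\<lambda>z. g z - (\<Sum>k<N. c k * (T ^^ k) f z)) < \<epsilon>)"

definition diag_mat :: "('n \<Rightarrow> complex) \<Rightarrow> complex^'n^'n" where
  "diag_mat \<mu> = (\<chi> i j. if i = j then \<mu> i else 0)"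

definition jordan2_mat :: "('n \<Rightarrow> complex) \<Rightarrow> 'n \<Rightarrow> 'n \<Rightarrow> complex^'n^'n" where
  "jordan2_mat \<mu> i0 i1 = (\<chi> i j. if i = j then \<mu> i else if i = i0 \<and> j = i1 then 1 else 0)"

definition nonresonant :: "('n \<Rightarrow> complex) \<Rightarrow> 'n set \<Rightarrow> bool" where
  "nonresonant \<mu> S \<longleftrightarrow> (\<forall>\<alpha>::'n \<Rightarrow> int. (\<forall>j. j \<notin> S \<longrightarrow> \<alpha> j = 0) \<longrightarrow>
      (\<exists>j\<in>S. \<alpha> j \<noteq> 0) \<longrightarrow> (\<Prod>j\<in>S. \<mu> j powi \<alpha> j) \<noteq> 1)"

end

theory Submission
  imports Defs "HOL-Complex_Analysis.Cauchy_Integral_Formula"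
begin

no_notation fps_nth (infixl \<open>$\<close> 75)

text \<open>Boundedness forces a fixed point \<open>p\<close> of \<open>\<phi>\<close>. Iterated directional derivatives at \<open>p\<close> are continuous
  functionals on the Fock space, and composition with \<open>\<phi>\<close> acts on them through \<open>A\<close>. Two independent
  eigenfunctionals with the same eigenvalue exclude cyclicity, since a combination of them vanishes on the
  orbit. Such pairs of order at most two arise from a zero eigenvalue, a double eigenspace, a Jordan chain of
  length three or two chains of length two, and pairs of higher order arise from resonances.

  Conversely, in Jordan coordinates centred at \<open>p\<close> the polynomials, which are dense, split into generalized
  eigenspaces with distinct eigenvalues on each of which the operator is a single Jordan block. A rapidly
  convergent series of generators of these blocks is a cyclic vector.\<close>

section \<open>Directional derivatives of entire functions\<close>

text \<open>Why blocks of size two are the borderline: derivatives of order \<open>n\<close> at the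
  fixed point transform by the \<open>n\<close>-th symmetric power of \<open>A\<close>. For nonzero
  eigenvalues the symmetric square of a Jordan block of size 3 splits into blocks of sizes 5 and 1,
  and the tensor product of two blocks of size 2 into sizes 3 and 1, so a second eigenvector with
  the same eigenvalue appears. Every symmetric power of one block of size 2, however, is again a
  single block, of size \<open>n + 1\<close>; this admits the exceptional Jordan form and explains
  why its second index is left out of the resonance condition. On the analytic side neither
  completeness nor an orthonormal basis of the Fock space is set up. Norm estimates for constructed
  functions come from pointwise bounds by multiples of \<open>exp (|z|^2 / 8)\<close>: after
  squaring, the weight still leaves the integrable Gaussian \<open>exp (- |z|^2 / 4)\<close>.
  Orthogonality is used only on the circles \<open>circ t *s z\<close>, to which integrals over the
  whole space are reduced by averaging.\<close>

lemma norm_scalar_mult_complex: "norm (c *s (v::complex^'n)) = cmod c * norm v"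
  by (simp add: norm_vec_def norm_mult L2_set_right_distrib)

lemma bounded_linear_scalar_mult_left: "bounded_linear (\<lambda>c. c *s (v::complex^'n))"
proof (rule bounded_linear_intro)
  show "norm (x *s v) \<le> norm x * norm v" for x
    by (simp add: norm_scalar_mult_complex)
  show "(r *\<^sub>R x) *s v = r *\<^sub>R (x *s v)" for r x
    by (simp add: vec_eq_iff)
qed (simp add: vec_eq_iff algebra_simps)

lemma bounded_linear_scalar_mult_right: "bounded_linear (\<lambda>v. c *s (v::complex^'n))"
proof (rule bounded_linear_intro)
  show "norm (c *s v) \<le> norm v * cmod c" for v :: "complex^'n"
    by (simp add: norm_scalar_mult_complex)
qed (simp_all add: vec_eq_iff algebra_simps scaleR_conv_of_real)

lemma continuous_on_scalar_mult [continuous_intros]: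
  fixes g :: "'a::topological_space \<Rightarrow> complex^'n"
  assumes "continuous_on S c" "continuous_on S g"
  shows "continuous_on S (\<lambda>x. c x *s g x)"
  unfolding continuous_on_componentwise vector_scalar_mult_def
  by (auto intro!: continuous_intros assms)

lemma vec_eq_sum_axis: "h = (\<Sum>j\<in>UNIV. h $ j *s axis j (1::complex))"
  by (simp add: vec_eq_iff axis_def if_distrib[where f="(*) _"] cong: if_cong)

text \<open>A complex homogeneous derivative is determined by its values on the axis vectors, which
  serve as the coefficients \<open>c\<close>.\<close>

lemma entire_funI:
  fixes f :: "complex^'n \<Rightarrow> complex"
  assumes "\<And>z. \<exists>L. (f has_derivative L) (at z) \<and> (\<forall>c h. L (c *s h) = c * L h)"
  shows "entire_fun f"
  unfolding entire_fun_def
proof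
  fix z :: "complex^'n"
  obtain L where L: "(f has_derivative L) (at z)" and hom: "\<And>c h. L (c *s h) = c * L h"
    using assms by blast
  interpret L: bounded_linear L
    using L by (rule has_derivative_bounded_linear)
  have "L h = (\<Sum>j\<in>UNIV. (\<chi> j. L (axis j 1))$j * h$j)" for h
    by (subst vec_eq_sum_axis) (simp add: L.sum hom mult.commute)
  then have "L = (\<lambda>h. \<Sum>j\<in>UNIV. (\<chi> j. L (axis j 1))$j * h$j)"
    by (rule ext)
  with L show "\<exists>c::complex^'n. (f has_derivative (\<lambda>h. \<Sum>j\<in>UNIV. c$j * h$j)) (at z)"
    by metis
qed

lemma entire_funE:
  assumes "entire_fun f"
  obtains L where "(f has_derivative L) (at z)" "\<And>c h. L (c *s h) = c * L h"
    "\<And>g h. L (g + h) = L g + L h"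
proof -
  obtain c where "(f has_derivative (\<lambda>h. \<Sum>j\<in>UNIV. c$j * h$j)) (at z)"
    using assms unfolding entire_fun_def by blast
  then show ?thesis
    by (rule that) (simp_all add: sum_distrib_left sum.distrib algebra_simps)
qed

lemma entire_fun_continuous_on: "entire_fun f \<Longrightarrow> continuous_on S f"
  by (meson continuous_at_imp_continuous_on entire_funE has_derivative_continuous)

lemma entire_fun_borel [measurable]: "entire_fun f \<Longrightarrow> f \<in> borel_measurable borel"
  by (intro borel_measurable_continuous_onI entire_fun_continuous_on)

text \<open>Encoded as \<open>deriv\<close> of a one-variable restriction, so that Cauchy's formula
  and Taylor series on complex lines apply directly.\<close>

definition dirderiv :: "complex^'n \<Rightarrow> (complex^'n \<Rightarrow> complex) \<Rightarrow> complex^'n \<Rightarrow> complex" where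
  "dirderiv v f z = deriv (\<lambda>t. f (z + t *s v)) 0"

lemma DERIV_along_line:
  fixes f :: "complex^'n \<Rightarrow> complex"
  assumes "(f has_derivative L) (at (z + t *s v))" "\<And>c h. L (c *s h) = c * L h"
  shows "((\<lambda>t. f (z + t *s v)) has_field_derivative L v) (at t)"
proof -
  have "((\<lambda>t. z + t *s v) has_derivative (\<lambda>h. h *s v)) (at t)"
    using has_derivative_add[OF has_derivative_const
        bounded_linear.has_derivative[OF bounded_linear_scalar_mult_left[of v] has_derivative_ident], of z "at t"]
    by simp
  from has_derivative_compose[OF this assms(1)]
  show ?thesis
    by (simp add: has_field_derivative_def assms(2) mult_commute_abs)
qed

lemma dirderiv_eq:
  assumes "(f has_derivative L) (at z)" "\<And>c h. L (c *s h) = c * L h"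
  shows "dirderiv v f z = L v"
  unfolding dirderiv_def
  by (rule DERIV_imp_deriv, rule DERIV_along_line) (use assms in simp_all)

lemma entire_fun_has_derivative:
  assumes "entire_fun f"
  shows "(f has_derivative (\<lambda>h. dirderiv h f z)) (at z)"
  using assms dirderiv_eq by (metis (no_types, lifting) entire_funE ext)

lemma dirderiv_scalar_mult: "entire_fun f \<Longrightarrow> dirderiv (c *s v) f z = c * dirderiv v f z"
  by (metis entire_funE dirderiv_eq)

lemma dirderiv_add: "entire_fun f \<Longrightarrow> dirderiv (v + w) f z = dirderiv v f z + dirderiv w f z"
  by (metis entire_funE dirderiv_eq)

lemma dirderiv_axis:
  assumes "entire_fun f"
  shows "dirderiv v f z = (\<Sum>j\<in>UNIV. v $ j * dirderiv (axis j 1) f z)"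
proof -
  interpret L: bounded_linear "\<lambda>h. dirderiv h f z"
    using entire_fun_has_derivative[OF assms] by (rule has_derivative_bounded_linear)
  show ?thesis
    by (subst vec_eq_sum_axis) (simp only: L.sum dirderiv_scalar_mult[OF assms])
qed

lemma entire_fun_holomorphic_line:
  assumes "entire_fun f"
  shows "(\<lambda>t. f (z + t *s v)) holomorphic_on S"
proof -
  have "(\<lambda>t. f (z + t *s v)) field_differentiable at t" for t
    by (metis DERIV_along_line entire_funE[OF assms] field_differentiable_def)
  then show ?thesis
    by (simp add: field_differentiable_at_within holomorphic_on_def)
qed

lemma dirderiv_affine_map:
  "dirderiv v (f \<circ> affine_map A b) z = dirderiv (A *v v) f (affine_map A b z)"
  by (simp add: dirderiv_def o_def affine_map_def vec.add vec.scale add_ac)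

lemma deriv_along_line: "deriv (\<lambda>t. f (z + t *s v)) t = dirderiv v f (z + t *s v)"
  unfolding dirderiv_def
  by (subst deriv_shift_0) (simp add: o_def vec.scale_left_distrib add.assoc)

lemma higher_deriv_along_line:
  "(deriv ^^ n) (\<lambda>t. f (z + t *s v)) = (\<lambda>t. (dirderiv v ^^ n) f (z + t *s v))"
  by (induction n) (simp_all add: deriv_along_line)

text \<open>The unit circle is parametrized by \<open>{0..1}\<close>, which has length one, so
  circle means need no normalising factor.\<close>

definition circ :: "real \<Rightarrow> complex" where
  "circ t = exp (2 * of_real pi * \<i> * of_real t)"

lemma norm_circ [simp]: "cmod (circ t) = 1"
  by (simp add: circ_def)

lemma continuous_on_circ [continuous_intros]: "continuous_on S circ"
  unfolding circ_def by (intro continuous_intros)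

lemma circ_nonzero [simp]: "circ t \<noteq> 0"
  by (simp add: circ_def)

lemma cnj_circ: "cnj (circ t) = inverse (circ t)"
  by (metis complex_cnj_cnj complex_mod_cnj inverse_unique mult.commute mult.right_neutral
      norm_circ complex_norm_square of_real_1 one_power2)

text \<open>On the unit circle \<open>1 / u\<close> is the conjugate of \<open>u\<close>, so
  Cauchy's formula presents Taylor coefficients at 0 as Fourier coefficients of the boundary
  values.\<close>

lemma Cauchy_circ:
  assumes "g holomorphic_on UNIV"
  shows "((\<lambda>t. g (circ t) * cnj (circ t) ^ m) has_integral (deriv ^^ m) g 0 / fact m) {0..1}"
proof -
  have "((\<lambda>u. g u / (u - 0) ^ Suc m) has_contour_integral ((2 * pi * \<i>) / fact m * (deriv ^^ m) g 0))
      (circlepath 0 1)"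
    by (rule Cauchy_has_contour_integral_higher_derivative_circlepath)
      (use assms in \<open>auto intro: holomorphic_on_subset holomorphic_on_imp_continuous_on\<close>)
  then have "((\<lambda>t. g (circ t) / circ t ^ Suc m * (2 * pi * \<i> * circ t)) has_integral
      ((2 * pi * \<i>) / fact m * (deriv ^^ m) g 0)) {0..1}"
    unfolding has_contour_integral vector_derivative_circlepath
    by (simp add: circlepath circ_def mult_ac)
  then have "((\<lambda>t. (1 / (2 * pi * \<i>)) * (g (circ t) / circ t ^ Suc m * (2 * pi * \<i> * circ t))) has_integral
      (1 / (2 * pi * \<i>)) * ((2 * pi * \<i>) / fact m * (deriv ^^ m) g 0)) {0..1}"
    by (rule has_integral_mult_right)
  moreover have "(1 / (2 * pi * \<i>)) * (g (circ t) / circ t ^ Suc m * (2 * pi * \<i> * circ t))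
      = g (circ t) * cnj (circ t) ^ m" for t
    by (simp add: cnj_circ field_simps power_inverse)
  ultimately show ?thesis
    by simp
qed

lemma dirderiv_integral:
  assumes "entire_fun f"
  shows "dirderiv v f z = integral {0..1} (\<lambda>t. f (z + circ t *s v) * cnj (circ t))"
  using Cauchy_circ[OF entire_fun_holomorphic_line[OF assms], of z v 1]
  by (simp add: dirderiv_def integral_unique)

text \<open>Differentiability at every point does not by itself make the derivative continuous in
  the point. Cauchy's formula writes it as a parameter integral with continuous integrand; the
  Leibniz rule applied later depends on this.\<close>

lemma continuous_on_dirderiv:
  fixes f :: "complex^'n \<Rightarrow> complex"
  assumes "entire_fun f"
  shows "continuous_on S (dirderiv v f)"
proof -
  have "continuous_on S (\<lambda>z. integral (cbox 0 1) (\<lambda>t. f (z + circ t *s v) * cnj (circ t)))"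
    unfolding circ_def
    by (rule integral_continuous_on_param)
       (auto simp: split_beta intro!: continuous_intros
         continuous_on_compose2[OF entire_fun_continuous_on[OF assms, of UNIV]])
  then show ?thesis
    by (simp add: dirderiv_integral[OF assms, abs_def])
qed

text \<open>Differentiation under the integral sign in Cauchy's formula.\<close>
lemma entire_fun_dirderiv:
  fixes f :: "complex^'n \<Rightarrow> complex"
  assumes f: "entire_fun f"
  shows "entire_fun (dirderiv v f)"
proof (rule entire_funI)
  fix z0 :: "complex^'n"
  define F where "F = (\<lambda>z t. f (z + circ t *s v) * cnj (circ t))"
  define dF where "dF = (\<lambda>z t. Blinfun (\<lambda>h. dirderiv h f (z + circ t *s v) * cnj (circ t)))"
  have bl: "bounded_linear (\<lambda>h. dirderiv h f (z + circ t *s v) * cnj (circ t))" for z t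
    by (rule bounded_linear_mult_const[OF has_derivative_bounded_linear[OF entire_fun_has_derivative[OF f]]])
  have app: "blinfun_apply (dF z t) = (\<lambda>h. dirderiv h f (z + circ t *s v) * cnj (circ t))" for z t
    unfolding dF_def by (rule bounded_linear_Blinfun_apply[OF bl])
  \<comment> \<open>The Leibniz rule wants the derivative jointly continuous as a bounded operator;
    in finite dimension this may be tested on each direction separately.\<close>
  have cont: "continuous_on (UNIV \<times> cbox 0 1) (\<lambda>(z, t). dF z t)"
  proof (rule continuous_on_blinfun_componentwise)
    fix i :: "complex^'n"
    show "continuous_on (UNIV \<times> cbox 0 1) (\<lambda>x. blinfun_apply (case x of (z, t) \<Rightarrow> dF z t) i)"
      unfolding split_beta app circ_def
      by (intro continuous_intros continuous_on_compose2[OF continuous_on_dirderiv[OF f, of UNIV]]) auto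
  qed
  have int_dF: "dF z0 integrable_on cbox 0 1"
    by (rule integrable_continuous)
       (use continuous_on_compose2[OF cont, of "cbox 0 1" "\<lambda>t. (z0, t)"] in
         \<open>auto simp: continuous_on_Pair continuous_on_const continuous_on_id\<close>)
  have "((\<lambda>z. integral (cbox 0 1) (F z)) has_derivative integral (cbox 0 1) (dF z0)) (at z0 within UNIV)"
  proof (rule leibniz_rule[OF _ _ cont])
    fix z and t :: real
    have "((\<lambda>z. z + circ t *s v) has_derivative (\<lambda>h. h)) (at z)"
      by (auto intro!: derivative_eq_intros)
    from has_derivative_compose[OF this entire_fun_has_derivative[OF f]]
    have "((\<lambda>z. f (z + circ t *s v)) has_derivative (\<lambda>h. dirderiv h f (z + circ t *s v))) (at z)" .
    then show "((\<lambda>z. F z t) has_derivative blinfun_apply (dF z t)) (at z within UNIV)"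
      unfolding F_def app by (rule has_derivative_mult_left)
  next
    fix z
    show "F z integrable_on cbox 0 1"
      unfolding F_def circ_def
      by (rule integrable_continuous)
         (intro continuous_intros continuous_on_compose2[OF entire_fun_continuous_on[OF f, of UNIV]], auto)
  qed auto
  moreover have "(\<lambda>z. integral (cbox 0 1) (F z)) = dirderiv v f"
    by (simp add: fun_eq_iff F_def dirderiv_integral[OF f])
  moreover have "integral (cbox 0 1) (dF z0) (c *s h) = c * integral (cbox 0 1) (dF z0) h" for c h
    using int_dF by (simp add: blinfun_apply_integral app dirderiv_scalar_mult[OF f] mult.assoc)
  ultimately show "\<exists>L. (dirderiv v f has_derivative L) (at z0) \<and> (\<forall>c h. L (c *s h) = c * L h)"
    by auto
qed

section \<open>Algebra of entire functions, derivation rules and a Cauchy estimate\<close>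

lemma entire_fun_const: "entire_fun (\<lambda>z. c)"
  by (rule entire_funI) (auto intro!: exI[of _ "\<lambda>h. 0"])

lemma entire_fun_add: "entire_fun f \<Longrightarrow> entire_fun g \<Longrightarrow> entire_fun (\<lambda>z. f z + g z)"
  by (rule entire_funI)
     (auto intro!: exI derivative_eq_intros entire_fun_has_derivative
       simp: dirderiv_scalar_mult algebra_simps)

lemma entire_fun_mult: "entire_fun f \<Longrightarrow> entire_fun g \<Longrightarrow> entire_fun (\<lambda>z. f z * g z)"
  by (rule entire_funI)
     (auto intro!: exI derivative_eq_intros entire_fun_has_derivative
       simp: dirderiv_scalar_mult algebra_simps)

lemma entire_fun_sum: "(\<And>i. i \<in> I \<Longrightarrow> entire_fun (f i)) \<Longrightarrow> entire_fun (\<lambda>z. \<Sum>i\<in>I. f i z)"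
  by (induction I rule: infinite_finite_induct) (auto intro: entire_fun_const entire_fun_add)

lemma entire_fun_diff: "entire_fun f \<Longrightarrow> entire_fun g \<Longrightarrow> entire_fun (\<lambda>z. f z - g z)"
  using entire_fun_add[of f "\<lambda>z. (-1) * g z"] entire_fun_mult[OF entire_fun_const, of g "-1"]
  by simp

lemma dirderiv_fun_add:
  "entire_fun f \<Longrightarrow> entire_fun g \<Longrightarrow> dirderiv v (\<lambda>z. f z + g z) z = dirderiv v f z + dirderiv v g z"
  by (rule dirderiv_eq)
     (auto intro!: derivative_eq_intros entire_fun_has_derivative
       simp: dirderiv_scalar_mult algebra_simps)

lemma dirderiv_fun_mult:
  "entire_fun f \<Longrightarrow> entire_fun g \<Longrightarrow>
    dirderiv v (\<lambda>z. f z * g z) z = dirderiv v f z * g z + f z * dirderiv v g z"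
  by (rule dirderiv_eq)
     (auto intro!: derivative_eq_intros entire_fun_has_derivative
       simp: dirderiv_scalar_mult algebra_simps)

lemma dirderiv_const: "dirderiv v (\<lambda>z. c) z = 0"
  by (simp add: dirderiv_def)

lemma dirderiv_fun_cmult:
  "entire_fun f \<Longrightarrow> dirderiv v (\<lambda>z. c * f z) z = c * dirderiv v f z"
  using dirderiv_fun_mult[OF entire_fun_const, of f v c] by (simp add: dirderiv_const)

lemma dirderiv_fun_sum:
  "(\<And>i. i \<in> I \<Longrightarrow> entire_fun (f i)) \<Longrightarrow>
    dirderiv v (\<lambda>z. \<Sum>i\<in>I. f i z) z = (\<Sum>i\<in>I. dirderiv v (f i) z)"
  by (induction I rule: infinite_finite_induct)
     (auto simp: dirderiv_const dirderiv_fun_add entire_fun_sum)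

text \<open>Cauchy's estimate on the circle \<open>z + circ t *s v\<close>, all of whose points have
  norm at most \<open>norm z + norm v\<close>.\<close>

lemma norm_dirderiv_le:
  assumes f: "entire_fun f" and le: "\<And>w. norm w \<le> norm z + norm v \<Longrightarrow> cmod (f w) \<le> B"
  shows "cmod (dirderiv v f z) \<le> B"
proof -
  have "((\<lambda>t. f (z + circ t *s v) * cnj (circ t)) has_integral dirderiv v f z) {0..1}"
    using Cauchy_circ[OF entire_fun_holomorphic_line[OF f], of z v 1] by (simp add: dirderiv_def)
  moreover have "cmod (f (z + circ t *s v) * cnj (circ t)) \<le> B" for t
    using le[of "z + circ t *s v"] norm_triangle_ineq[of z "circ t *s v"]
    by (simp add: norm_mult norm_scalar_mult_complex)
  moreover have "0 \<le> B"
    using le[of z] order_trans[OF norm_ge_zero] by force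
  ultimately show ?thesis
    using has_integral_bound[of B _ _ "0::real" 1] by (fastforce simp: cbox_interval)
qed

section \<open>Averages over the circle action\<close>

lemma nn_integral_lborel_affine:
  fixes f :: "'a::euclidean_space \<Rightarrow> ennreal"
  assumes [measurable]: "f \<in> borel_measurable borel" and c: "\<bar>c\<bar> = 1"
  shows "(\<integral>\<^sup>+x. f (t + c *\<^sub>R x) \<partial>lborel) = (\<integral>\<^sup>+x. f x \<partial>lborel)"
  by (subst (2) lborel_affine[of c t])
     (use c in \<open>auto simp: nn_integral_density nn_integral_distr\<close>)

text \<open>The image of Lebesgue measure under a linear isometry is translation invariant, hence a
  multiple of Lebesgue measure, and the unit ball shows that the factor is 1.\<close>
lemma emeasure_lborel_isometry:
  fixes R :: "'a::euclidean_space \<Rightarrow> 'a"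
  assumes "linear R" and iso: "\<And>x. norm (R x) = norm x" and A [measurable]: "A \<in> sets borel"
  shows "(\<integral>\<^sup>+x. indicator A (R x) \<partial>lborel) = emeasure lborel A"
proof -
  interpret linear R by fact
  have R [measurable]: "R \<in> borel_measurable borel"
    using \<open>linear R\<close>
    by (intro borel_measurable_continuous_onI linear_continuous_on) (simp add: linear_conv_bounded_linear)
  have "inj R"
    using iso by (metis diff eq_iff_diff_eq_0 injI norm_eq_zero)
  then have "surj R"
    using \<open>linear R\<close> linear_injective_imp_surjective by blast
  define B where "B = ball (0::'a) 1"
  have [measurable]: "B \<in> sets borel"
    by (simp add: B_def)
  have B_R: "indicator B (R x) = (indicator B x :: ennreal)" for x
    by (simp add: B_def iso indicator_def)
  \<comment> \<open>Inserting the mass of the ball creates a double integral. After an exchange of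
    the integrals, writing the shift as \<open>y = R u\<close> and substituting in \<open>x\<close>
    moves it from the ball to \<open>A\<close>; exchanged back, the inner integral is the measure of
    \<open>A\<close>.\<close>
  have "(\<integral>\<^sup>+x. indicator A (R x) \<partial>lborel) * emeasure lborel B
      = (\<integral>\<^sup>+x. indicator A (R x) * (\<integral>\<^sup>+y. indicator B y \<partial>lborel) \<partial>lborel)"
    by (simp add: nn_integral_multc)
  also have "\<dots> = (\<integral>\<^sup>+x. indicator A (R x) * (\<integral>\<^sup>+y. indicator B (R x + 1 *\<^sub>R y) \<partial>lborel) \<partial>lborel)"
    by (subst nn_integral_lborel_affine) auto
  also have "\<dots> = (\<integral>\<^sup>+x. (\<integral>\<^sup>+y. indicator A (R x) * indicator B (R x + y) \<partial>lborel) \<partial>lborel)"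
    by (simp add: nn_integral_cmult)
  also have "\<dots> = (\<integral>\<^sup>+y. (\<integral>\<^sup>+x. indicator A (R x) * indicator B (R x + y) \<partial>lborel) \<partial>lborel)"
    by (rule lborel_pair.Fubini') measurable
  also have "\<dots> = (\<integral>\<^sup>+y. (\<integral>\<^sup>+x. indicator A (R x - y) * indicator B (R x) \<partial>lborel) \<partial>lborel)"
  proof (rule nn_integral_cong)
    fix y :: 'a
    obtain u where y: "y = R u"
      using \<open>surj R\<close> by (meson surjD)
    have "(\<integral>\<^sup>+x. indicator A (R x - y) * indicator B (R x) \<partial>lborel)
        = (\<integral>\<^sup>+x. indicator A (R (u + 1 *\<^sub>R x) - y) * indicator B (R (u + 1 *\<^sub>R x)) \<partial>lborel)"
      by (rule nn_integral_lborel_affine[symmetric]) auto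
    then show "(\<integral>\<^sup>+x. indicator A (R x) * indicator B (R x + y) \<partial>lborel)
        = (\<integral>\<^sup>+x. indicator A (R x - y) * indicator B (R x) \<partial>lborel)"
      by (simp add: y add add.commute)
  qed
  also have "\<dots> = (\<integral>\<^sup>+x. (\<integral>\<^sup>+y. indicator A (R x - y) * indicator B (R x) \<partial>lborel) \<partial>lborel)"
    by (rule lborel_pair.Fubini') measurable
  also have "\<dots> = (\<integral>\<^sup>+x. (\<integral>\<^sup>+y. indicator A (R x + (-1) *\<^sub>R y) \<partial>lborel) * indicator B x \<partial>lborel)"
    by (simp add: nn_integral_multc B_R)
  also have "\<dots> = (\<integral>\<^sup>+x. (\<integral>\<^sup>+y. indicator A y \<partial>lborel) * indicator B x \<partial>lborel)"
    by (subst nn_integral_lborel_affine) auto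
  also have "\<dots> = emeasure lborel A * emeasure lborel B"
    by (simp add: nn_integral_cmult)
  finally have "(\<integral>\<^sup>+x. indicator A (R x) \<partial>lborel) * emeasure lborel B = emeasure lborel A * emeasure lborel B" .
  moreover have "emeasure lborel B \<noteq> 0"
    using content_ball_pos[of 1 "0::'a"] by (auto simp: B_def measure_def)
  moreover have "emeasure lborel B \<noteq> \<infinity>"
    unfolding B_def using emeasure_lborel_ball_finite[of "0::'a" 1] by auto
  ultimately show ?thesis
    by (simp add: ennreal_mult_cancel_left mult.commute[of _ "emeasure lborel B"])
qed

lemma nn_integral_lborel_isometry:
  fixes R :: "'a::euclidean_space \<Rightarrow> 'a"
  assumes "linear R" "\<And>x. norm (R x) = norm x" and [measurable]: "f \<in> borel_measurable borel"
  shows "(\<integral>\<^sup>+x. f (R x) \<partial>lborel) = (\<integral>\<^sup>+x. f x \<partial>lborel)"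
proof -
  have R [measurable]: "R \<in> borel_measurable borel"
    using \<open>linear R\<close>
    by (intro borel_measurable_continuous_onI linear_continuous_on) (simp add: linear_conv_bounded_linear)
  have "distr lborel borel R = lborel"
  proof (rule measure_eqI)
    fix A assume "A \<in> sets (distr lborel borel R)"
    then have [measurable]: "A \<in> sets borel" by simp
    have "emeasure (distr lborel borel R) A = (\<integral>\<^sup>+x. indicator A x \<partial>distr lborel borel R)"
      by simp
    also have "\<dots> = (\<integral>\<^sup>+x. indicator A (R x) \<partial>lborel)"
      by (rule nn_integral_distr) auto
    finally show "emeasure (distr lborel borel R) A = emeasure lborel A"
      by (simp add: emeasure_lborel_isometry[OF assms(1,2)])
  qed simp
  then have "(\<integral>\<^sup>+x. f x \<partial>lborel) = (\<integral>\<^sup>+x. f x \<partial>distr lborel borel R)"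
    by simp
  also have "\<dots> = (\<integral>\<^sup>+x. f (R x) \<partial>lborel)"
    by (rule nn_integral_distr) auto
  finally show ?thesis ..
qed

lemma circ_scalar_mult_borel [measurable]:
  "(\<lambda>p. circ (snd p) *s fst p) \<in> borel_measurable (borel \<Otimes>\<^sub>M (borel :: real measure))"
  unfolding borel_prod
  by (intro borel_measurable_continuous_onI continuous_intros continuous_on_compose2[OF continuous_on_circ]) auto

text \<open>Every rotation by \<open>circ t\<close> is a real linear isometry and
  \<open>{0..1}\<close> has length one. This reduces integrals over the space to integrals over
  circles, where one-variable complex analysis is available.\<close>

lemma nn_integral_circ_average:
  fixes F :: "complex^'n \<Rightarrow> ennreal"
  assumes [measurable]: "F \<in> borel_measurable borel"
  shows "(\<integral>\<^sup>+z. (\<integral>\<^sup>+t. indicator {0..1} t * F (circ t *s z) \<partial>lborel) \<partial>lborel) = (\<integral>\<^sup>+z. F z \<partial>lborel)"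
proof -
  have meas: "(\<lambda>p::(complex^'n) \<times> real. indicator {0..1} (snd p) * F (circ (snd p) *s fst p))
      \<in> borel_measurable (borel \<Otimes>\<^sub>M borel)"
    by measurable
  have "(\<integral>\<^sup>+z. (\<integral>\<^sup>+t. indicator {0..1} t * F (circ t *s z) \<partial>lborel) \<partial>lborel)
      = (\<integral>\<^sup>+t. (\<integral>\<^sup>+z. indicator {0..1} t * F (circ t *s z) \<partial>lborel) \<partial>lborel)"
    by (rule lborel_pair.Fubini'[symmetric]) (use meas in \<open>simp add: split_beta\<close>)
  also have "\<dots> = (\<integral>\<^sup>+t. indicator {0..1} t * (\<integral>\<^sup>+z. F z \<partial>lborel) \<partial>(lborel::real measure))"
  proof (rule nn_integral_cong)
    fix t :: real
    have lin: "linear (\<lambda>z::complex^'n. circ t *s z)"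
      using bounded_linear_scalar_mult_right bounded_linear.linear by blast
    have [measurable]: "(\<lambda>z::complex^'n. circ t *s z) \<in> borel_measurable borel"
      by (intro borel_measurable_continuous_onI continuous_intros)
    show "(\<integral>\<^sup>+z. indicator {0..1} t * F (circ t *s z) \<partial>lborel) = indicator {0..1} t * (\<integral>\<^sup>+z. F z \<partial>lborel)"
      using nn_integral_lborel_isometry[OF lin _ assms]
      by (simp add: nn_integral_cmult norm_scalar_mult_complex)
  qed
  also have "\<dots> = (\<integral>\<^sup>+z. F z \<partial>lborel)"
    by (simp add: nn_integral_multc)
  finally show ?thesis .
qed

lemma integrable_exp_minus_norm_sq:
  fixes a :: real
  assumes a: "a > 0"
  shows "integrable lborel (\<lambda>z::'a::euclidean_space. exp (- a * (norm z)\<^sup>2))"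
proof (rule integrableI_nonneg)
  have fin1: "(\<integral>\<^sup>+x. ennreal (exp (- a * x\<^sup>2)) \<partial>(lborel::real measure)) < \<infinity>"
  proof -
    define g where "g = (\<lambda>x::real. indicator {0..} x * ennreal (exp (- (2 * a) * x)))"
    have [measurable]: "g \<in> borel_measurable borel"
      unfolding g_def by measurable
    have g: "(\<integral>\<^sup>+x. g x \<partial>lborel) = ennreal (exp (- (2 * a) * 0) / (2 * a))"
      using nn_integral_has_integral_lebesgue[OF _ has_integral_exp_minus_to_infinity[of "2 * a" 0]] a
      by (simp add: g_def ennreal_indicator[symmetric] ennreal_mult')
    have "ennreal (exp (- a * x\<^sup>2)) \<le> ennreal (exp a) * (g x + g (0 + (- 1) *\<^sub>R x))" for x
    proof -
      \<comment> \<open>From \<open>a * (|x| - 1)^2 >= 0\<close>: a two-sided exponential with known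
        integral dominates the Gaussian.\<close>
      have "- a * x\<^sup>2 \<le> a + - (2 * a) * \<bar>x\<bar>"
        using mult_nonneg_nonneg[OF less_imp_le[OF a] zero_le_power2[of "\<bar>x\<bar> - 1"]]
        by (simp add: power2_eq_square algebra_simps)
      then have "ennreal (exp (- a * x\<^sup>2)) \<le> ennreal (exp a) * ennreal (exp (- (2 * a) * \<bar>x\<bar>))"
        by (simp flip: ennreal_mult exp_add)
      also have "ennreal (exp (- (2 * a) * \<bar>x\<bar>)) \<le> g x + g (0 + (- 1) *\<^sub>R x)"
        by (cases "x \<ge> 0") (auto simp: g_def)
      finally show ?thesis
        by (simp add: mult_left_mono)
    qed
    then have "(\<integral>\<^sup>+x. ennreal (exp (- a * x\<^sup>2)) \<partial>lborel)
        \<le> (\<integral>\<^sup>+x. ennreal (exp a) * (g x + g (0 + (- 1) *\<^sub>R x)) \<partial>lborel)"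
      by (intro nn_integral_mono)
    also have "\<dots> = ennreal (exp a) * ((\<integral>\<^sup>+x. g x \<partial>lborel) + (\<integral>\<^sup>+x. g (0 + (- 1) *\<^sub>R x) \<partial>lborel))"
      by (subst nn_integral_cmult) (auto simp: nn_integral_add)
    also have "\<dots> < \<infinity>"
      by (subst nn_integral_lborel_affine) (auto simp: g ennreal_mult_less_top)
    finally show ?thesis .
  qed
  have "exp (- a * (norm z)\<^sup>2) = (\<Prod>b\<in>Basis. exp (- a * (z \<bullet> b)\<^sup>2))" for z :: 'a
    by (simp add: norm_eq_sqrt_inner euclidean_inner[of z z] power2_eq_square sum_nonneg
        sum_distrib_left sum_negf flip: exp_sum)
  then have "(\<integral>\<^sup>+z. ennreal (exp (- a * (norm z)\<^sup>2)) \<partial>(lborel::'a measure))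
      = (\<integral>\<^sup>+z. (\<Prod>b\<in>Basis. ennreal (exp (- a * (z \<bullet> b)\<^sup>2))) \<partial>(lborel::'a measure))"
    by (simp add: prod_ennreal)
  also have "\<dots> = (\<Prod>b\<in>(Basis::'a set). \<integral>\<^sup>+x. ennreal (exp (- a * x\<^sup>2)) \<partial>lborel)"
    by (rule nn_integral_lborel_prod) auto
  also have "\<dots> < \<infinity>"
    using fin1 by (simp add: less_top[symmetric] power_eq_top_ennreal_iff)
  finally show "(\<integral>\<^sup>+z. ennreal (exp (- a * (norm z)\<^sup>2)) \<partial>(lborel::'a measure)) < \<infinity>" .
qed auto

text \<open>Truncated subtraction gives the right value beyond the degree: for \<open>m > n\<close>
  the factor with \<open>i = n\<close> is 0.\<close>

lemma higher_deriv_monomial: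
  "(deriv ^^ m) (\<lambda>w::complex. w ^ n) = (\<lambda>w. (\<Prod>i<m. of_nat (n - i)) * w ^ (n - m))"
proof (induction m)
  case (Suc m)
  have "deriv (\<lambda>w::complex. c * w ^ k) = (\<lambda>w. c * of_nat k * w ^ (k - 1))" for c k
    by (intro ext DERIV_imp_deriv) (auto intro!: derivative_eq_intros)
  then show ?case
    by (simp add: Suc)
qed simp

lemma higher_deriv_polynomial_0:
  "(deriv ^^ m) (\<lambda>w. \<Sum>j<M. c j * w ^ j) 0 = (if m < M then c m * fact m else (0::complex))"
proof (induction M)
  case (Suc M)
  have "(deriv ^^ m) (\<lambda>w. w ^ M) 0 = (if m = M then fact m else (0::complex))"
    by (cases m M rule: linorder_cases)
       (auto simp: higher_deriv_monomial power_0_left fact_prod_rev lessThan_atLeast0)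
  moreover have "(deriv ^^ m) (\<lambda>w. (\<Sum>j<M. c j * w ^ j) + c M * w ^ M) 0
      = (deriv ^^ m) (\<lambda>w. \<Sum>j<M. c j * w ^ j) 0 + c M * (deriv ^^ m) (\<lambda>w. w ^ M) 0"
    by (subst higher_deriv_add[of _ UNIV], (intro holomorphic_intros)+, simp, simp)
       (subst higher_deriv_cmult[of _ UNIV], (intro holomorphic_intros)+, auto)
  ultimately show ?case
    using Suc by (auto simp: less_Suc_eq)
qed (induction m, auto)

lemma integral_cmod_sq_nonneg: "0 \<le> integral X (\<lambda>t. (cmod (g t))\<^sup>2)"
  by (cases "(\<lambda>t. (cmod (g t))\<^sup>2) integrable_on X")
     (auto intro: Henstock_Kurzweil_Integration.integral_nonneg simp: not_integrable_integral)

text \<open>\<open>h\<close> and \<open>S\<close> share the Taylor coefficients below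
  \<open>M\<close>, so on the circle \<open>S\<close> is the orthogonal projection of
  \<open>h\<close> to the first \<open>M\<close> Fourier modes. Hence \<open>h - S\<close> is
  orthogonal to \<open>S\<close> and Pythagoras applies.\<close>

lemma circ_orthogonality:
  fixes M :: nat
  assumes h: "h holomorphic_on UNIV"
  defines "S \<equiv> (\<lambda>w. \<Sum>m<M. (deriv ^^ m) h 0 / fact m * w ^ m)"
  shows "integral {0..1} (\<lambda>t. (cmod (h (circ t)))\<^sup>2) =
    integral {0..1} (\<lambda>t. (cmod (h (circ t) - S (circ t)))\<^sup>2) + integral {0..1} (\<lambda>t. (cmod (S (circ t)))\<^sup>2)"
proof -
  have hS: "S holomorphic_on UNIV"
    unfolding S_def by (intro holomorphic_intros)
  have derivS: "(deriv ^^ m) S 0 = (deriv ^^ m) h 0" if "m < M" for m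
    unfolding S_def higher_deriv_polynomial_0 using that by simp
  have "((\<lambda>t. (h (circ t) - S (circ t)) * cnj (S (circ t))) has_integral
     (\<Sum>m<M. cnj ((deriv ^^ m) h 0 / fact m) * ((deriv ^^ m) h 0 / fact m - (deriv ^^ m) S 0 / fact m))) {0..1}"
  proof -
    have "((\<lambda>t. \<Sum>m<M. cnj ((deriv ^^ m) h 0 / fact m) *
        (h (circ t) * cnj (circ t) ^ m - S (circ t) * cnj (circ t) ^ m)) has_integral
       (\<Sum>m<M. cnj ((deriv ^^ m) h 0 / fact m) * ((deriv ^^ m) h 0 / fact m - (deriv ^^ m) S 0 / fact m))) {0..1}"
      by (intro has_integral_sum has_integral_mult_right has_integral_diff Cauchy_circ h hS) auto
    moreover have "(\<Sum>m<M. cnj ((deriv ^^ m) h 0 / fact m) *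
        (h (circ t) * cnj (circ t) ^ m - S (circ t) * cnj (circ t) ^ m)) = (h (circ t) - S (circ t)) * cnj (S (circ t))" for t
    proof -
      have "cnj (S w) = (\<Sum>m<M. cnj ((deriv ^^ m) h 0 / fact m) * cnj w ^ m)" for w
        by (simp add: S_def)
      then show ?thesis
        by (simp add: sum_distrib_left left_diff_distrib right_diff_distrib diff_divide_distrib mult_ac)
    qed
    ultimately show ?thesis by simp
  qed
  then have "((\<lambda>t. (h (circ t) - S (circ t)) * cnj (S (circ t))) has_integral 0) {0..1}"
    by (simp add: derivS)
  from has_integral_linear[OF this bounded_linear_Re]
  have cross: "((\<lambda>t. 2 * Re ((h (circ t) - S (circ t)) * cnj (S (circ t)))) has_integral 0) {0..1}"
    using has_integral_mult_right[of "\<lambda>t. Re ((h (circ t) - S (circ t)) * cnj (S (circ t)))" 0 "{0..1}" 2]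
    by (simp add: o_def)
  have ch: "continuous_on {0..1} (\<lambda>t. h (circ t))" and cS: "continuous_on {0..1} (\<lambda>t. S (circ t))"
    by (intro continuous_on_compose2[OF holomorphic_on_imp_continuous_on[OF h] continuous_on_circ]
        continuous_on_compose2[OF holomorphic_on_imp_continuous_on[OF hS] continuous_on_circ] subset_UNIV)+
  have int1: "(\<lambda>t. (cmod (h (circ t) - S (circ t)))\<^sup>2) integrable_on {0..1}"
    and int2: "(\<lambda>t. (cmod (S (circ t)))\<^sup>2) integrable_on {0..1}"
    by (intro integrable_continuous_real continuous_intros ch cS)+
  have "(cmod x)\<^sup>2 = (cmod (x - y))\<^sup>2 + (cmod y)\<^sup>2 + 2 * Re ((x - y) * cnj y)" for x y
    by (simp only: cmod_power2) (simp add: power2_eq_square algebra_simps)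
  then have "(\<lambda>t. (cmod (h (circ t)))\<^sup>2) = (\<lambda>t. (cmod (h (circ t) - S (circ t)))\<^sup>2 + (cmod (S (circ t)))\<^sup>2
      + 2 * Re ((h (circ t) - S (circ t)) * cnj (S (circ t))))"
    by blast
  moreover have "((\<lambda>t. (cmod (h (circ t) - S (circ t)))\<^sup>2 + (cmod (S (circ t)))\<^sup>2
      + 2 * Re ((h (circ t) - S (circ t)) * cnj (S (circ t)))) has_integral
      (integral {0..1} (\<lambda>t. (cmod (h (circ t) - S (circ t)))\<^sup>2) + integral {0..1} (\<lambda>t. (cmod (S (circ t)))\<^sup>2) + 0)) {0..1}"
    by (intro has_integral_add integrable_integral int1 int2 cross)
  ultimately show ?thesis
    by (simp add: integral_unique)
qed

lemma nn_integral_circ: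
  assumes "g holomorphic_on UNIV"
  shows "(\<integral>\<^sup>+t. indicator {0..1} t * ennreal ((cmod (g (circ t)))\<^sup>2) \<partial>lborel)
    = ennreal (integral {0..1} (\<lambda>t. (cmod (g (circ t)))\<^sup>2))"
proof -
  have "(\<lambda>t. (cmod (g (circ t)))\<^sup>2) integrable_on {0..1}"
    by (intro integrable_continuous_real continuous_intros
        continuous_on_compose2[OF holomorphic_on_imp_continuous_on[OF assms] continuous_on_circ]) auto
  then show ?thesis
    using nn_integral_has_integral_lebesgue[of "{0..1}" "\<lambda>t. (cmod (g (circ t)))\<^sup>2"]
    by (simp add: has_integral_integral ennreal_mult' ennreal_indicator nn_integral_completion)
qed

lemma circ_Bessel:
  assumes h: "h holomorphic_on UNIV"
  shows "(\<integral>\<^sup>+t. indicator {0..1} t * ennreal ((cmod (h (circ t) - (\<Sum>m<M. (deriv ^^ m) h 0 / fact m * circ t ^ m)))\<^sup>2) \<partial>lborel)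
    \<le> (\<integral>\<^sup>+t. indicator {0..1} t * ennreal ((cmod (h (circ t)))\<^sup>2) \<partial>lborel)"
proof -
  have hol: "(\<lambda>w. h w - (\<Sum>m<M. (deriv ^^ m) h 0 / fact m * w ^ m)) holomorphic_on UNIV"
    by (intro holomorphic_intros h)
  show ?thesis
    unfolding nn_integral_circ[OF hol] nn_integral_circ[OF h] circ_orthogonality[OF h, of M]
    by (intro ennreal_leI) (simp add: integral_cmod_sq_nonneg)
qed

text \<open>The case \<open>M = 1\<close> of the orthogonal decomposition, where the projection is
  the constant \<open>h 0\<close>.\<close>

lemma circ_mean_value:
  assumes h: "h holomorphic_on UNIV"
  shows "ennreal ((cmod (h 0))\<^sup>2) \<le> (\<integral>\<^sup>+t. indicator {0..1} t * ennreal ((cmod (h (circ t)))\<^sup>2) \<partial>lborel)"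
  unfolding nn_integral_circ[OF h]
  using circ_orthogonality[OF h, of 1] by (simp add: ennreal_leI integral_cmod_sq_nonneg)

section \<open>The Fock norm\<close>

lemma fock_weight_pos [simp]: "fock_weight z > 0"
  by (simp add: fock_weight_def)

lemma fock_weight_nonneg [simp]: "fock_weight z \<ge> 0"
  by (simp add: fock_weight_def)

lemma fock_weight_borel [measurable]: "fock_weight \<in> borel_measurable borel"
  unfolding fock_weight_def by measurable

lemma fock_space_entire: "f \<in> fock_space \<Longrightarrow> entire_fun f"
  by (simp add: fock_space_def)

text \<open>The squared norm without its normalising factor. As a nonnegative integral it is
  meaningful before integrability is known, so membership in the Fock space becomes
  finiteness.\<close>

definition fock_int :: "(complex^'n \<Rightarrow> complex) \<Rightarrow> ennreal" where
  "fock_int f = (\<integral>\<^sup>+z. ennreal ((cmod (f z))\<^sup>2 * fock_weight z) \<partial>lborel)"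

lemma fock_space_iff: "f \<in> fock_space \<longleftrightarrow> entire_fun f \<and> fock_int f < \<infinity>"
proof -
  have "integrable lborel (\<lambda>z. (cmod (f z))\<^sup>2 * fock_weight z) \<longleftrightarrow> fock_int f < \<infinity>" if "entire_fun f"
  proof -
    have [measurable]: "f \<in> borel_measurable borel"
      using that by (rule entire_fun_borel)
    show ?thesis
      by (subst integrable_iff_bounded) (simp add: fock_int_def)
  qed
  then show ?thesis
    by (auto simp: fock_space_def)
qed

lemma fock_norm_nonneg [simp]: "0 \<le> fock_norm f"
  by (auto simp: fock_norm_def)

lemma fock_int_eq:
  fixes f :: "complex^'n \<Rightarrow> complex"
  assumes "f \<in> fock_space"
  shows "fock_int f = ennreal ((2 * pi) ^ CARD('n) * (fock_norm f)\<^sup>2)"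
proof -
  have "fock_int f = ennreal (integral\<^sup>L lborel (\<lambda>z. (cmod (f z))\<^sup>2 * fock_weight z))"
    unfolding fock_int_def
    by (rule nn_integral_eq_integral) (use assms in \<open>auto simp: fock_space_def\<close>)
  then show ?thesis
    by (simp add: fock_norm_def field_simps)
qed

lemma fock_norm_le_iff:
  fixes f :: "complex^'n \<Rightarrow> complex"
  assumes "f \<in> fock_space" "0 \<le> K"
  shows "fock_norm f \<le> K \<longleftrightarrow> fock_int f \<le> ennreal ((2 * pi) ^ CARD('n) * K\<^sup>2)"
  using assms by (simp add: fock_int_eq)

text \<open>Young's inequality with weights made for the triangle inequality: replacing
  \<open>cmod x\<close> and \<open>cmod y\<close> by \<open>A\<close> and \<open>B\<close> turns the
  right-hand side into \<open>(A + B)^2\<close>.\<close>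

lemma cmod_add_square_le:
  assumes "A > 0" "B > 0"
  shows "(cmod (x + y))\<^sup>2 \<le> (1 + B / A) * (cmod x)\<^sup>2 + (1 + A / B) * (cmod y)\<^sup>2"
proof -
  have "(cmod (x + y))\<^sup>2 \<le> (cmod x + cmod y)\<^sup>2"
    by (intro power_mono norm_triangle_ineq) auto
  moreover have "(1 + B / A) * (cmod x)\<^sup>2 + (1 + A / B) * (cmod y)\<^sup>2 - (cmod x + cmod y)\<^sup>2
      = (B * cmod x - A * cmod y)\<^sup>2 / (A * B)"
    using assms by (simp add: field_simps power2_eq_square)
  moreover have "(B * cmod x - A * cmod y)\<^sup>2 / (A * B) \<ge> 0"
    using assms by simp
  ultimately show ?thesis by linarith
qed

lemma fock_int_add_le:
  fixes f g :: "complex^'n \<Rightarrow> complex"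
  assumes "entire_fun f" "entire_fun g" "A > 0" "B > 0"
  shows "fock_int (\<lambda>z. f z + g z) \<le> ennreal (1 + B / A) * fock_int f + ennreal (1 + A / B) * fock_int g"
proof -
  have [measurable]: "f \<in> borel_measurable borel" "g \<in> borel_measurable borel"
    using assms by (auto intro: entire_fun_borel)
  have "fock_int (\<lambda>z. f z + g z) \<le> (\<integral>\<^sup>+z. ennreal (1 + B / A) * ennreal ((cmod (f z))\<^sup>2 * fock_weight z)
      + ennreal (1 + A / B) * ennreal ((cmod (g z))\<^sup>2 * fock_weight z) \<partial>lborel)"
    unfolding fock_int_def
  proof (rule nn_integral_mono)
    fix z
    have "(cmod (f z + g z))\<^sup>2 * fock_weight z
        \<le> ((1 + B / A) * (cmod (f z))\<^sup>2 + (1 + A / B) * (cmod (g z))\<^sup>2) * fock_weight z"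
      by (intro mult_right_mono cmod_add_square_le assms) auto
    then have "(cmod (f z + g z))\<^sup>2 * fock_weight z
        \<le> (1 + B / A) * ((cmod (f z))\<^sup>2 * fock_weight z) + (1 + A / B) * ((cmod (g z))\<^sup>2 * fock_weight z)"
      by (simp add: algebra_simps)
    then show "ennreal ((cmod (f z + g z))\<^sup>2 * fock_weight z)
      \<le> ennreal (1 + B / A) * ennreal ((cmod (f z))\<^sup>2 * fock_weight z)
      + ennreal (1 + A / B) * ennreal ((cmod (g z))\<^sup>2 * fock_weight z)"
      using assms(3,4) by (simp flip: ennreal_mult ennreal_plus)
  qed
  also have "\<dots> = ennreal (1 + B / A) * fock_int f + ennreal (1 + A / B) * fock_int g"
    unfolding fock_int_def by (subst nn_integral_add) (auto simp: nn_integral_cmult)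
  finally show ?thesis .
qed

lemma fock_space_add:
  assumes "f \<in> fock_space" "g \<in> fock_space"
  shows "(\<lambda>z. f z + g z) \<in> fock_space"
  using fock_int_add_le[of f g 1 1] assms
  by (auto simp: fock_space_iff entire_fun_add ennreal_mult_less_top
      intro: le_less_trans)

lemma fock_norm_triangle:
  fixes f g :: "complex^'n \<Rightarrow> complex"
  assumes f: "f \<in> fock_space" and g: "g \<in> fock_space"
  shows "fock_norm (\<lambda>z. f z + g z) \<le> fock_norm f + fock_norm g"
proof (rule field_le_epsilon)
  fix e :: real assume "e > 0"
  \<comment> \<open>The surplus \<open>e / 2\<close> keeps \<open>A\<close> and \<open>B\<close>
    positive even when a norm is 0.\<close>
  define A where "A = fock_norm f + e / 2"
  define B where "B = fock_norm g + e / 2"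
  have AB: "A > 0" "B > 0"
    using \<open>e > 0\<close> by (auto simp: A_def B_def add_nonneg_pos)
  have "fock_int (\<lambda>z. f z + g z) \<le> ennreal (1 + B / A) * fock_int f + ennreal (1 + A / B) * fock_int g"
    using f g AB by (intro fock_int_add_le) (auto simp: fock_space_entire)
  also have "\<dots> \<le> ennreal (1 + B / A) * ennreal ((2 * pi) ^ CARD('n) * A\<^sup>2)
      + ennreal (1 + A / B) * ennreal ((2 * pi) ^ CARD('n) * B\<^sup>2)"
    using \<open>e > 0\<close> AB
    by (intro add_mono mult_left_mono fock_norm_le_iff[THEN iffD1] f g) (auto simp: A_def B_def)
  also have "\<dots> = ennreal ((1 + B / A) * ((2 * pi) ^ CARD('n) * A\<^sup>2) + (1 + A / B) * ((2 * pi) ^ CARD('n) * B\<^sup>2))"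
    using AB by (simp flip: ennreal_mult ennreal_plus)
  also have "(1 + B / A) * ((2 * pi) ^ CARD('n) * A\<^sup>2) + (1 + A / B) * ((2 * pi) ^ CARD('n) * B\<^sup>2)
     = (2 * pi) ^ CARD('n) * (A + B)\<^sup>2"
    using AB by (simp add: field_simps power2_eq_square)
  finally have "fock_norm (\<lambda>z. f z + g z) \<le> A + B"
    using AB by (subst fock_norm_le_iff) (auto intro: fock_space_add f g)
  then show "fock_norm (\<lambda>z. f z + g z) \<le> fock_norm f + fock_norm g + e"
    by (simp add: A_def B_def)
qed

lemma fock_space_cmult: "f \<in> fock_space \<Longrightarrow> (\<lambda>z. c * f z) \<in> fock_space"
  unfolding fock_space_def
  by (auto intro!: entire_fun_mult entire_fun_const simp: norm_mult power_mult_distrib mult.assoc)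

lemma fock_norm_cmult: "fock_norm (\<lambda>z. c * f z) = cmod c * fock_norm f"
  by (simp add: fock_norm_def norm_mult power_mult_distrib mult.assoc real_sqrt_mult)

lemma fock_space_diff: "f \<in> fock_space \<Longrightarrow> g \<in> fock_space \<Longrightarrow> (\<lambda>z. f z - g z) \<in> fock_space"
  using fock_space_add[of f "\<lambda>z. (-1) * g z"] fock_space_cmult[of g "-1"] by simp

lemma fock_norm_zero: "fock_norm (\<lambda>z. 0) = 0"
  by (simp add: fock_norm_def)

lemma fock_space_zero: "(\<lambda>z. 0) \<in> fock_space"
  by (simp add: fock_space_def entire_fun_const)

lemma fock_space_sum: "(\<And>i. i \<in> I \<Longrightarrow> f i \<in> fock_space) \<Longrightarrow> (\<lambda>z. \<Sum>i\<in>I. f i z) \<in> fock_space"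
  by (induction I rule: infinite_finite_induct) (auto intro: fock_space_add fock_space_zero)

lemma fock_norm_sum_le:
  "(\<And>i. i \<in> I \<Longrightarrow> f i \<in> fock_space) \<Longrightarrow> fock_norm (\<lambda>z. \<Sum>i\<in>I. f i z) \<le> (\<Sum>i\<in>I. fock_norm (f i))"
proof (induction I rule: infinite_finite_induct)
  case (insert i I)
  then show ?case
    using fock_norm_triangle[of "f i" "\<lambda>z. \<Sum>i\<in>I. f i z"] by (auto simp: fock_space_sum)
qed (auto simp: fock_norm_zero)

text \<open>The square of the bound times the weight is a multiple of
  \<open>exp (- |z|^2 / 4)\<close>, which is integrable. As \<open>G\<close> is independent of
  \<open>f\<close>, pointwise estimates become norm estimates with the same dependence on
  \<open>K\<close>.\<close>

lemma fock_space_dominated: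
  obtains G where "G \<ge> 0" "\<And>(f::complex^'n \<Rightarrow> complex) K. entire_fun f \<Longrightarrow>
    (\<And>z. cmod (f z) \<le> K * exp ((norm z)\<^sup>2 / 8)) \<Longrightarrow> f \<in> fock_space \<and> fock_norm f \<le> K * G"
proof
  let ?E = "\<lambda>z::complex^'n. exp (- (1/4) * (norm z)\<^sup>2)"
  let ?c = "(2 * pi) ^ CARD('n)"
  define G where "G = sqrt (inverse ?c * integral\<^sup>L lborel ?E)"
  have intE: "integrable lborel ?E"
    by (rule integrable_exp_minus_norm_sq) simp
  show "G \<ge> 0"
    by (auto simp: G_def)
  fix f :: "complex^'n \<Rightarrow> complex" and K
  assume f: "entire_fun f" and le: "\<And>z. cmod (f z) \<le> K * exp ((norm z)\<^sup>2 / 8)"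
  have K: "K \<ge> 0"
    using order_trans[OF norm_ge_zero le[of 0]] by simp
  have le': "(cmod (f z))\<^sup>2 * fock_weight z \<le> K\<^sup>2 * ?E z" for z
  proof -
    have "(cmod (f z))\<^sup>2 \<le> (K * exp ((norm z)\<^sup>2 / 8))\<^sup>2"
      by (intro power_mono le) auto
    then have "(cmod (f z))\<^sup>2 * fock_weight z \<le> (K * exp ((norm z)\<^sup>2 / 8))\<^sup>2 * fock_weight z"
      by (intro mult_right_mono) auto
    also have "\<dots> = K\<^sup>2 * ?E z"
      by (simp add: fock_weight_def power_mult_distrib mult.assoc flip: exp_double exp_add)
    finally show ?thesis .
  qed
  have [measurable]: "f \<in> borel_measurable borel"
    using f by (rule entire_fun_borel)
  have int: "integrable lborel (\<lambda>z. (cmod (f z))\<^sup>2 * fock_weight z)"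
    by (rule Bochner_Integration.integrable_bound[OF integrable_mult_right[OF intE, of "K\<^sup>2"]])
       (use le' in \<open>auto simp: abs_mult\<close>)
  have "integral\<^sup>L lborel (\<lambda>z. (cmod (f z))\<^sup>2 * fock_weight z) \<le> integral\<^sup>L lborel (\<lambda>z. K\<^sup>2 * ?E z)"
    by (intro integral_mono int integrable_mult_right intE le')
  then have "fock_norm f \<le> sqrt (inverse ?c * (K\<^sup>2 * integral\<^sup>L lborel ?E))"
    unfolding fock_norm_def by (intro real_sqrt_le_mono mult_left_mono) auto
  also have "\<dots> = K * G"
    using K by (simp add: G_def real_sqrt_mult)
  finally show "f \<in> fock_space \<and> fock_norm f \<le> K * G"
    using f int by (simp add: fock_space_def)
qed

text \<open>The square of the modulus satisfies the sub-mean value inequality on circles, hence on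
  the unit ball around the point, where the weight is bounded below.\<close>

lemma fock_point_evaluation_bound:
  fixes R :: real
  obtains C where "C \<ge> 0"
    "\<And>(f::complex^'n \<Rightarrow> complex) z. f \<in> fock_space \<Longrightarrow> norm z \<le> R \<Longrightarrow> cmod (f z) \<le> C * fock_norm f"
proof
  let ?c = "(2 * pi) ^ CARD('n)"
  define B where "B = ball (0::complex^'n) 1"
  define V where "V = measure lborel B"
  \<comment> \<open>The reciprocal of the smallest value of the weight on the ball of radius
    \<open>R + 1\<close>.\<close>
  define W where "W = exp ((R + 1)\<^sup>2 / 2)"
  have V: "V > 0"
    by (simp add: V_def B_def content_ball_pos)
  have EV: "emeasure lborel B = ennreal V"
    unfolding V_def B_def using emeasure_lborel_ball_finite[of "0::complex^'n" 1]
    by (intro emeasure_eq_ennreal_measure) auto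
  have [measurable]: "B \<in> sets borel"
    by (simp add: B_def)
  define C where "C = sqrt (W * ?c / V)"
  show "C \<ge> 0"
    using V by (simp add: C_def W_def)
  fix f :: "complex^'n \<Rightarrow> complex" and p :: "complex^'n"
  assume f: "f \<in> fock_space" and p: "norm p \<le> R"
  have [measurable]: "f \<in> borel_measurable borel"
    using f by (intro entire_fun_borel fock_space_entire)
  have "ennreal (V * (cmod (f p))\<^sup>2) = (\<integral>\<^sup>+z. indicator B z * ennreal ((cmod (f p))\<^sup>2) \<partial>lborel)"
    using V by (simp add: nn_integral_multc EV ennreal_mult)
  also have "\<dots> \<le> (\<integral>\<^sup>+z. (\<integral>\<^sup>+t. indicator {0..1} t *
      (indicator B (circ t *s z) * ennreal ((cmod (f (p + circ t *s z)))\<^sup>2)) \<partial>lborel) \<partial>lborel)"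
  proof (rule nn_integral_mono)
    fix z
    have ind: "indicator B (circ t *s z) = (indicator B z :: ennreal)" for t
      by (simp add: B_def indicator_def norm_scalar_mult_complex)
    have [measurable]: "(\<lambda>t. f (p + circ t *s z)) \<in> borel_measurable borel"
      by (intro borel_measurable_continuous_onI continuous_intros
          continuous_on_compose2[OF entire_fun_continuous_on[OF fock_space_entire[OF f], of UNIV]]) auto
    have "ennreal ((cmod (f p))\<^sup>2) \<le> (\<integral>\<^sup>+t. indicator {0..1} t * ennreal ((cmod (f (p + circ t *s z)))\<^sup>2) \<partial>lborel)"
      using circ_mean_value[OF entire_fun_holomorphic_line[OF fock_space_entire[OF f]], of p z] by simp
    then have "indicator B z * ennreal ((cmod (f p))\<^sup>2)
        \<le> indicator B z * (\<integral>\<^sup>+t. indicator {0..1} t * ennreal ((cmod (f (p + circ t *s z)))\<^sup>2) \<partial>lborel)"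
      by (rule mult_left_mono) simp
    also have "\<dots> = (\<integral>\<^sup>+t. indicator {0..1} t *
      (indicator B (circ t *s z) * ennreal ((cmod (f (p + circ t *s z)))\<^sup>2)) \<partial>lborel)"
      by (subst nn_integral_cmult[symmetric]) (auto simp: ind mult_ac)
    finally show "indicator B z * ennreal ((cmod (f p))\<^sup>2) \<le> \<dots>" .
  qed
  also have "\<dots> = (\<integral>\<^sup>+z. indicator B z * ennreal ((cmod (f (p + z)))\<^sup>2) \<partial>lborel)"
    by (rule nn_integral_circ_average) measurable
  also have "\<dots> \<le> (\<integral>\<^sup>+z. ennreal W * ennreal ((cmod (f (p + 1 *\<^sub>R z)))\<^sup>2 * fock_weight (p + 1 *\<^sub>R z)) \<partial>lborel)"
  proof (rule nn_integral_mono)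
    fix z
    show "indicator B z * ennreal ((cmod (f (p + z)))\<^sup>2)
        \<le> ennreal W * ennreal ((cmod (f (p + 1 *\<^sub>R z)))\<^sup>2 * fock_weight (p + 1 *\<^sub>R z))"
    proof (cases "z \<in> B")
      case True
      then have "norm (p + z) \<le> R + 1"
        using p norm_triangle_ineq[of p z] by (simp add: B_def)
      then have "(norm (p + z))\<^sup>2 \<le> (R + 1)\<^sup>2"
        by (intro power_mono) auto
      then have "1 \<le> W * fock_weight (p + z)"
        by (simp add: W_def fock_weight_def flip: exp_add)
      then have "(cmod (f (p + z)))\<^sup>2 * 1 \<le> (cmod (f (p + z)))\<^sup>2 * (W * fock_weight (p + z))"
        by (rule mult_left_mono) simp
      then show ?thesis
        using True by (simp add: W_def mult_ac flip: ennreal_mult)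
    qed simp
  qed
  also have "\<dots> = ennreal W * (\<integral>\<^sup>+z. ennreal ((cmod (f (p + 1 *\<^sub>R z)))\<^sup>2 * fock_weight (p + 1 *\<^sub>R z)) \<partial>lborel)"
    by (rule nn_integral_cmult) measurable
  also have "\<dots> = ennreal W * fock_int f"
    unfolding fock_int_def by (subst nn_integral_lborel_affine) auto
  also have "\<dots> = ennreal (W * (?c * (fock_norm f)\<^sup>2))"
    by (simp add: fock_int_eq[OF f] W_def flip: ennreal_mult)
  finally have "V * (cmod (f p))\<^sup>2 \<le> W * (?c * (fock_norm f)\<^sup>2)"
    by (simp add: W_def)
  then have "(cmod (f p))\<^sup>2 \<le> W * ?c / V * (fock_norm f)\<^sup>2"
    using V by (simp add: field_simps)
  then have "sqrt ((cmod (f p))\<^sup>2) \<le> sqrt (W * ?c / V * (fock_norm f)\<^sup>2)"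
    by (rule real_sqrt_le_mono)
  then show "cmod (f p) \<le> C * fock_norm f"
    by (simp add: C_def real_sqrt_mult real_sqrt_divide)
qed

section \<open>Density of the polynomials\<close>

text \<open>Generated from the constant by multiplications with coordinates: a linear space of
  functions contains all polynomials once it contains 1 and is stable under these
  multiplications.\<close>

inductive_set polyfuns :: "(complex^'n \<Rightarrow> complex) set" where
  one: "(\<lambda>z. 1) \<in> polyfuns"
| add: "f \<in> polyfuns \<Longrightarrow> g \<in> polyfuns \<Longrightarrow> (\<lambda>z. f z + g z) \<in> polyfuns"
| cmult: "f \<in> polyfuns \<Longrightarrow> (\<lambda>z. c * f z) \<in> polyfuns"
| coord: "f \<in> polyfuns \<Longrightarrow> (\<lambda>z. z $ j * f z) \<in> polyfuns"

lemma polyfuns_zero: "(\<lambda>z. 0) \<in> polyfuns"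
  using polyfuns.cmult[OF polyfuns.one, of 0] by simp

lemma polyfuns_sum: "(\<And>i. i \<in> I \<Longrightarrow> f i \<in> polyfuns) \<Longrightarrow> (\<lambda>z. \<Sum>i\<in>I. f i z) \<in> polyfuns"
  by (induction I rule: infinite_finite_induct) (auto intro: polyfuns.add polyfuns_zero)

lemma polyfuns_mult: "f \<in> polyfuns \<Longrightarrow> g \<in> polyfuns \<Longrightarrow> (\<lambda>z. f z * g z) \<in> polyfuns"
  by (induction f rule: polyfuns.induct)
     (auto simp: distrib_right mult.assoc intro: polyfuns.intros)

lemma polyfuns_const: "(\<lambda>z. c) \<in> polyfuns"
  using polyfuns.cmult[OF polyfuns.one, of c] by simp

lemma polyfuns_power: "f \<in> polyfuns \<Longrightarrow> (\<lambda>z. f z ^ n) \<in> polyfuns"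
  by (induction n) (auto intro: polyfuns.one polyfuns_mult)

lemma polyfuns_prod: "(\<And>i. i \<in> I \<Longrightarrow> f i \<in> polyfuns) \<Longrightarrow> (\<lambda>z. \<Prod>i\<in>I. f i z) \<in> polyfuns"
  by (induction I rule: infinite_finite_induct) (auto intro: polyfuns.one polyfuns_mult)

lemma polyfuns_coord: "(\<lambda>z. z $ j) \<in> polyfuns"
  using polyfuns.coord[OF polyfuns.one] by simp

lemma entire_fun_coord: "entire_fun (\<lambda>z. z $ j)"
  by (rule entire_funI) (auto intro!: exI[of _ "\<lambda>h. h $ j"] bounded_linear.has_derivative[OF bounded_linear_vec_nth]
      has_derivative_ident)

lemma polyfuns_entire: "f \<in> polyfuns \<Longrightarrow> entire_fun f"
  by (induction f rule: polyfuns.induct)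
     (auto intro: entire_fun_const entire_fun_add entire_fun_mult entire_fun_coord)

lemma dirderiv_coord: "dirderiv v (\<lambda>z. z $ j) z = v $ j"
  by (rule dirderiv_eq[where L = "\<lambda>h. h $ j"])
     (auto intro!: bounded_linear.has_derivative[OF bounded_linear_vec_nth] has_derivative_ident)

text \<open>Quantifying over every rate \<epsilon> makes the induction work: a coordinate factor
  spends \<open>\<epsilon> / 2\<close> and leaves the other half to the induction
  hypothesis.\<close>

lemma polyfuns_growth:
  fixes f :: "complex^'n \<Rightarrow> complex"
  assumes "f \<in> polyfuns" "\<epsilon> > 0"
  shows "\<exists>K\<ge>0. \<forall>z. cmod (f z) \<le> K * exp (\<epsilon> * norm z)"
  using assms
proof (induction f arbitrary: \<epsilon> rule: polyfuns.induct)
  case one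
  then show ?case by (intro exI[of _ 1]) auto
next
  case (add f g)
  obtain K1 K2 where "K1 \<ge> 0" "\<And>z. cmod (f z) \<le> K1 * exp (\<epsilon> * norm z)"
    "K2 \<ge> 0" "\<And>z. cmod (g z) \<le> K2 * exp (\<epsilon> * norm z)"
    using add by meson
  then show ?case
    by (intro exI[of _ "K1 + K2"]) (auto simp: distrib_right intro: order_trans[OF norm_triangle_ineq add_mono])
next
  case (cmult f c)
  obtain K where "K \<ge> 0" "\<And>z. cmod (f z) \<le> K * exp (\<epsilon> * norm z)"
    using cmult by meson
  then show ?case
    by (intro exI[of _ "cmod c * K"]) (auto simp: norm_mult mult.assoc intro: mult_left_mono)
next
  case (coord f j)
  obtain K where K: "K \<ge> 0" "\<And>z. cmod (f z) \<le> K * exp (\<epsilon> / 2 * norm z)"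
    using coord.IH[of "\<epsilon> / 2"] coord.prems by (metis half_gt_zero)
  have "cmod (z $ j * f z) \<le> (2 / \<epsilon> * K) * exp (\<epsilon> * norm z)" for z
  proof -
    have "\<epsilon> / 2 * norm z \<le> exp (\<epsilon> / 2 * norm z)"
      using exp_ge_add_one_self[of "\<epsilon> / 2 * norm z"] by linarith
    then have "norm z \<le> 2 / \<epsilon> * exp (\<epsilon> / 2 * norm z)"
      using coord.prems by (simp add: field_simps)
    moreover have "cmod (z $ j) \<le> norm z"
      by (rule Finite_Cartesian_Product.norm_nth_le)
    ultimately have "cmod (z $ j) \<le> 2 / \<epsilon> * exp (\<epsilon> / 2 * norm z)"
      by linarith
    then have "cmod (z $ j) * cmod (f z) \<le> (2 / \<epsilon> * exp (\<epsilon> / 2 * norm z)) * (K * exp (\<epsilon> / 2 * norm z))"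
      using K coord.prems by (intro mult_mono) auto
    also have "\<dots> = (2 / \<epsilon> * K) * exp (\<epsilon> / 2 * norm z + \<epsilon> / 2 * norm z)"
      by (simp only: exp_add mult_ac)
    finally show ?thesis by (simp add: norm_mult)
  qed
  then show ?case
    using K coord.prems by (intro exI[of _ "2 / \<epsilon> * K"]) auto
qed

lemma exp_linear_le_exp_square: "exp (a * r) \<le> exp (2 * a\<^sup>2) * exp (r\<^sup>2 / 8)" for a r :: real
proof -
  have "a * r \<le> 2 * a\<^sup>2 + r\<^sup>2 / 8"
    using zero_le_power2[of "4 * a - r"] by (simp add: power2_eq_square algebra_simps)
  then show ?thesis
    by (simp flip: exp_add)
qed

lemma polyfuns_growth':
  fixes f :: "complex^'n \<Rightarrow> complex"
  assumes "f \<in> polyfuns"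
  obtains K where "K \<ge> 0" "\<And>z. cmod (f z) \<le> K * exp ((norm z)\<^sup>2 / 8)"
proof -
  obtain K where K: "K \<ge> 0" "\<And>z. cmod (f z) \<le> K * exp (1 * norm z)"
    using polyfuns_growth[OF assms, of 1] by auto
  have "cmod (f z) \<le> (K * exp 2) * exp ((norm z)\<^sup>2 / 8)" for z
    using K(2)[of z] mult_left_mono[OF exp_linear_le_exp_square[of 1 "norm z"] K(1)]
    by (simp add: mult.assoc)
  with K(1) show ?thesis
    by (intro that[of "K * exp 2"]) auto
qed

lemma polyfuns_fock: "f \<in> polyfuns \<Longrightarrow> f \<in> fock_space"
  by (metis fock_space_dominated polyfuns_entire polyfuns_growth')

lemma entire_fun_dirderiv_iter: "entire_fun f \<Longrightarrow> entire_fun ((dirderiv v ^^ m) f)"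
  by (induction m) (auto intro: entire_fun_dirderiv)

lemma dirderiv_iter_scalar_mult:
  "entire_fun f \<Longrightarrow> (dirderiv (c *s v) ^^ m) f = (\<lambda>z. c ^ m * (dirderiv v ^^ m) f z)"
proof (induction m)
  case (Suc m)
  then have "(dirderiv (c *s v) ^^ Suc m) f = dirderiv (c *s v) (\<lambda>z. c ^ m * (dirderiv v ^^ m) f z)"
    by simp
  then show ?case
    using Suc.prems
    by (simp add: dirderiv_fun_cmult dirderiv_scalar_mult entire_fun_dirderiv_iter
        entire_fun_mult entire_fun_const mult_ac)
qed simp

lemma dirderiv_iter_sum:
  assumes "\<And>i. i \<in> I \<Longrightarrow> entire_fun (f i)"
  shows "(dirderiv v ^^ m) (\<lambda>z. \<Sum>i\<in>I. c i * f i z) = (\<lambda>z. \<Sum>i\<in>I. c i * (dirderiv v ^^ m) (f i) z)"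
proof (induction m)
  case (Suc m)
  have "(dirderiv v ^^ Suc m) (\<lambda>z. \<Sum>i\<in>I. c i * f i z)
      = dirderiv v (\<lambda>z. \<Sum>i\<in>I. c i * (dirderiv v ^^ m) (f i) z)"
    by (simp add: Suc)
  then show ?case
    using assms
    by (simp add: dirderiv_fun_sum dirderiv_fun_cmult entire_fun_mult entire_fun_const
        entire_fun_dirderiv_iter)
qed simp

text \<open>Up to a factorial these are the homogeneous parts of the Taylor expansion at
  \<open>p\<close>. Expanding the innermost derivative in axis directions produces one coordinate
  factor and replaces \<open>f\<close> by a partial derivative, so \<open>f\<close> varies in the
  induction.\<close>

lemma dirderiv_iter_polyfun:
  fixes f :: "complex^'n \<Rightarrow> complex"
  shows "entire_fun f \<Longrightarrow> (\<lambda>z. (dirderiv z ^^ m) f p) \<in> polyfuns"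
proof (induction m arbitrary: f)
  case 0
  show ?case by (simp add: polyfuns_const)
next
  case (Suc m)
  have "(\<lambda>z. (dirderiv z ^^ Suc m) f p) = (\<lambda>z. \<Sum>j\<in>UNIV. z $ j * (dirderiv z ^^ m) (dirderiv (axis j 1) f) p)"
  proof
    fix z
    have "dirderiv z f = (\<lambda>w. \<Sum>j\<in>UNIV. z $ j * dirderiv (axis j 1) f w)"
      by (rule ext, rule dirderiv_axis[OF Suc.prems])
    then show "(dirderiv z ^^ Suc m) f p = (\<Sum>j\<in>UNIV. z $ j * (dirderiv z ^^ m) (dirderiv (axis j 1) f) p)"
      unfolding funpow_Suc_right o_def
      by (simp add: dirderiv_iter_sum entire_fun_dirderiv Suc.prems)
  qed
  then show ?case
    by (auto intro!: polyfuns_sum polyfuns.coord Suc.IH entire_fun_dirderiv Suc.prems)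
qed

text \<open>Rotating the variable by the circle turns the Taylor remainder along complex lines into a Fourier
  remainder; by Bessel it is dominated by the mean of the function itself, so dominated convergence applies.\<close>
lemma polyfuns_dense:
  fixes f :: "complex^'n \<Rightarrow> complex"
  assumes f: "f \<in> fock_space" and "\<epsilon> > 0"
  shows "\<exists>q\<in>polyfuns. fock_norm (\<lambda>z. f z - q z) < \<epsilon>"
proof -
  have ent: "entire_fun f"
    using f by (rule fock_space_entire)
  define a where "a = (\<lambda>m z. (dirderiv z ^^ m) f 0 / fact m)"
  define S where "S = (\<lambda>M z. \<Sum>m<M. a m z)"
  have poly_S: "S M \<in> polyfuns" for M
    unfolding S_def a_def divide_inverse
    by (subst mult.commute) (intro polyfuns_sum polyfuns.cmult dirderiv_iter_polyfun ent)
  have a_rot: "a m (c *s z) = a m z * c ^ m" for m c z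
    by (simp add: a_def dirderiv_iter_scalar_mult[OF ent])
  have a_eq: "a m z = (deriv ^^ m) (\<lambda>t. f (t *s z)) 0 / fact m" for m z
    using higher_deriv_along_line[of m f 0 z] by (simp add: a_def)
  have hol: "(\<lambda>t. f (t *s z)) holomorphic_on UNIV" for z
    using entire_fun_holomorphic_line[OF ent, of 0 z UNIV] by simp
  have [measurable]: "f \<in> borel_measurable borel" "S M \<in> borel_measurable borel" for M
    using ent poly_S by (auto intro: entire_fun_borel polyfuns_entire)
  have wrot: "fock_weight (circ t *s z) = fock_weight z" for t and z :: "complex^'n"
    by (simp add: fock_weight_def norm_scalar_mult_complex)
  have [measurable]: "(\<lambda>t. circ t *s z) \<in> borel_measurable borel" for z :: "complex^'n"
    by (intro borel_measurable_continuous_onI continuous_intros)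
  \<comment> \<open>The weighted square error averaged over the circle through \<open>z\<close>: its
    integral is the \<open>fock_int\<close> of the error, while Bessel bounds it by
    \<open>R 0\<close>.\<close>
  define R where "R = (\<lambda>M z. \<integral>\<^sup>+t. indicator {0..1} t *
      ennreal ((cmod (f (circ t *s z) - S M (circ t *s z)))\<^sup>2 * fock_weight (circ t *s z)) \<partial>lborel)"
  have R_eq: "R M z = ennreal (fock_weight z) * (\<integral>\<^sup>+t. indicator {0..1} t *
      ennreal ((cmod (f (circ t *s z) - S M (circ t *s z)))\<^sup>2) \<partial>lborel)" for M z
    unfolding R_def by (subst nn_integral_cmult[symmetric]) (auto simp: wrot ennreal_mult mult_ac)
  have R_meas: "R M \<in> borel_measurable borel" for M
  proof -
    have "(\<lambda>p::(complex^'n) \<times> real. indicator {0..1} (snd p) *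
      ennreal ((cmod (f (circ (snd p) *s fst p) - S M (circ (snd p) *s fst p)))\<^sup>2 * fock_weight (circ (snd p) *s fst p)))
      \<in> borel_measurable (borel \<Otimes>\<^sub>M borel)"
      by measurable
    then show ?thesis
      unfolding R_def
      using lborel.borel_measurable_nn_integral[of "\<lambda>z t. indicator {0..1} t *
      ennreal ((cmod (f (circ t *s z) - S M (circ t *s z)))\<^sup>2 * fock_weight (circ t *s z))" borel]
      by (simp add: split_beta' cong: measurable_cong_sets)
  qed
  have R_int: "(\<integral>\<^sup>+z. R M z \<partial>lborel) = fock_int (\<lambda>z. f z - S M z)" for M
    unfolding R_def fock_int_def
    by (rule nn_integral_circ_average[where F = "\<lambda>z. ennreal ((cmod (f z - S M z))\<^sup>2 * fock_weight z)"]) measurable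
  have R_le: "R M z \<le> R 0 z" for M z
  proof -
    have "(\<lambda>t. S M (circ t *s z)) = (\<lambda>t. \<Sum>m<M. (deriv ^^ m) (\<lambda>t. f (t *s z)) 0 / fact m * circ t ^ m)"
      by (simp add: S_def a_rot) (simp add: a_eq)
    then show ?thesis
      unfolding R_eq using circ_Bessel[OF hol, of z M]
      by (intro mult_left_mono) (simp_all add: S_def fun_eq_iff)
  qed
  have R_lim: "(\<lambda>M. R M z) \<longlonglongrightarrow> 0" for z
  proof -
    have sums: "(\<lambda>m. a m z * w ^ m) sums f (w *s z)" for w
      using holomorphic_power_series[of "\<lambda>t. f (t *s z)" 0 "cmod w + 1" w] hol[of z]
      by (simp add: a_eq) (meson holomorphic_on_subset subset_UNIV)
    \<comment> \<open>Convergence at \<open>2\<close> gives absolute convergence on the unit circle,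
      so the tail bound \<tau> is uniform in \<open>t\<close>.\<close>
    have "summable (\<lambda>m. norm (a m z * 1 ^ m))"
      by (rule powser_insidea[of _ 2]) (use sums[of 2] in \<open>auto simp: sums_iff\<close>)
    then have summ: "summable (\<lambda>m. norm (a m z))"
      by simp
    define \<tau> where "\<tau> = (\<lambda>M. \<Sum>m. norm (a (m + M) z))"
    have \<tau>: "\<tau> \<longlonglongrightarrow> 0"
      unfolding \<tau>_def by (rule suminf_exist_split2[OF summ])
    have tail: "cmod (f (circ t *s z) - S M (circ t *s z)) \<le> \<tau> M" for t M
    proof -
      have "(\<lambda>m. a (m + M) z * circ t ^ (m + M)) sums (f (circ t *s z) - S M (circ t *s z))"
        using sums_split_initial_segment[OF sums[of "circ t"], of M] by (simp add: S_def a_rot)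
      moreover have "summable (\<lambda>m. norm (a (m + M) z * circ t ^ (m + M)))"
        using summ by (simp add: norm_mult norm_power summable_iff_shift[of "\<lambda>m. norm (a m z)"])
      ultimately show ?thesis
        unfolding \<tau>_def using summable_norm[of "\<lambda>m. a (m + M) z * circ t ^ (m + M)"]
        by (simp add: sums_iff norm_mult norm_power)
    qed
    have \<tau>0: "\<tau> M \<ge> 0" for M
      using tail[of 0 M] norm_ge_zero order_trans by blast
    have "R M z \<le> ennreal (fock_weight z * (\<tau> M)\<^sup>2)" for M
    proof -
      have "(\<integral>\<^sup>+t. indicator {0..1} t * ennreal ((cmod (f (circ t *s z) - S M (circ t *s z)))\<^sup>2) \<partial>lborel)
          \<le> (\<integral>\<^sup>+t. indicator {0..1} t * ennreal ((\<tau> M)\<^sup>2) \<partial>(lborel::real measure))"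
        by (intro nn_integral_mono mult_left_mono ennreal_leI power_mono tail) auto
      also have "\<dots> = ennreal ((\<tau> M)\<^sup>2)"
        by (simp add: nn_integral_multc)
      finally show ?thesis
        unfolding R_eq by (auto simp: ennreal_mult intro: mult_left_mono)
    qed
    moreover have "(\<lambda>M. ennreal (fock_weight z * (\<tau> M)\<^sup>2)) \<longlonglongrightarrow> ennreal (fock_weight z * 0\<^sup>2)"
      by (intro tendsto_ennrealI tendsto_intros \<tau>)
    ultimately show ?thesis
      using tendsto_sandwich[of "\<lambda>_. 0" "\<lambda>M. R M z" sequentially
        "\<lambda>M. ennreal (fock_weight z * (\<tau> M)\<^sup>2)" 0]
    by simp
  qed
  have "(\<lambda>M. \<integral>\<^sup>+z. R M z \<partial>lborel) \<longlonglongrightarrow> (\<integral>\<^sup>+z. 0 \<partial>(lborel :: (complex^'n) measure))"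
  \<comment> \<open>Since \<open>S 0\<close> is zero, the dominating function \<open>R 0\<close> has
    the finite integral \<open>fock_int f\<close>.\<close>
  proof (rule nn_integral_dominated_convergence[where w = "R 0"])
    show "(\<integral>\<^sup>+z. R 0 z \<partial>lborel) < \<infinity>"
      using f by (simp only: R_int) (simp add: S_def fock_space_iff)
  qed (use R_meas R_le R_lim in auto)
  then have lim: "(\<lambda>M. fock_int (\<lambda>z. f z - S M z)) \<longlonglongrightarrow> 0"
    by (simp add: R_int)
  have pos: "ennreal ((2 * pi) ^ CARD('n) * (\<epsilon> / 2)\<^sup>2) > 0"
    using \<open>\<epsilon> > 0\<close> by simp
  obtain M where "fock_int (\<lambda>z. f z - S M z) < ennreal ((2 * pi) ^ CARD('n) * (\<epsilon> / 2)\<^sup>2)"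
    using order_tendstoD(2)[OF lim pos] by (auto simp: eventually_sequentially)
  then have "fock_norm (\<lambda>z. f z - S M z) \<le> \<epsilon> / 2"
    using \<open>\<epsilon> > 0\<close> f poly_S[of M]
    by (subst fock_norm_le_iff) (auto intro: fock_space_diff polyfuns_fock)
  then show ?thesis
    using poly_S[of M] \<open>\<epsilon> > 0\<close> by (intro bexI[of _ "S M"]) auto
qed

section \<open>Linear forms, the fixed point and continuous functionals\<close>

text \<open>Bilinear, without conjugation, so that it is holomorphic in \<open>z\<close>.\<close>

definition lform :: "complex^'n \<Rightarrow> complex^'n \<Rightarrow> complex" where
  "lform u z = (\<Sum>j\<in>UNIV. u $ j * z $ j)"

lemma lform_add: "lform u (x + y) = lform u x + lform u y"
  by (simp add: lform_def distrib_left sum.distrib)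

lemma lform_scale: "lform u (c *s x) = c * lform u x"
  by (simp add: lform_def sum_distrib_left mult_ac)

lemma lform_diff: "lform u (x - y) = lform u x - lform u y"
  by (simp add: lform_def right_diff_distrib sum_subtractf)

lemma lform_zero [simp]: "lform u 0 = 0"
  by (simp add: lform_def)

lemma lform_add_left: "lform (u + v) x = lform u x + lform v x"
  by (simp add: lform_def distrib_right sum.distrib)

lemma lform_scale_left: "lform (c *s u) x = c * lform u x"
  by (simp add: lform_def sum_distrib_left mult_ac)

lemma polyfuns_lform: "lform u \<in> polyfuns"
proof -
  have "(\<lambda>z. \<Sum>j\<in>UNIV. u $ j * z $ j) \<in> polyfuns"
    by (intro polyfuns_sum polyfuns.cmult polyfuns_coord)
  then show ?thesis
    by (simp add: lform_def[abs_def])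
qed

lemma polyfuns_lform_diff: "(\<lambda>z. lform u (z - p)) \<in> polyfuns"
  using polyfuns.add[OF polyfuns_lform polyfuns_const, of u "- lform u p"] by (simp add: lform_diff)

lemma entire_fun_lform: "entire_fun (lform u)"
  by (rule polyfuns_entire[OF polyfuns_lform])

lemma dirderiv_lform: "dirderiv v (lform u) z = lform u v"
  using entire_fun_has_derivative[OF entire_fun_lform]
  by (auto simp: lform_def[abs_def] dirderiv_fun_sum dirderiv_fun_cmult dirderiv_coord
      entire_fun_coord entire_fun_mult entire_fun_const)

lemma lform_separates:
  fixes b :: "complex^'n"
  assumes "b \<notin> vec.span S"
  obtains u where "\<And>s. s \<in> S \<Longrightarrow> lform u s = 0" "lform u b = 1"
proof -
  obtain B where B: "B \<subseteq> S" "vec.independent B" "S \<subseteq> vec.span B"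
    using vec.maximal_independent_subset by blast
  have "b \<notin> vec.span B"
    using assms B(1) vec.span_mono by blast
  then have ind: "vec.independent (insert b B)"
    using B(2) by (simp add: vec.independent_insertI)
  \<comment> \<open>An arbitrary coordinate: reading it off turns the extended linear map into a
    linear form.\<close>
  define k where "k = (undefined :: 'n)"
  obtain g where g: "Vector_Spaces.linear (*s) (*s) g"
    and g_eq: "\<And>x. x \<in> insert b B \<Longrightarrow> g x = (if x = b then axis k 1 else (0::complex^'n))"
    using vec.linear_independent_extend[OF ind, of "\<lambda>x. if x = b then axis k 1 else 0"] by blast
  interpret g: Vector_Spaces.linear "(*s)" "(*s)" g by (rule g)
  define u where "u = (\<chi> j. g (axis j 1) $ k)"
  have u: "lform u x = g x $ k" for x
    by (subst (2) vec_eq_sum_axis) (simp add: g.sum g.scale lform_def u_def mult.commute)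
  have "g x = 0" if "x \<in> B" for x
    using that \<open>b \<notin> vec.span B\<close> g_eq[of x] vec.span_base[of b B] by auto
  then have "g x = 0" if "x \<in> vec.span B" for x
    using vec.linear_eq_0_on_span[OF g _ that] by blast
  then show ?thesis
    using B(3) g_eq[of b] by (intro that[of u]) (auto simp: u)
qed

text \<open>If \<open>u\<close> is nonzero at \<open>x\<close> and \<open>v\<close> at
  \<open>y\<close>, one of \<open>u\<close>, \<open>u + v\<close>, \<open>u + 2 *s v\<close> is
  nonzero at both; the last one serves when \<open>u\<close> vanishes at \<open>y\<close> and
  \<open>u + v\<close> cancels at \<open>x\<close>.\<close>

lemma lform_separates2:
  fixes x y :: "complex^'n"
  assumes "x \<notin> vec.span S" "y \<notin> vec.span S"
  obtains u where "\<And>s. s \<in> S \<Longrightarrow> lform u s = 0" "lform u x \<noteq> 0" "lform u y \<noteq> 0"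
proof -
  obtain u where u: "\<And>s. s \<in> S \<Longrightarrow> lform u s = 0" "lform u x = 1"
    using lform_separates[OF assms(1)] by blast
  obtain v where v: "\<And>s. s \<in> S \<Longrightarrow> lform v s = 0" "lform v y = 1"
    using lform_separates[OF assms(2)] by blast
  show ?thesis
  proof (cases "lform u y = 0 \<and> lform v x = - 1")
    case True
    then show ?thesis
      using u v by (intro that[of "u + 2 *s v"]) (auto simp: lform_add_left lform_scale_left)
  next
    case False
    show ?thesis
    proof (cases "lform u y = 0")
      case True
      with False show ?thesis
        using u v by (intro that[of "u + v"]) (auto simp: lform_add_left add_eq_0_iff)
    next
      case False
      with u show ?thesis by (intro that[of u]) auto
    qed
  qed
qed

lemma entire_fun_exp:
  assumes "entire_fun f"
  shows "entire_fun (\<lambda>z. exp (f z))"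
proof (rule entire_funI)
  fix z
  have "((\<lambda>z. exp (f z)) has_derivative (\<lambda>h. exp (f z) * dirderiv h f z)) (at z)"
    using has_derivative_compose[OF entire_fun_has_derivative[OF assms]
        DERIV_exp[unfolded has_field_derivative_def]] .
  then show "\<exists>L. ((\<lambda>z. exp (f z)) has_derivative L) (at z) \<and> (\<forall>c h. L (c *s h) = c * L h)"
    by (auto simp: dirderiv_scalar_mult[OF assms])
qed

lemma lform_bound: "cmod (lform u z) \<le> (\<Sum>j\<in>UNIV. cmod (u $ j)) * norm z"
  unfolding lform_def sum_distrib_right
  by (rule order_trans[OF norm_sum sum_mono])
     (auto simp: norm_mult intro: mult_left_mono Finite_Cartesian_Product.norm_nth_le)

lemma exp_lform_fock: "(\<lambda>z. exp (s * lform u z)) \<in> fock_space"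
proof -
  define L where "L = cmod s * (\<Sum>j\<in>UNIV. cmod (u $ j))"
  have "cmod (exp (s * lform u z)) \<le> exp (2 * L\<^sup>2) * exp ((norm z)\<^sup>2 / 8)" for z
  proof -
    have "Re (s * lform u z) \<le> cmod s * cmod (lform u z)"
      by (metis complex_Re_le_cmod norm_mult)
    also have "\<dots> \<le> L * norm z"
      unfolding L_def mult.assoc by (intro mult_left_mono lform_bound) auto
    finally have "cmod (exp (s * lform u z)) \<le> exp (L * norm z)"
      by simp
    then show ?thesis
      using exp_linear_le_exp_square order_trans by blast
  qed
  moreover have "entire_fun (\<lambda>z. exp (s * lform u z))"
    by (intro entire_fun_exp entire_fun_mult entire_fun_const entire_fun_lform)
  ultimately show ?thesis
    by (metis fock_space_dominated)
qed

text \<open>Without a fixed point there is a linear form with \<open>u \<circ> \<phi> = u + c\<close>, \<open>c \<noteq> 0\<close>, and the exponentials of its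
  multiples are eigenfunctions for every nonzero eigenvalue.\<close>
lemma bounded_comp_op_fixed_point:
  fixes A :: "complex^'n^'n"
  assumes bdd: "fock_bounded_op (comp_op (affine_map A b))"
  obtains p where "affine_map A b p = p"
proof -
  have "\<exists>p. affine_map A b p = p"
  proof (rule ccontr)
    assume no: "\<nexists>p. affine_map A b p = p"
    \<comment> \<open>A fixed point is a solution of \<open>p - A *v p = b\<close>, so its absence
      means that \<open>b\<close> lies outside this range.\<close>
    define S where "S = range (\<lambda>x. x - A *v x)"
    have S: "x \<in> S \<longleftrightarrow> (\<exists>y. x = y - A *v y)" for x
      by (auto simp: S_def)
    have "vec.subspace S"
    proof (rule vec.subspaceI)
      show "0 \<in> S"
        unfolding S by (rule exI[of _ 0]) simp
      show "x + y \<in> S" if "x \<in> S" "y \<in> S" for x y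
      proof -
        from that obtain x' y' where "x = x' - A *v x'" "y = y' - A *v y'"
          unfolding S by blast
        then have "x + y = (x' + y') - A *v (x' + y')"
          by (simp add: vec.add)
        then show ?thesis unfolding S by blast
      qed
      show "c *s x \<in> S" if "x \<in> S" for c x
      proof -
        from that obtain x' where "x = x' - A *v x'"
          unfolding S by blast
        then have "c *s x = c *s x' - A *v (c *s x')"
          by (simp add: vec.scale vec.scale_right_diff_distrib)
        then show ?thesis unfolding S by blast
      qed
    qed
    then have "vec.span S = S"
      by (simp add: vec.span_eq_iff)
    moreover have "b \<notin> S"
    proof
      assume "b \<in> S"
      then obtain y where "b = y - A *v y"
        unfolding S by blast
      then have "affine_map A b y = y"
        by (simp add: affine_map_def)
      with no show False by blast
    qed
    ultimately obtain u where u: "\<And>s. s \<in> S \<Longrightarrow> lform u s = 0" "lform u b = 1"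
      using lform_separates by metis
    have uA: "lform u (A *v z) = lform u z" for z
      using u(1)[of "z - A *v z"] by (simp add: S_def lform_diff)
    obtain M where M: "\<And>f. f \<in> fock_space \<Longrightarrow> fock_norm (comp_op (affine_map A b) f) \<le> M * fock_norm f"
      using bdd by (auto simp: fock_bounded_op_def)
    \<comment> \<open>With this multiple the eigenvalue \<open>exp s\<close> exceeds the operator
      bound, since \<open>exp |M| >= 1 + |M|\<close>.\<close>
    define s where "s = complex_of_real \<bar>M\<bar>"
    define f where "f = (\<lambda>z. exp (s * lform u z))"
    have f: "f \<in> fock_space"
      unfolding f_def by (rule exp_lform_fock)
    obtain C where C: "C \<ge> 0"
      "\<And>(f::complex^'n \<Rightarrow> complex) z. f \<in> fock_space \<Longrightarrow> norm z \<le> 0 \<Longrightarrow> cmod (f z) \<le> C * fock_norm f"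
      using fock_point_evaluation_bound[of 0] by metis
    from C(2)[OF f, of 0] have "fock_norm f \<noteq> 0"
      by (auto simp: f_def)
    then have pos: "fock_norm f > 0"
      using fock_norm_nonneg[of f] by linarith
    have "comp_op (affine_map A b) f = (\<lambda>z. exp s * f z)"
      by (simp add: fun_eq_iff comp_op_def f_def affine_map_def lform_add uA u(2) distrib_left
          exp_add mult.commute)
    then have "exp \<bar>M\<bar> * fock_norm f \<le> M * fock_norm f"
      using M[OF f] by (simp add: fock_norm_cmult s_def)
    then have "exp \<bar>M\<bar> \<le> M"
      using pos by simp
    moreover have "exp \<bar>M\<bar> \<ge> 1 + \<bar>M\<bar>"
      by (rule exp_ge_add_one_self)
    ultimately show False by linarith
  qed
  with that show ?thesis by blast
qed

section \<open>Iterated derivatives as continuous functionals and the obstruction to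
  cyclicity\<close>

primrec dirderivs :: "(complex^'n) list \<Rightarrow> (complex^'n \<Rightarrow> complex) \<Rightarrow> complex^'n \<Rightarrow> complex" where
  "dirderivs [] f = f"
| "dirderivs (v # vs) f = dirderiv v (dirderivs vs f)"

lemma entire_fun_dirderivs: "entire_fun f \<Longrightarrow> entire_fun (dirderivs vs f)"
  by (induction vs) (auto intro: entire_fun_dirderiv)

lemma dirderivs_affine_map:
  "dirderivs vs (f \<circ> affine_map A b) = dirderivs (map ((*v) A) vs) f \<circ> affine_map A b"
proof (induction vs)
  case (Cons v vs)
  have "dirderivs (v # vs) (f \<circ> affine_map A b)
      = dirderiv v (dirderivs (map ((*v) A) vs) f \<circ> affine_map A b)"
    by (simp only: dirderivs.simps Cons.IH)
  also have "\<dots> = dirderivs (map ((*v) A) (v # vs)) f \<circ> affine_map A b"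
    by (rule ext) (simp only: dirderiv_affine_map dirderivs.simps list.map o_apply)
  finally show ?case .
qed simp

lemma dirderivs_fun_add:
  assumes "entire_fun f" "entire_fun g"
  shows "dirderivs vs (\<lambda>z. f z + g z) = (\<lambda>z. dirderivs vs f z + dirderivs vs g z)"
  by (induction vs) (auto simp: dirderiv_fun_add entire_fun_dirderivs assms)

lemma dirderivs_fun_cmult:
  assumes "entire_fun f"
  shows "dirderivs vs (\<lambda>z. c * f z) = (\<lambda>z. c * dirderivs vs f z)"
  by (induction vs) (auto simp: dirderiv_fun_cmult entire_fun_dirderivs assms)

text \<open>The radius \<open>R\<close> varies because each Cauchy estimate enlarges the ball by the
  norm of the direction.\<close>

lemma dirderivs_bound:
  "\<exists>C. \<forall>(f::complex^'n \<Rightarrow> complex)\<in>fock_space. \<forall>z. norm z \<le> R \<longrightarrow> cmod (dirderivs vs f z) \<le> C * fock_norm f"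
proof (induction vs arbitrary: R)
  case Nil
  then show ?case
    using fock_point_evaluation_bound[of R] by (metis dirderivs.simps(1))
next
  case (Cons v vs)
  obtain C where "\<And>(f::complex^'n \<Rightarrow> complex) z. f \<in> fock_space \<Longrightarrow> norm z \<le> R + norm v \<Longrightarrow>
      cmod (dirderivs vs f z) \<le> C * fock_norm f"
    using Cons.IH by blast
  then have "cmod (dirderivs (v # vs) f z) \<le> C * fock_norm f" if "f \<in> fock_space" "norm z \<le> R" for f z
    using that by (auto intro!: norm_dirderiv_le entire_fun_dirderivs intro: fock_space_entire)
  then show ?case by blast
qed

text \<open>Linearity is demanded on the Fock space only, since derivatives need not be additive on
  functions that are not differentiable.\<close>

definition fock_functional :: "((complex^'n \<Rightarrow> complex) \<Rightarrow> complex) \<Rightarrow> bool" where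
  "fock_functional L \<longleftrightarrow>
    (\<forall>f\<in>fock_space. \<forall>g\<in>fock_space. L (\<lambda>z. f z + g z) = L f + L g) \<and>
    (\<forall>f\<in>fock_space. \<forall>c. L (\<lambda>z. c * f z) = c * L f) \<and>
    (\<exists>C. \<forall>f\<in>fock_space. cmod (L f) \<le> C * fock_norm f)"

lemma fock_functional_add:
  assumes "fock_functional L" "f \<in> fock_space" "g \<in> fock_space"
  shows "L (\<lambda>z. f z + g z) = L f + L g"
  using assms unfolding fock_functional_def by blast

lemma fock_functional_cmult:
  assumes "fock_functional L" "f \<in> fock_space"
  shows "L (\<lambda>z. c * f z) = c * L f"
  using assms unfolding fock_functional_def by blast

lemma fock_functional_boundE:
  assumes "fock_functional L"
  obtains C where "\<And>f. f \<in> fock_space \<Longrightarrow> cmod (L f) \<le> C * fock_norm f"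
proof -
  from assms have "\<exists>C. \<forall>f\<in>fock_space. cmod (L f) \<le> C * fock_norm f"
    unfolding fock_functional_def by blast
  with that show ?thesis by blast
qed

lemma fock_functional_dirderivs: "fock_functional (\<lambda>f. dirderivs vs f p)"
  unfolding fock_functional_def
  using dirderivs_bound[of "norm p" vs]
  by (auto simp: dirderivs_fun_add dirderivs_fun_cmult fock_space_entire)

lemma fock_functional_combine:
  assumes "fock_functional L" "fock_functional L'"
  shows "fock_functional (\<lambda>f. a * L f + b * L' f)"
proof -
  obtain C C' where C: "\<And>f. f \<in> fock_space \<Longrightarrow> cmod (L f) \<le> C * fock_norm f"
    "\<And>f. f \<in> fock_space \<Longrightarrow> cmod (L' f) \<le> C' * fock_norm f"
    using fock_functional_boundE[OF assms(1)] fock_functional_boundE[OF assms(2)] by metis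
  have "cmod (a * L f + b * L' f) \<le> (cmod a * C + cmod b * C') * fock_norm f" if "f \<in> fock_space" for f
  proof -
    have "cmod (a * L f + b * L' f) \<le> cmod a * cmod (L f) + cmod b * cmod (L' f)"
      by (metis norm_mult norm_triangle_ineq)
    also have "\<dots> \<le> cmod a * (C * fock_norm f) + cmod b * (C' * fock_norm f)"
      by (intro add_mono mult_left_mono C that) auto
    finally show ?thesis by (simp add: algebra_simps)
  qed
  then have "\<exists>C. \<forall>f\<in>fock_space. cmod (a * L f + b * L' f) \<le> C * fock_norm f"
    by blast
  then show ?thesis
    using assms unfolding fock_functional_def by (auto simp: algebra_simps)
qed

lemma fock_functional_sum:
  assumes "fock_functional L" and g: "\<And>k. k \<in> I \<Longrightarrow> g k \<in> fock_space"
  shows "L (\<lambda>z. \<Sum>k\<in>I. c k * g k z) = (\<Sum>k\<in>I. c k * L (g k))"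
proof -
  have zero: "L (\<lambda>z. 0) = 0"
    using fock_functional_cmult[OF assms(1) fock_space_zero, of 0] by simp
  show ?thesis
    using g
  proof (induction I rule: infinite_finite_induct)
    case (insert k I)
    have "(\<lambda>z. c k * g k z) \<in> fock_space"
      by (intro fock_space_cmult insert.prems) simp
    moreover have "(\<lambda>z. \<Sum>k\<in>I. c k * g k z) \<in> fock_space"
      by (intro fock_space_sum fock_space_cmult insert.prems) simp
    ultimately show ?case
      using insert by (simp add: fock_functional_add[OF assms(1)] fock_functional_cmult[OF assms(1)])
  qed (auto simp: zero)
qed

lemma comp_op_funpow: "(comp_op \<phi> ^^ k) f = f \<circ> (\<phi> ^^ k)"
  by (induction k) (auto simp: comp_op_def o_assoc funpow_swap1 fun_eq_iff)

lemma fock_functional_cyclic_zero: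
  fixes T :: "(complex^'n \<Rightarrow> complex) \<Rightarrow> (complex^'n \<Rightarrow> complex)"
  assumes L: "fock_functional L" and f: "f \<in> fock_space"
    and cyc: "\<forall>g\<in>fock_space. \<forall>\<epsilon>>0. \<exists>N::nat. \<exists>c. fock_norm (\<lambda>z. g z - (\<Sum>k<N. c k * (T ^^ k) f z)) < \<epsilon>"
    and T: "\<And>h. h \<in> fock_space \<Longrightarrow> T h \<in> fock_space"
    and zero: "\<And>k. L ((T ^^ k) f) = 0" and g: "g \<in> fock_space"
  shows "L g = 0"
proof (rule ccontr)
  assume "L g \<noteq> 0"
  obtain C where C: "\<And>f. f \<in> fock_space \<Longrightarrow> cmod (L f) \<le> C * fock_norm f"
    using fock_functional_boundE[OF L] by blast
  have Tk: "(T ^^ k) f \<in> fock_space" for k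
    by (induction k) (use f T in simp_all)
  \<comment> \<open>The denominator \<open>|C| + 1\<close> is positive whatever the sign of the
    constant \<open>C\<close>.\<close>
  define \<epsilon> where "\<epsilon> = cmod (L g) / (\<bar>C\<bar> + 1)"
  have "\<epsilon> > 0"
    using \<open>L g \<noteq> 0\<close> by (simp add: \<epsilon>_def)
  then obtain N c where Nc: "fock_norm (\<lambda>z. g z - (\<Sum>k<N. c k * (T ^^ k) f z)) < \<epsilon>"
    using cyc g by blast
  define h where "h = (\<lambda>z. \<Sum>k<N. c k * (T ^^ k) f z)"
  have h: "h \<in> fock_space"
    unfolding h_def by (intro fock_space_sum fock_space_cmult Tk)
  have "L h = 0"
    unfolding h_def by (subst fock_functional_sum[OF L Tk]) (simp add: zero)
  have "L (\<lambda>z. g z - h z) = L (\<lambda>z. g z + (-1) * h z)"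
    by simp
  also have "\<dots> = L g + L (\<lambda>z. (-1) * h z)"
    by (rule fock_functional_add[OF L g fock_space_cmult[OF h]])
  also have "\<dots> = L g + (-1) * L h"
    by (simp only: fock_functional_cmult[OF L h])
  also have "\<dots> = L g"
    by (simp add: \<open>L h = 0\<close>)
  finally have "cmod (L g) \<le> C * fock_norm (\<lambda>z. g z - h z)"
    using C[OF fock_space_diff[OF g h]] by simp
  also have "\<dots> \<le> (\<bar>C\<bar> + 1) * fock_norm (\<lambda>z. g z - h z)"
    by (intro mult_right_mono) auto
  also have "\<dots> < (\<bar>C\<bar> + 1) * \<epsilon>"
    using Nc by (intro mult_strict_left_mono) (auto simp: h_def)
  also have "\<dots> = cmod (L g)"
    by (simp add: \<epsilon>_def)
  finally show False by simp
qed

text \<open>Along the orbit of \<open>f\<close> both functionals are multiplied by the same powers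
  of \<kappa>, so \<open>L2 f * L1 - L1 f * L2\<close> vanishes there and, by density, everywhere.
  Testing on \<open>f1\<close> gives \<open>L2 f = 0\<close>, then on \<open>f2\<close> gives
  \<open>L1 f = 0\<close>; after that \<open>L1\<close> alone vanishes on the orbit.\<close>

lemma not_fock_cyclic:
  fixes T :: "(complex^'n \<Rightarrow> complex) \<Rightarrow> (complex^'n \<Rightarrow> complex)"
  assumes T: "\<And>h. h \<in> fock_space \<Longrightarrow> T h \<in> fock_space"
    and L1: "fock_functional L1" and L2: "fock_functional L2"
    and eig: "\<And>f. f \<in> fock_space \<Longrightarrow> L1 (T f) = \<kappa> * L1 f" "\<And>f. f \<in> fock_space \<Longrightarrow> L2 (T f) = \<kappa> * L2 f"
    and f1: "f1 \<in> fock_space" "L1 f1 \<noteq> 0" "L2 f1 = 0" and f2: "f2 \<in> fock_space" "L2 f2 \<noteq> 0"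
  shows "\<not> fock_cyclic T"
proof
  assume "fock_cyclic T"
  then obtain f where f: "f \<in> fock_space"
    and cyc: "\<forall>g\<in>fock_space. \<forall>\<epsilon>>0. \<exists>N::nat. \<exists>c. fock_norm (\<lambda>z. g z - (\<Sum>k<N. c k * (T ^^ k) f z)) < \<epsilon>"
    by (auto simp: fock_cyclic_def)
  have Tk: "(T ^^ k) f \<in> fock_space" for k
    by (induction k) (use f T in simp_all)
  have orb: "L1 ((T ^^ k) f) = \<kappa> ^ k * L1 f" "L2 ((T ^^ k) f) = \<kappa> ^ k * L2 f" for k
    by (induction k) (auto simp: eig Tk)
  have zero: "L2 f * L1 g + (- L1 f) * L2 g = 0" if "g \<in> fock_space" for g
    using fock_functional_cyclic_zero[OF fock_functional_combine[OF L1 L2, of "L2 f" "- L1 f"] f cyc T _ that]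
    by (auto simp: orb)
  have "L2 f = 0"
    using zero[OF f1(1)] f1 by simp
  then have "L1 f = 0"
    using zero[OF f2(1)] f2 by simp
  then have "\<forall>g\<in>fock_space. L1 g = 0"
    using fock_functional_cyclic_zero[OF L1 f cyc T] by (auto simp: orb)
  with f1 show False by blast
qed

section \<open>Eigenfunctionals of a cyclic composition operator\<close>

lemma dirderivs2_add_left:
  "entire_fun f \<Longrightarrow> dirderivs [x + y, w] f p = dirderivs [x, w] f p + dirderivs [y, w] f p"
  by (simp add: dirderiv_add entire_fun_dirderiv)

lemma dirderivs2_scale_left:
  "entire_fun f \<Longrightarrow> dirderivs [c *s x, w] f p = c * dirderivs [x, w] f p"
  by (simp add: dirderiv_scalar_mult entire_fun_dirderiv)

lemma dirderivs2_add_right: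
  assumes "entire_fun f"
  shows "dirderivs [w, x + y] f p = dirderivs [w, x] f p + dirderivs [w, y] f p"
proof -
  have "dirderiv (x + y) f = (\<lambda>z. dirderiv x f z + dirderiv y f z)"
    by (intro ext dirderiv_add assms)
  then show ?thesis
    by (simp add: dirderiv_fun_add entire_fun_dirderiv assms)
qed

lemma dirderivs2_scale_right:
  assumes "entire_fun f"
  shows "dirderivs [w, c *s x] f p = c * dirderivs [w, x] f p"
proof -
  have "dirderiv (c *s x) f = (\<lambda>z. c * dirderiv x f z)"
    by (intro ext dirderiv_scalar_mult assms)
  then show ?thesis
    by (simp add: dirderiv_fun_cmult entire_fun_dirderiv assms)
qed

lemma dirderivs1_scale: "entire_fun f \<Longrightarrow> dirderivs [c *s x] f p = c * dirderivs [x] f p"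
  by (simp add: dirderiv_scalar_mult)

lemma dirderivs1_lform: "dirderivs [v] (lform u) p = lform u v"
  by (simp add: dirderiv_lform)

lemma dirderivs_zero_direction: "dirderivs (0 # vs) f p = 0"
  by (simp add: dirderiv_def)

lemmas dirderivs2_bilinear =
  dirderivs2_add_left dirderivs2_scale_left dirderivs2_add_right dirderivs2_scale_right

lemma dirderivs2_lform: "dirderivs [v, w] (lform u) p = 0"
proof -
  have "dirderiv w (lform u) = (\<lambda>z. lform u w)"
    by (intro ext dirderiv_lform)
  then show ?thesis
    by (simp add: dirderiv_const)
qed

lemma dirderivs2_lform_square:
  "dirderivs [v, w] (\<lambda>z. lform u z * lform u z) p = 2 * lform u v * lform u w"
proof -
  have "dirderiv w (\<lambda>z. lform u z * lform u z) = (\<lambda>z. (2 * lform u w) * lform u z)"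
    by (rule ext) (simp add: dirderiv_fun_mult entire_fun_lform dirderiv_lform)
  then show ?thesis
    by (simp add: dirderiv_fun_cmult entire_fun_lform dirderiv_lform)
qed

lemma lform_fock: "lform u \<in> fock_space"
  by (rule polyfuns_fock[OF polyfuns_lform])

lemma lform_square_fock: "(\<lambda>z. lform u z * lform u z) \<in> fock_space"
  by (rule polyfuns_fock[OF polyfuns_mult[OF polyfuns_lform polyfuns_lform]])

text \<open>Test functions for higher derivatives: with forms \<open>u j\<close> dual to
  eigenvectors, derivatives along the latter act on one exponent at a time, and the centre
  \<open>p\<close> annihilates whatever is left of positive degree.\<close>

definition monomial_at ::
    "('n \<Rightarrow> complex^'n) \<Rightarrow> complex^'n \<Rightarrow> 'n set \<Rightarrow> ('n \<Rightarrow> nat) \<Rightarrow> complex^'n \<Rightarrow> complex" where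
  "monomial_at u p S \<gamma> z = (\<Prod>j\<in>S. lform (u j) (z - p) ^ \<gamma> j)"

lemma polyfuns_monomial_at: "monomial_at u p S \<gamma> \<in> polyfuns"
  unfolding monomial_at_def by (intro polyfuns_prod polyfuns_power polyfuns_lform_diff)

lemma monomial_at_center: "monomial_at u p S \<gamma> p \<noteq> 0 \<longleftrightarrow> (\<forall>j\<in>S. \<gamma> j = 0)"
  for S :: "'n::finite set"
  by (auto simp: monomial_at_def power_0_left)

lemma dirderiv_monomial_at:
  fixes S :: "'n::finite set"
  assumes i: "i \<in> S" and dual: "\<And>j. j \<in> S \<Longrightarrow> lform (u j) v = (if j = i then 1 else 0)"
  shows "dirderiv v (monomial_at u p S \<gamma>) = (\<lambda>z. of_nat (\<gamma> i) * monomial_at u p S (\<gamma>(i := \<gamma> i - 1)) z)"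
proof
  fix z
  define c where "c = (\<Prod>j\<in>S - {i}. lform (u j) (z - p) ^ \<gamma> j)"
  have split: "monomial_at u p S \<delta> w = lform (u i) (w - p) ^ \<delta> i * (\<Prod>j\<in>S - {i}. lform (u j) (w - p) ^ \<delta> j)" for \<delta> w
    unfolding monomial_at_def by (rule prod.remove) (use i in auto)
  have "(\<Prod>j\<in>S - {i}. lform (u j) (z + t *s v - p) ^ \<gamma> j) = c" for t
    unfolding c_def by (rule prod.cong) (auto simp: lform_diff lform_add lform_scale dual)
  then have "(\<lambda>t. monomial_at u p S \<gamma> (z + t *s v)) = (\<lambda>t. (lform (u i) (z - p) + t) ^ \<gamma> i * c)"
    using i by (simp add: split lform_diff lform_add lform_scale dual algebra_simps)
  moreover have "((\<lambda>t. (lform (u i) (z - p) + t) ^ \<gamma> i * c) has_field_derivative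
      of_nat (\<gamma> i) * (lform (u i) (z - p)) ^ (\<gamma> i - 1) * c) (at 0)"
    by (auto intro!: derivative_eq_intros)
  moreover have "monomial_at u p S (\<gamma>(i := \<gamma> i - 1)) z = (lform (u i) (z - p)) ^ (\<gamma> i - 1) * c"
  proof -
    have "(\<Prod>j\<in>S - {i}. lform (u j) (z - p) ^ (\<gamma>(i := \<gamma> i - 1)) j) = c"
      unfolding c_def by (rule prod.cong) auto
    then show ?thesis
      by (simp add: split)
  qed
  ultimately show "dirderiv v (monomial_at u p S \<gamma>) z = of_nat (\<gamma> i) * monomial_at u p S (\<gamma>(i := \<gamma> i - 1)) z"
    by (simp add: dirderiv_def DERIV_imp_deriv mult.assoc)
qed

text \<open>Differentiating an exhausted exponent makes \<open>c\<close> vanish, so the truncated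
  exponents that follow do no harm.\<close>

lemma dirderivs_monomial_at:
  fixes S :: "'n::finite set"
  assumes dual: "\<And>i j. i \<in> S \<Longrightarrow> j \<in> S \<Longrightarrow> lform (u j) (v i) = (if j = i then 1 else 0)"
    and "set js \<subseteq> S"
  shows "\<exists>c. dirderivs (map v js) (monomial_at u p S \<gamma>)
      = (\<lambda>z. c * monomial_at u p S (\<lambda>j. \<gamma> j - count_list js j) z) \<and> (c \<noteq> 0 \<longleftrightarrow> (\<forall>j. count_list js j \<le> \<gamma> j))"
  using assms(2)
proof (induction js)
  case Nil
  show ?case by (intro exI[of _ 1]) auto
next
  case (Cons i js)
  obtain c where c: "dirderivs (map v js) (monomial_at u p S \<gamma>)
      = (\<lambda>z. c * monomial_at u p S (\<lambda>j. \<gamma> j - count_list js j) z)"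
    and c0: "c \<noteq> 0 \<longleftrightarrow> (\<forall>j. count_list js j \<le> \<gamma> j)"
    using Cons by auto
  have i: "i \<in> S"
    using Cons.prems by simp
  have "dirderivs (map v (i # js)) (monomial_at u p S \<gamma>)
     = (\<lambda>z. c * dirderiv (v i) (monomial_at u p S (\<lambda>j. \<gamma> j - count_list js j)) z)"
    by (simp add: c dirderiv_fun_cmult[OF polyfuns_entire[OF polyfuns_monomial_at]] fun_eq_iff)
  also have "dirderiv (v i) (monomial_at u p S (\<lambda>j. \<gamma> j - count_list js j)) =
      (\<lambda>z. of_nat (\<gamma> i - count_list js i) * monomial_at u p S (\<lambda>j. \<gamma> j - count_list (i # js) j) z)"
  proof -
    have "(\<lambda>j. \<gamma> j - count_list js j)(i := \<gamma> i - count_list js i - 1) = (\<lambda>j. \<gamma> j - count_list (i # js) j)"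
      by auto
    then show ?thesis
      by (subst dirderiv_monomial_at[OF i]) (simp_all only: dual i)
  qed
  finally have "dirderivs (map v (i # js)) (monomial_at u p S \<gamma>) =
     (\<lambda>z. (c * of_nat (\<gamma> i - count_list js i)) * monomial_at u p S (\<lambda>j. \<gamma> j - count_list (i # js) j) z)"
    by (simp add: mult.assoc)
  moreover have "c * of_nat (\<gamma> i - count_list js i) \<noteq> 0 \<longleftrightarrow> (\<forall>j. count_list (i # js) j \<le> \<gamma> j)"
  proof -
    have "(\<forall>j. count_list (i # js) j \<le> \<gamma> j) \<longleftrightarrow> (\<forall>j. count_list js j \<le> \<gamma> j) \<and> count_list js i < \<gamma> i"
      (is "?l \<longleftrightarrow> ?r")
    proof
      assume l: ?l
      have "count_list js j \<le> \<gamma> j" for j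
        using l[rule_format, of j] by (simp split: if_splits)
      moreover have "count_list js i < \<gamma> i"
        using l[rule_format, of i] by simp
      ultimately show ?r by blast
    qed auto
    with c0 show ?thesis by auto
  qed
  ultimately show ?case by blast
qed

text \<open>At the centre only a monomial of degree zero survives, so the derivatives must use up
  every exponent exactly.\<close>

lemma dirderivs_monomial_at_center:
  fixes S :: "'n::finite set"
  assumes dual: "\<And>i j. i \<in> S \<Longrightarrow> j \<in> S \<Longrightarrow> lform (u j) (v i) = (if j = i then 1 else 0)"
    and "set js \<subseteq> S"
  shows "dirderivs (map v js) (monomial_at u p S \<gamma>) p \<noteq> 0 \<longleftrightarrow>
    (\<forall>j. count_list js j \<le> \<gamma> j) \<and> (\<forall>j\<in>S. \<gamma> j \<le> count_list js j)"
proof -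
  obtain c where c: "dirderivs (map v js) (monomial_at u p S \<gamma>)
      = (\<lambda>z. c * monomial_at u p S (\<lambda>j. \<gamma> j - count_list js j) z)"
    and c0: "c \<noteq> 0 \<longleftrightarrow> (\<forall>j. count_list js j \<le> \<gamma> j)"
    using dirderivs_monomial_at[OF assms, of p \<gamma>] by auto
  have "monomial_at u p S (\<lambda>j. \<gamma> j - count_list js j) p \<noteq> 0 \<longleftrightarrow> (\<forall>j\<in>S. \<gamma> j \<le> count_list js j)"
    unfolding monomial_at_center by simp
  with c c0 show ?thesis by auto
qed

lemma dirderivs_scale:
  assumes "entire_fun f"
  shows "dirderivs (map (\<lambda>i. c i *s v i) js) f = (\<lambda>z. prod_list (map c js) * dirderivs (map v js) f z)"
proof (induction js)
  case (Cons i js)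
  have "dirderivs (map (\<lambda>i. c i *s v i) (i # js)) f
      = dirderiv (c i *s v i) (\<lambda>z. prod_list (map c js) * dirderivs (map v js) f z)"
    by (simp add: Cons)
  also have "\<dots> = (\<lambda>z. prod_list (map c (i # js)) * dirderivs (map v (i # js)) f z)"
  proof
    fix z
    have "entire_fun (\<lambda>z. prod_list (map c js) * dirderivs (map v js) f z)"
      by (intro entire_fun_mult entire_fun_const entire_fun_dirderivs assms)
    then show "dirderiv (c i *s v i) (\<lambda>z. prod_list (map c js) * dirderivs (map v js) f z) z
        = prod_list (map c (i # js)) * dirderivs (map v (i # js)) f z"
      by (simp add: dirderiv_scalar_mult dirderiv_fun_cmult entire_fun_dirderivs assms mult_ac)
  qed
  finally show ?case .
qed simp

lemma list_with_counts:
  fixes \<alpha> :: "'n::finite \<Rightarrow> nat"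
  obtains js where "\<And>j. count_list js j = \<alpha> j"
proof -
  obtain js where "mset js = (\<Sum>j\<in>UNIV. replicate_mset (\<alpha> j) j)"
    using ex_mset by blast
  then have "count_list js j = \<alpha> j" for j
    by (simp add: count_mset[symmetric] count_sum)
  then show ?thesis by (rule that)
qed

lemma prod_list_count_list:
  fixes \<mu> :: "'n::finite \<Rightarrow> complex"
  shows "prod_list (map \<mu> js) = (\<Prod>j\<in>UNIV. \<mu> j ^ count_list js j)"
proof (induction js)
  case (Cons i js)
  have "(\<Prod>j\<in>UNIV. \<mu> j ^ count_list (i # js) j) = (\<Prod>j\<in>UNIV. (if j = i then \<mu> j else 1) * \<mu> j ^ count_list js j)"
    by (rule prod.cong) auto
  also have "\<dots> = \<mu> i * (\<Prod>j\<in>UNIV. \<mu> j ^ count_list js j)"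
    by (simp add: prod.distrib)
  finally show ?case
    by (simp add: Cons)
qed simp

locale cyclic_comp_op =
  fixes A :: "complex^'n^'n" and b p :: "complex^'n"
  assumes bounded: "fock_bounded_op (comp_op (affine_map A b))"
    and fixed_point: "affine_map A b p = p"
    and cyclic: "fock_cyclic (comp_op (affine_map A b))"
begin

text \<open>The chain rule without a shift of the base point: this is what turns eigenvectors and
  Jordan chains of \<open>A\<close> into eigenfunctionals.\<close>

lemma dirderivs_fixed_point:
  "dirderivs vs (comp_op (affine_map A b) f) p = dirderivs (map ((*v) A) vs) f p"
  by (simp only: comp_op_def dirderivs_affine_map o_apply fixed_point)

lemma eigenfunctionals_contradiction:
  assumes "fock_functional L1" "fock_functional L2"
    and "\<And>f. entire_fun f \<Longrightarrow> L1 (comp_op (affine_map A b) f) = \<kappa> * L1 f"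
    and "\<And>f. entire_fun f \<Longrightarrow> L2 (comp_op (affine_map A b) f) = \<kappa> * L2 f"
    and "f1 \<in> fock_space" "L1 f1 \<noteq> 0" "L2 f1 = 0" "f2 \<in> fock_space" "L2 f2 \<noteq> 0"
  shows False
  using not_fock_cyclic[OF _ assms(1,2) _ _ assms(5-9)] assms(3,4) bounded cyclic fock_space_entire
  unfolding fock_bounded_op_def by blast

text \<open>A kernel vector gives a first and a second derivative that both vanish after
  composition, hence two functionals with eigenvalue 0; a linear form and its square tell them
  apart.\<close>

lemma kernel_trivial:
  assumes "A *v v = 0"
  shows "v = 0"
proof (rule ccontr)
  assume "v \<noteq> 0"
  then obtain u where u: "lform u v = 1"
    using lform_separates[of v "{}"] by auto
  show False
  proof (rule eigenfunctionals_contradiction[of "\<lambda>f. dirderivs [v] f p" "\<lambda>f. dirderivs [v, v] f p" 0 "lform u"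
        "\<lambda>z. lform u z * lform u z"])
  qed (simp_all add: fock_functional_dirderivs dirderivs_fixed_point lform_fock lform_square_fock
      dirderivs1_lform dirderivs2_lform dirderivs2_lform_square dirderivs_zero_direction assms u
      del: dirderivs.simps)
qed

lemma span_eigenvector:
  assumes "A *v v = \<mu> *s v" "w \<in> vec.span {v}"
  shows "A *v w = \<mu> *s w"
proof -
  obtain c where w: "w = c *s v"
    using assms(2) by (auto simp: vec.span_singleton)
  show ?thesis
    unfolding w by (simp add: vec.scale assms(1) mult.commute)
qed

text \<open>Derivatives along two independent eigenvectors would be independent eigenfunctionals
  with the same eigenvalue.\<close>

lemma eigenvectors_dependent:
  assumes "v \<noteq> 0" "A *v v = \<mu> *s v" "A *v w = \<mu> *s w"
  shows "w \<in> vec.span {v}"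
proof (rule ccontr)
  assume "w \<notin> vec.span {v}"
  then obtain u where u: "lform u v = 0" "lform u w = 1"
    using lform_separates[of w "{v}"] by auto
  obtain u' where u': "lform u' v = 1"
    using lform_separates[of v "{}"] \<open>v \<noteq> 0\<close> by auto
  show False
  proof (rule eigenfunctionals_contradiction[of "\<lambda>f. dirderivs [w] f p" "\<lambda>f. dirderivs [v] f p" \<mu> "lform u" "lform u'"])
  qed (simp_all add: fock_functional_dirderivs dirderivs_fixed_point lform_fock dirderivs1_lform
      dirderivs1_scale assms u u' del: dirderivs.simps)
qed

text \<open>In the symmetric square, \<open>v1 v1\<close> is one eigenvector and
  \<open>v2 v2 - 2 v1 v3 - v1 v2 / \<mu>\<close> another: the action on
  \<open>v2 v2 - 2 v1 v3\<close> leaves the remainder \<open>v1 v1\<close>, which the last term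
  cancels.\<close>

lemma no_chain3:
  assumes "v1 \<noteq> 0" "A *v v1 = \<mu> *s v1" "A *v v2 = \<mu> *s v2 + v1" "A *v v3 = \<mu> *s v3 + v2"
  shows False
proof -
  have "\<mu> \<noteq> 0"
    using kernel_trivial[of v1] assms(1,2) by auto
  have "v2 \<notin> vec.span {v1}"
    using span_eigenvector[OF assms(2), of v2] assms(1,3) by auto
  then obtain u where u: "lform u v1 = 0" "lform u v2 = 1"
    using lform_separates[of v2 "{v1}"] by auto
  obtain u' where u': "lform u' v1 = 1"
    using lform_separates[of v1 "{}"] \<open>v1 \<noteq> 0\<close> by auto
  \<comment> \<open>The term \<open>2 v1 v3\<close> is split into both orders of differentiation, so
    the cancellation works without symmetry of mixed derivatives.\<close>
  define L1 where "L1 = (\<lambda>f. 1 * (1 * dirderivs [v2, v2] f p + (-1) * dirderivs [v1, v3] f p)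
    + 1 * ((-1) * dirderivs [v3, v1] f p + (- 1 / \<mu>) * dirderivs [v1, v2] f p))"
  show False
  proof (rule eigenfunctionals_contradiction[of L1 "\<lambda>f. dirderivs [v1, v1] f p" "\<mu>\<^sup>2"
        "\<lambda>z. lform u z * lform u z" "\<lambda>z. lform u' z * lform u' z"])
    show "fock_functional L1"
      unfolding L1_def by (intro fock_functional_combine fock_functional_dirderivs)
    show "L1 (comp_op (affine_map A b) f) = \<mu>\<^sup>2 * L1 f" if "entire_fun f" for f
      using \<open>\<mu> \<noteq> 0\<close>
      by (simp add: L1_def dirderivs_fixed_point assms dirderivs2_bilinear[OF that] field_simps power2_eq_square
          del: dirderivs.simps)
    show "dirderivs [v1, v1] (comp_op (affine_map A b) f) p = \<mu>\<^sup>2 * dirderivs [v1, v1] f p" if "entire_fun f" for f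
      by (simp add: dirderivs_fixed_point assms dirderivs2_bilinear[OF that] power2_eq_square del: dirderivs.simps)
  qed (simp_all add: L1_def fock_functional_dirderivs lform_square_fock dirderivs2_lform_square u u' del: dirderivs.simps)
qed

text \<open>Besides \<open>v1 w1\<close>, the combination \<open>\<nu> v1 w2 - \<mu> v2 w1\<close>
  is an eigenvector for \<open>\<mu> * \<nu>\<close>, because its two remainders are opposite
  multiples of \<open>v1 w1\<close>.\<close>

lemma no_two_chains:
  assumes v: "v1 \<noteq> 0" "A *v v1 = \<mu> *s v1" "A *v v2 = \<mu> *s v2 + v1"
    and w: "w1 \<noteq> 0" "A *v w1 = \<nu> *s w1" "A *v w2 = \<nu> *s w2 + w1" and "\<mu> \<noteq> \<nu>"
  shows False
proof -
  have "\<mu> \<noteq> 0"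
    using kernel_trivial[of v1] v by auto
  have "v2 \<notin> vec.span {v1}"
    using span_eigenvector[OF v(2), of v2] v by auto
  moreover have "w1 \<notin> vec.span {v1}"
    using span_eigenvector[OF v(2), of w1] w \<open>\<mu> \<noteq> \<nu>\<close> by auto
  \<comment> \<open>Since \<open>u\<close> kills \<open>v1\<close>, its square is invisible to
    \<open>[v1, w1]\<close>, and \<open>L1\<close> of it is a multiple of
    \<open>lform u v2 * lform u w1\<close>; hence both values must be nonzero.\<close>
  ultimately obtain u where u: "lform u v1 = 0" "lform u v2 \<noteq> 0" "lform u w1 \<noteq> 0"
    using lform_separates2[of v2 "{v1}" w1] by auto
  obtain u' where u': "lform u' v1 \<noteq> 0" "lform u' w1 \<noteq> 0"
    using lform_separates2[of v1 "{}" w1] v w by auto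
  define L1 where "L1 = (\<lambda>f. \<nu> * dirderivs [v1, w2] f p + (- \<mu>) * dirderivs [v2, w1] f p)"
  show False
  proof (rule eigenfunctionals_contradiction[of L1 "\<lambda>f. dirderivs [v1, w1] f p" "\<mu> * \<nu>"
        "\<lambda>z. lform u z * lform u z" "\<lambda>z. lform u' z * lform u' z"])
    show "fock_functional L1"
      unfolding L1_def by (intro fock_functional_combine fock_functional_dirderivs)
    show "L1 (comp_op (affine_map A b) f) = \<mu> * \<nu> * L1 f" if "entire_fun f" for f
      by (simp add: L1_def dirderivs_fixed_point v w dirderivs2_bilinear[OF that] algebra_simps
          del: dirderivs.simps)
    show "dirderivs [v1, w1] (comp_op (affine_map A b) f) p = \<mu> * \<nu> * dirderivs [v1, w1] f p" if "entire_fun f" for f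
      by (simp add: dirderivs_fixed_point v w dirderivs2_bilinear[OF that] del: dirderivs.simps)
  qed (use \<open>\<mu> \<noteq> 0\<close> in \<open>simp_all add: L1_def fock_functional_dirderivs lform_square_fock dirderivs2_lform_square u u'
    del: dirderivs.simps\<close>)
qed

text \<open>Derivatives along the eigenvectors with multiplicities \<alpha> and \<beta> are
  eigenfunctionals whose eigenvalues are the two products; the dual monomials show their
  independence.\<close>

lemma eigenvalue_monomials_distinct:
  fixes S :: "'n set" and \<alpha> \<beta> :: "'n \<Rightarrow> nat"
  assumes dual: "\<And>i j. i \<in> S \<Longrightarrow> j \<in> S \<Longrightarrow> lform (u j) (v i) = (if j = i then 1 else 0)"
    and eig: "\<And>i. i \<in> S \<Longrightarrow> A *v v i = \<mu> i *s v i"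
    and \<alpha>: "\<And>j. j \<notin> S \<Longrightarrow> \<alpha> j = 0" and \<beta>: "\<And>j. j \<notin> S \<Longrightarrow> \<beta> j = 0"
    and eq: "(\<Prod>j\<in>UNIV. \<mu> j ^ \<alpha> j) = (\<Prod>j\<in>UNIV. \<mu> j ^ \<beta> j)"
  shows "\<alpha> = \<beta>"
proof (rule ccontr)
  assume "\<alpha> \<noteq> \<beta>"
  obtain xs where xs: "\<And>j. count_list xs j = \<alpha> j"
    using list_with_counts by blast
  obtain ys where ys: "\<And>j. count_list ys j = \<beta> j"
    using list_with_counts by blast
  have sub: "set xs \<subseteq> S" "set ys \<subseteq> S"
    using \<alpha> \<beta> by (metis xs ys count_list_0_iff subsetI)+
  define \<kappa> where "\<kappa> = (\<Prod>j\<in>UNIV. \<mu> j ^ \<alpha> j)"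
  have eigL: "dirderivs (map v js) (comp_op (affine_map A b) f) p = prod_list (map \<mu> js) * dirderivs (map v js) f p"
    if "set js \<subseteq> S" "entire_fun f" for js f
  proof -
    have "map ((*v) A) (map v js) = map (\<lambda>i. \<mu> i *s v i) js"
      using that eig by auto
    then show ?thesis
      by (simp only: dirderivs_fixed_point dirderivs_scale[OF that(2)])
  qed
  show False
  proof (rule eigenfunctionals_contradiction[of "\<lambda>f. dirderivs (map v xs) f p" "\<lambda>f. dirderivs (map v ys) f p" \<kappa>
        "monomial_at u p S \<alpha>" "monomial_at u p S \<beta>"])
    show "dirderivs (map v xs) (monomial_at u p S \<alpha>) p \<noteq> 0" "dirderivs (map v ys) (monomial_at u p S \<beta>) p \<noteq> 0"
      using dirderivs_monomial_at_center[OF dual sub(1)] dirderivs_monomial_at_center[OF dual sub(2)]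
      by (simp_all add: xs ys)
    have "\<not> ((\<forall>j. \<beta> j \<le> \<alpha> j) \<and> (\<forall>j\<in>S. \<alpha> j \<le> \<beta> j))"
      using \<open>\<alpha> \<noteq> \<beta>\<close> \<alpha> \<beta> by (metis ext le_antisym)
    then show "dirderivs (map v ys) (monomial_at u p S \<alpha>) p = 0"
      using dirderivs_monomial_at_center[OF dual sub(2), of p \<alpha>] unfolding ys by blast
  qed (simp_all add: fock_functional_dirderivs polyfuns_fock polyfuns_monomial_at eigL sub
      prod_list_count_list xs ys \<kappa>_def eq)
qed

text \<open>Splitting an integer exponent into positive and negative parts turns a resonance into an
  equality of two monomials in the eigenvalues.\<close>

lemma eigenvalues_nonresonant:
  fixes S :: "'n set"
  assumes dual: "\<And>i j. i \<in> S \<Longrightarrow> j \<in> S \<Longrightarrow> lform (u j) (v i) = (if j = i then 1 else 0)"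
    and eig: "\<And>i. i \<in> S \<Longrightarrow> A *v v i = \<mu> i *s v i"
  shows "nonresonant \<mu> S"
  unfolding nonresonant_def
proof (intro allI impI notI)
  fix \<gamma> :: "'n \<Rightarrow> int"
  assume supp: "\<forall>j. j \<notin> S \<longrightarrow> \<gamma> j = 0" and nz: "\<exists>j\<in>S. \<gamma> j \<noteq> 0" and one: "(\<Prod>j\<in>S. \<mu> j powi \<gamma> j) = 1"
  define \<alpha> where "\<alpha> = (\<lambda>j. nat (\<gamma> j))"
  define \<beta> where "\<beta> = (\<lambda>j. nat (- \<gamma> j))"
  have \<mu>: "\<mu> j \<noteq> 0" if "j \<in> S" for j
    using kernel_trivial[of "v j"] eig[OF that] dual[OF that that] by auto
  have UNIV_S: "(\<Prod>j\<in>UNIV. \<mu> j ^ \<delta> j) = (\<Prod>j\<in>S. \<mu> j ^ \<delta> j)" if "\<And>j. j \<notin> S \<Longrightarrow> \<delta> j = (0::nat)" for \<delta>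
    by (rule prod.mono_neutral_right) (use that in auto)
  have "(\<Prod>j\<in>S. \<mu> j ^ \<alpha> j) = (\<Prod>j\<in>S. \<mu> j powi \<gamma> j * \<mu> j ^ \<beta> j)"
    by (rule prod.cong) (use \<mu> in \<open>auto simp: \<alpha>_def \<beta>_def power_int_def power_inverse field_simps\<close>)
  also have "\<dots> = (\<Prod>j\<in>S. \<mu> j ^ \<beta> j)"
    by (simp add: prod.distrib one)
  finally have "\<alpha> = \<beta>"
    using supp by (intro eigenvalue_monomials_distinct[OF dual eig]) (auto simp: \<alpha>_def \<beta>_def UNIV_S)
  then have "\<gamma> j = 0" for j
  proof -
    have "nat (\<gamma> j) = nat (- \<gamma> j)"
      using \<open>\<alpha> = \<beta>\<close> unfolding \<alpha>_def \<beta>_def by (rule fun_cong)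
    then show ?thesis by arith
  qed
  with nz show False by blast
qed

end

section \<open>The normal form of the matrix\<close>

lemma invertible_columns:
  fixes e :: "'n \<Rightarrow> complex^'n"
  assumes "vec.span (range e) = UNIV"
  obtains P :: "complex^'n^'n" where "invertible P" "\<And>j. column j P = e j"
proof -
  define P :: "complex^'n^'n" where "P = (\<chi> i j. e j $ i)"
  have col: "column j P = e j" for j
    by (simp add: P_def column_def vec_eq_iff)
  have "columns P = range e"
    by (auto simp: columns_def col)
  then have "invertible P"
    using assms by (metis invertible_right_inverse matrix_right_invertible_span_columns)
  with col show ?thesis
    using that by blast
qed

section \<open>Similarity to a normal form, read off from the columns\<close>

lemma matrix_mult_eq_iff_columns:
  fixes A P J :: "complex^'n^'n"
  shows "A ** P = P ** J \<longleftrightarrow> (\<forall>j. A *v column j P = (\<Sum>i\<in>UNIV. J $ i $ j *s column i P))"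
proof -
  have "(A ** P) $ i $ j = (A *v column j P) $ i" for i j
    by (simp add: matrix_matrix_mult_def matrix_vector_mult_def column_def)
  moreover have "(P ** J) $ i $ j = (\<Sum>i\<in>UNIV. J $ i $ j *s column i P) $ i" for i j
    by (simp add: matrix_matrix_mult_def column_def mult.commute)
  ultimately have "A ** P = P ** J \<longleftrightarrow>
      (\<forall>i j. (A *v column j P) $ i = (\<Sum>i\<in>UNIV. J $ i $ j *s column i P) $ i)"
    unfolding vec_eq_iff[of "A ** P"] vec_eq_iff[of "(A ** P) $ _"] by simp
  also have "\<dots> \<longleftrightarrow> (\<forall>j i. (A *v column j P) $ i = (\<Sum>i\<in>UNIV. J $ i $ j *s column i P) $ i)"
    by (rule all_comm)
  finally show ?thesis
    unfolding vec_eq_iff[of "A *v _"] .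
qed

lemma matrix_mult_diag_iff:
  fixes A P :: "complex^'n^'n"
  shows "A ** P = P ** diag_mat \<mu> \<longleftrightarrow> (\<forall>j. A *v column j P = \<mu> j *s column j P)"
proof -
  have "(\<Sum>i\<in>UNIV. diag_mat \<mu> $ i $ j *s column i P) = \<mu> j *s column j P" for j
  proof -
    have "(\<Sum>i\<in>UNIV. diag_mat \<mu> $ i $ j *s column i P) = (\<Sum>i\<in>UNIV. if i = j then \<mu> j *s column j P else 0)"
      by (rule sum.cong) (auto simp: diag_mat_def)
    then show ?thesis by simp
  qed
  then show ?thesis
    by (simp add: matrix_mult_eq_iff_columns)
qed

lemma matrix_mult_jordan2_iff:
  fixes A P :: "complex^'n^'n"
  assumes "i0 \<noteq> i1"
  shows "A ** P = P ** jordan2_mat \<mu> i0 i1 \<longleftrightarrow>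
    (\<forall>j. A *v column j P = \<mu> j *s column j P + (if j = i1 then column i0 P else 0))"
proof -
  have "(\<Sum>i\<in>UNIV. jordan2_mat \<mu> i0 i1 $ i $ j *s column i P)
      = \<mu> j *s column j P + (if j = i1 then column i0 P else 0)" for j
  proof -
    have "(\<Sum>i\<in>UNIV. jordan2_mat \<mu> i0 i1 $ i $ j *s column i P)
        = (\<Sum>i\<in>UNIV. (if i = j then \<mu> j *s column j P else 0)
            + (if i = i0 then if j = i1 then column i0 P else 0 else 0))"
      by (rule sum.cong) (use assms in \<open>auto simp: jordan2_mat_def\<close>)
    then show ?thesis
      by (simp add: sum.distrib)
  qed
  then show ?thesis
    by (simp add: matrix_mult_eq_iff_columns)
qed

text \<open>The vector \<open>q(A) v\<close>, computed from the orbit of \<open>v\<close> rather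
  than from matrix powers.\<close>

definition poly_mat_act :: "complex^'n^'n \<Rightarrow> complex poly \<Rightarrow> complex^'n \<Rightarrow> complex^'n" where
  "poly_mat_act A q v = (\<Sum>i\<le>degree q. coeff q i *s (((*v) A ^^ i) v))"

lemma poly_mat_act_bound:
  "degree q \<le> n \<Longrightarrow> poly_mat_act A q v = (\<Sum>i\<le>n. coeff q i *s (((*v) A ^^ i) v))"
  unfolding poly_mat_act_def
  by (rule sum.mono_neutral_left) (auto simp: coeff_eq_0)

lemma mat_funpow_linear:
  fixes A :: "complex^'n^'n"
  shows "((*v) A ^^ i) (c *s v + w) = c *s ((*v) A ^^ i) v + ((*v) A ^^ i) w"
  by (induction i) (simp_all add: vec.add vec.scale)

text \<open>Polynomials in \<open>A\<close> commute with \<open>A\<close>, so a linear factor may be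
  applied first; this peels off one root.\<close>

lemma poly_mat_act_linear_factor:
  "poly_mat_act A ([:- \<mu>, 1:] * r) v = poly_mat_act A r (A *v v - \<mu> *s v)"
proof -
  define n where "n = degree r"
  have "poly_mat_act A ([:- \<mu>, 1:] * r) v
      = (\<Sum>i\<le>Suc n. (- \<mu> * coeff r i) *s (((*v) A ^^ i) v) + coeff (pCons 0 r) i *s (((*v) A ^^ i) v))"
    using degree_mult_le[of "[:- \<mu>, 1:]" r]
    by (subst poly_mat_act_bound[of _ "Suc n"]) (auto simp: n_def vec.scale_left_distrib)
  also have "\<dots> = (\<Sum>i\<le>Suc n. (- \<mu> * coeff r i) *s (((*v) A ^^ i) v))
      + (\<Sum>i\<le>Suc n. coeff (pCons 0 r) i *s (((*v) A ^^ i) v))"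
    by (rule sum.distrib)
  also have "(\<Sum>i\<le>Suc n. (- \<mu> * coeff r i) *s (((*v) A ^^ i) v))
      = (\<Sum>i\<le>n. (- \<mu> * coeff r i) *s (((*v) A ^^ i) v))"
    by (simp add: n_def coeff_eq_0)
  also have "(\<Sum>i\<le>Suc n. coeff (pCons 0 r) i *s (((*v) A ^^ i) v))
      = (\<Sum>i\<le>n. coeff r i *s (((*v) A ^^ i) (A *v v)))"
    by (subst sum.atMost_Suc_shift) (simp add: funpow_swap1)
  also have "(\<Sum>i\<le>n. (- \<mu> * coeff r i) *s (((*v) A ^^ i) v)) + \<dots>
      = (\<Sum>i\<le>n. coeff r i *s (((*v) A ^^ i) ((- \<mu>) *s v + A *v v)))"
    unfolding mat_funpow_linear
    by (simp add: sum.distrib[symmetric] vec.scale_right_distrib mult.commute)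
  finally show ?thesis
    by (simp add: poly_mat_act_def n_def)
qed

text \<open>In dimension \<open>n\<close> the \<open>n + 1\<close> vectors
  \<open>v, A v, ..., A^n v\<close> satisfy a linear relation.\<close>

lemma annihilating_poly:
  fixes A :: "complex^'n^'n"
  obtains q where "q \<noteq> 0" "poly_mat_act A q v = 0"
proof -
  define x where "x = (\<lambda>i. ((*v) A ^^ i) v)"
  define n where "n = CARD('n)"
  have "\<exists>c::nat \<Rightarrow> complex. (\<exists>i\<le>n. c i \<noteq> 0) \<and> (\<Sum>i\<le>n. c i *s x i) = 0"
  \<comment> \<open>Dependence is a property of the set of vectors, so a repetition in the list is
    treated separately; it gives a relation directly.\<close>
  proof (cases "inj_on x {..n}")
    case True
    then have "card (x ` {..n}) > vec.dim (UNIV :: (complex^'n) set)"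
      by (simp add: card_image n_def vec_dim_card del: vec.dim_UNIV)
    then have "vec.dependent (x ` {..n})"
      by (metis subset_UNIV vec.independent_card_le_dim linorder_not_le)
    then obtain u where u: "\<exists>w\<in>x ` {..n}. u w \<noteq> 0" "(\<Sum>w\<in>x ` {..n}. u w *s w) = 0"
      using vec.dependent_finite[of "x ` {..n}"] by auto
    then have "(\<Sum>i\<le>n. u (x i) *s x i) = 0"
      using sum.reindex[OF True, of "\<lambda>w. u w *s w"] by simp
    with u(1) show ?thesis
      by (intro exI[of _ "\<lambda>i. u (x i)"]) auto
  next
    case False
    then obtain i j where ij: "i \<le> n" "j \<le> n" "i \<noteq> j" "x i = x j"
      by (auto simp: inj_on_def)
    define c where "c = (\<lambda>k. if k = i then 1 else if k = j then - 1 else (0::complex))"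
    have "(\<Sum>k\<le>n. c k *s x k) = (\<Sum>k\<le>n. (if k = i then x i else 0) + (if k = j then - x j else 0))"
      by (rule sum.cong) (use ij(3) in \<open>auto simp: c_def\<close>)
    also have "\<dots> = 0"
      using ij by (simp add: sum.distrib)
    finally show ?thesis
      using ij(1) by (intro exI[of _ c]) (auto simp: c_def)
  qed
  then obtain c i where c: "i \<le> n" "c i \<noteq> 0" "(\<Sum>i\<le>n. c i *s x i) = 0"
    by blast
  define q where "q = (\<Sum>i\<le>n. monom (c i) i)"
  have coeff: "coeff q i = (if i \<le> n then c i else 0)" for i
    by (simp add: q_def coeff_sum)
  have "degree q \<le> n"
    by (rule degree_le) (simp add: coeff)
  then have "poly_mat_act A q v = 0"
    using c(3) by (simp add: poly_mat_act_bound coeff x_def)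
  moreover have "q \<noteq> 0"
    using c coeff[of i] by auto
  ultimately show ?thesis
    using that by blast
qed

text \<open>An annihilating polynomial of \<open>v\<close> splits into linear factors, and
  saturation removes them one by one until \<open>v\<close> is reached. This replaces the general
  Jordan form: it suffices that no \<open>A - \<mu>\<close> maps a vector from outside
  \<open>G\<close> into \<open>G\<close>.\<close>

lemma subspace_eq_UNIV_if_saturated:
  fixes A :: "complex^'n^'n"
  assumes G: "vec.subspace G" and sat: "\<And>\<mu> v. A *v v - \<mu> *s v \<in> G \<Longrightarrow> v \<in> G"
  shows "G = UNIV"
proof -
  have step: "v \<in> G" if "q \<noteq> 0" "poly_mat_act A q v \<in> G" for q v
    using that
  proof (induction "degree q" arbitrary: q v)
    case 0
    then obtain c where "q = [:c:]"
      using degree_eq_zeroE by metis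
    with 0 have "c \<noteq> 0" "c *s v \<in> G"
      by (auto simp: poly_mat_act_def)
    then show ?case
      using vec.subspace_scale[OF G, of "c *s v" "inverse c"] by simp
  next
    case (Suc n)
    have "coeff q (degree q) \<noteq> 0"
      using Suc.prems(1) by simp
    then have "\<exists>i\<in>{1..degree q}. coeff q i \<noteq> 0"
      using Suc.hyps(2) by (intro bexI[of _ "degree q"]) auto
    then obtain \<mu> where "poly q \<mu> = 0"
      using fundamental_theorem_of_algebra[of "coeff q" "degree q"] by (auto simp: poly_altdef)
    then obtain r where r: "q = [:- \<mu>, 1:] * r"
      unfolding poly_eq_0_iff_dvd by blast
    with Suc.prems have "r \<noteq> 0"
      by auto
    then have "degree q = Suc (degree r)"
      unfolding r by (subst degree_mult_eq) auto
    moreover have "poly_mat_act A r (A *v v - \<mu> *s v) \<in> G"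
      using Suc.prems(2) unfolding r poly_mat_act_linear_factor .
    ultimately have "A *v v - \<mu> *s v \<in> G"
      using Suc.hyps(1)[of r "A *v v - \<mu> *s v"] Suc.hyps(2) \<open>r \<noteq> 0\<close> by simp
    then show ?case by (rule sat)
  qed
  show ?thesis
  proof (rule UNIV_eq_I[symmetric])
    fix v
    obtain q where "q \<noteq> 0" "poly_mat_act A q v = 0"
      by (rule annihilating_poly)
    then show "v \<in> G"
      using step vec.subspace_0[OF G] by metis
  qed
qed

text \<open>Splits off the part of a span of eigenvectors on which \<open>A - \<mu>\<close> is invertible.\<close>
lemma eigenvector_span_split:
  fixes A :: "complex^'n^'n"
  assumes w: "w \<in> vec.span {v. \<exists>\<nu>. A *v v = \<nu> *s v}"
  shows "\<exists>x\<in>vec.span {v. \<exists>\<nu>. A *v v = \<nu> *s v}. \<exists>r. A *v r = \<mu> *s r \<and> w = (A *v x - \<mu> *s x) + r"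
  using w
proof (induction rule: vec.span_induct_alt)
  case base
  show ?case
    by (intro bexI[of _ 0] exI[of _ 0]) (auto simp: vec.span_zero)
next
  case (step c v w)
  let ?E = "{v. \<exists>\<nu>. A *v v = \<nu> *s v}"
  obtain \<nu> where \<nu>: "A *v v = \<nu> *s v"
    using step.hyps by auto
  obtain x r where x: "x \<in> vec.span ?E" and r: "A *v r = \<mu> *s r" and w: "w = (A *v x - \<mu> *s x) + r"
    using step.IH by auto
  show ?case
  proof (cases "\<nu> = \<mu>")
    case True
    have "A *v (c *s v + r) = \<mu> *s (c *s v + r)"
      by (simp add: vec.add vec.scale \<nu> r True vec.scale_right_distrib mult.commute)
    with x w show ?thesis
      by (intro bexI[of _ x] exI[of _ "c *s v + r"]) auto
  next
    case False
    \<comment> \<open>On \<open>v\<close> the map \<open>A - \<mu>\<close> is multiplication by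
      \<open>\<nu> - \<mu>\<close>, so \<open>y\<close> is a preimage of
      \<open>c *s v\<close>.\<close>
    define y where "y = (c / (\<nu> - \<mu>)) *s v"
    have "A *v y - \<mu> *s y = c *s v"
    proof -
      have "A *v y - \<mu> *s y = (c / (\<nu> - \<mu>) * \<nu> - \<mu> * (c / (\<nu> - \<mu>))) *s v"
        by (simp add: y_def vec.scale \<nu> vec.scale_left_diff_distrib)
      also have "c / (\<nu> - \<mu>) * \<nu> - \<mu> * (c / (\<nu> - \<mu>)) = c / (\<nu> - \<mu>) * (\<nu> - \<mu>)"
        by (simp add: algebra_simps diff_divide_distrib)
      also have "\<dots> = c"
        using False by simp
      finally show ?thesis .
    qed
    then have "c *s v + w = (A *v (y + x) - \<mu> *s (y + x)) + r"
      by (simp add: w vec.add vec.scale_right_distrib)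
    moreover have "y + x \<in> vec.span ?E"
      unfolding y_def using x step.hyps
      by (intro vec.span_add vec.span_scale) (auto intro: vec.span_base)
    ultimately show ?thesis
      using r by blast
  qed
qed

lemma basis_enumeration:
  fixes B :: "(complex^'n) set"
  assumes "vec.independent B" "vec.span B = UNIV"
  obtains e :: "'n \<Rightarrow> complex^'n" where "bij_betw e UNIV B"
proof -
  have "finite B \<and> card B = CARD('n)"
    using vec.basis_card_eq_dim[of B UNIV] vec.finiteI_independent[of B] assms
    by (simp add: vec_dim_card del: vec.dim_UNIV)
  then show ?thesis
    using finite_same_card_bij[of "UNIV :: 'n set" B] that by auto
qed

context cyclic_comp_op
begin

text \<open>The candidate space is the span of all eigenvectors, enlarged by a vector
  \<open>u\<close> that continues some eigenvector to a chain, if there is one. The excluded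
  configurations of chains make it saturated, and a basis is then chosen from its
  generators.\<close>

lemma diagonal_or_jordan2:
  "(\<exists>(P::complex^'n^'n) \<mu>. invertible P \<and> A ** P = P ** diag_mat \<mu>) \<or>
   (\<exists>(P::complex^'n^'n) \<mu> i0 i1. i0 \<noteq> i1 \<and> \<mu> i0 = \<mu> i1 \<and> invertible P \<and> A ** P = P ** jordan2_mat \<mu> i0 i1)"
proof -
  define E where "E = {v. \<exists>\<nu>. A *v v = \<nu> *s v}"
  show ?thesis
  proof (cases "\<exists>\<mu>0 v0 u. v0 \<noteq> 0 \<and> A *v v0 = \<mu>0 *s v0 \<and> A *v u = \<mu>0 *s u + v0")
    case False
    have "vec.span E = UNIV"
    proof (rule subspace_eq_UNIV_if_saturated[of _ A])
      fix \<mu> v assume "A *v v - \<mu> *s v \<in> vec.span E"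
      then obtain x r where x: "x \<in> vec.span E" and r: "A *v r = \<mu> *s r"
        and eq: "A *v v - \<mu> *s v = (A *v x - \<mu> *s x) + r"
        using eigenvector_span_split[of "A *v v - \<mu> *s v" A \<mu>] unfolding E_def by blast
      \<comment> \<open>A nonzero \<open>r\<close> would be the base of a chain of length two with
        top \<open>v - x\<close>.\<close>
      have d: "A *v (v - x) = \<mu> *s (v - x) + r"
        using eq by (simp add: vec.diff vec.scale_right_diff_distrib algebra_simps)
      with False r have "r = 0"
        by blast
      with d have "v - x \<in> E"
        unfolding E_def by auto
      then have "(v - x) + x \<in> vec.span E"
        by (intro vec.span_add x vec.span_base)
      then show "v \<in> vec.span E"
        by (simp only: diff_add_cancel)
    qed (rule vec.subspace_span)
    moreover obtain B where B: "B \<subseteq> E" "vec.independent B" "E \<subseteq> vec.span B"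
      using vec.maximal_independent_subset by blast
    ultimately have span: "vec.span B = UNIV"
      by (metis UNIV_I subsetI subset_antisym vec.span_minimal vec.subspace_span subset_UNIV)
    obtain e :: "'n \<Rightarrow> complex^'n" where e: "bij_betw e UNIV B"
      using basis_enumeration[OF B(2) span] by blast
    then have range: "range e = B"
      by (simp add: bij_betw_def)
    obtain P :: "complex^'n^'n" where P: "invertible P" "\<And>j. column j P = e j"
      using invertible_columns[of e] span range by metis
    have "\<exists>\<nu>. A *v e j = \<nu> *s e j" for j
      using range B(1) unfolding E_def by blast
    then obtain \<mu> where "\<And>j. A *v e j = \<mu> j *s e j"
      by metis
    then have "A ** P = P ** diag_mat \<mu>"
      by (simp add: matrix_mult_diag_iff P)
    with P(1) show ?thesis by blast
  next
    case True
    then obtain \<mu>0 v0 u where v0: "v0 \<noteq> 0" "A *v v0 = \<mu>0 *s v0" and u: "A *v u = \<mu>0 *s u + v0"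
      by blast
    have v0E: "v0 \<in> E"
      using v0 by (auto simp: E_def)
    have span: "vec.span (insert u E) = UNIV"
    proof (rule subspace_eq_UNIV_if_saturated[of _ A])
      let ?G = "vec.span (insert u E)"
      have EG: "vec.span E \<subseteq> ?G"
        by (rule vec.span_mono) auto
      have uG: "u \<in> ?G" and v0G: "v0 \<in> ?G"
        using v0E by (auto intro: vec.span_base)
      fix \<mu> v assume "A *v v - \<mu> *s v \<in> ?G"
      then obtain c where "A *v v - \<mu> *s v - c *s u \<in> vec.span E"
        unfolding vec.span_breakdown_eq by blast
      then obtain x r where x: "x \<in> vec.span E" and r: "A *v r = \<mu> *s r"
        and eq: "A *v v - \<mu> *s v - c *s u = (A *v x - \<mu> *s x) + r"
        using eigenvector_span_split[of "A *v v - \<mu> *s v - c *s u" A \<mu>] unfolding E_def by blast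
      show "v \<in> ?G"
      proof (cases "\<mu> = \<mu>0")
        case True
        \<comment> \<open>The eigenspace of \<mu>0 is a line, so \<open>r\<close> is a multiple of
          \<open>v0\<close>, which a multiple of \<open>u\<close> removes because
          \<open>A - \<mu>0\<close> sends \<open>u\<close> to \<open>v0\<close>.\<close>
        have "r \<in> vec.span {v0}"
          using eigenvectors_dependent[OF v0] r True by simp
        then obtain k where k: "r = k *s v0"
          by (auto simp: vec.span_singleton)
        define d where "d = v - x - k *s u"
        have d: "A *v d = \<mu>0 *s d + c *s u"
          using eq True unfolding d_def
          by (simp add: vec.diff vec.scale u k vec.scale_right_diff_distrib vec.scale_right_distrib
              algebra_simps)
        \<comment> \<open>Otherwise \<open>inverse c *s d\<close> would sit above \<open>u\<close>
          in a chain of length three.\<close>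
        have "c = 0"
        proof (rule ccontr)
          assume "c \<noteq> 0"
          have "A *v (inverse c *s d) = \<mu>0 *s (inverse c *s d) + u"
            using \<open>c \<noteq> 0\<close> by (simp add: vec.scale d vec.scale_right_distrib mult.commute)
          with no_chain3[OF v0 u] show False by blast
        qed
        with d have "d \<in> E"
          by (auto simp: E_def)
        then have "d + x + k *s u \<in> ?G"
          using x EG uG by (intro vec.span_add vec.span_scale) (auto intro: vec.span_base)
        moreover have "v = d + x + k *s u"
          by (simp add: d_def)
        ultimately show ?thesis by (simp only:)
      next
        case False
        define a where "a = inverse (\<mu>0 - \<mu>)"
        have a: "a * (\<mu>0 - \<mu>) = 1"
          using False by (simp add: a_def)
        \<comment> \<open>The map \<open>A - \<mu>\<close> is invertible on the span of
          \<open>u\<close> and \<open>v0\<close>, and \<open>y\<close> is its preimage of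
          \<open>c *s u\<close>.\<close>
        define y where "y = (c * a) *s (u - a *s v0)"
        have "A *v y - \<mu> *s y = (c * (a * (\<mu>0 - \<mu>))) *s u + (c * a * (1 - a * (\<mu>0 - \<mu>))) *s v0"
          by (simp add: y_def vec.scale vec.diff u v0 vec_eq_iff algebra_simps)
        then have y: "A *v y - \<mu> *s y = c *s u"
          by (simp add: a)
        define d where "d = v - x - y"
        have d: "A *v d = \<mu> *s d + r"
          using eq y unfolding d_def
          by (simp add: vec.diff vec.scale_right_diff_distrib algebra_simps)
        \<comment> \<open>A nonzero \<open>r\<close> would start a second chain, for a different
          eigenvalue.\<close>
        have "r = 0"
          using no_two_chains[OF v0 u _ r d] False by blast
        with d have "d \<in> E"
          by (auto simp: E_def)
        then have "d + x + y \<in> ?G"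
          unfolding y_def using x EG uG v0G
          by (intro vec.span_add vec.span_scale vec.span_diff) (auto intro: vec.span_base)
        moreover have "v = d + x + y"
          by (simp add: d_def)
        ultimately show ?thesis by (simp only:)
      qed
    qed (rule vec.subspace_span)
    have "u \<notin> vec.span {v0}"
      using span_eigenvector[OF v0(2), of u] u v0 by auto
    moreover have "vec.independent {v0}"
      using v0(1) by simp
    ultimately have "vec.independent {u, v0}"
      by (simp add: vec.independent_insertI)
    \<comment> \<open>Extending \<open>{u, v0}\<close> inside \<open>insert u E\<close> makes every
      basis vector other than \<open>u\<close> an eigenvector.\<close>
    then obtain B where B: "{u, v0} \<subseteq> B" "B \<subseteq> insert u E" "vec.independent B" "insert u E \<subseteq> vec.span B"
      using vec.maximal_independent_subset_extend[of "{u, v0}" "insert u E"] v0E by auto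
    have spanB: "vec.span B = UNIV"
      using B(4) span by (metis subset_antisym subset_UNIV vec.span_minimal vec.subspace_span)
    obtain e :: "'n \<Rightarrow> complex^'n" where e: "bij_betw e UNIV B"
      using basis_enumeration[OF B(3) spanB] by blast
    then have range: "range e = B" and inj: "inj e"
      by (simp_all add: bij_betw_def)
    obtain P :: "complex^'n^'n" where P: "invertible P" "\<And>j. column j P = e j"
      using invertible_columns[of e] spanB range by metis
    obtain i0 i1 where i0: "e i0 = v0" and i1: "e i1 = u"
      using B(1) range by (metis image_iff insert_subset)
    have "i0 \<noteq> i1"
      using i0 i1 \<open>u \<notin> vec.span {v0}\<close> vec.span_base[of v0 "{v0}"] by auto
    have "\<exists>\<nu>. A *v e j = \<nu> *s e j" if "j \<noteq> i1" for j
    proof -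
      have "e j \<noteq> u"
        using that inj i1 by (metis injD)
      then have "e j \<in> E"
        using range B(2) by blast
      then show ?thesis by (simp add: E_def)
    qed
    then obtain \<nu> where \<nu>: "\<And>j. j \<noteq> i1 \<Longrightarrow> A *v e j = \<nu> j *s e j"
      by metis
    \<comment> \<open>The vector \<open>e i1 = u\<close> is not an eigenvector; its diagonal entry
      is set to the eigenvalue of its chain.\<close>
    define \<mu> where "\<mu> = \<nu>(i1 := \<mu>0)"
    have "\<nu> i0 *s v0 = \<mu>0 *s v0"
      using \<nu>[OF \<open>i0 \<noteq> i1\<close>] i0 v0 by simp
    then have "\<nu> i0 = \<mu>0"
      using v0(1) by simp
    then have "\<mu> i0 = \<mu> i1"
      using \<open>i0 \<noteq> i1\<close> by (simp add: \<mu>_def)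
    moreover have "A ** P = P ** jordan2_mat \<mu> i0 i1"
      unfolding matrix_mult_jordan2_iff[OF \<open>i0 \<noteq> i1\<close>] P
      by (auto simp: \<mu>_def \<nu> i0 i1 u)
    ultimately show ?thesis
      using P(1) \<open>i0 \<noteq> i1\<close> by blast
  qed
qed

lemma invertible_matrix: "invertible A"
  using kernel_trivial by (simp add: invertible_left_inverse matrix_left_invertible_ker)

text \<open>The rows of the inverse of \<open>P\<close> form the basis dual to its columns.\<close>

lemma nonresonant_columns:
  assumes P: "invertible (P::complex^'n^'n)" and eig: "\<And>j. j \<in> S \<Longrightarrow> A *v column j P = \<mu> j *s column j P"
  shows "nonresonant \<mu> S"
proof -
  obtain Q where Q: "Q ** P = mat 1"
    using P by (auto simp: invertible_left_inverse)
  have "lform (Q $ j) (column i P) = (Q ** P) $ j $ i" for i j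
    by (simp add: lform_def matrix_matrix_mult_def column_def)
  then have "lform (Q $ j) (column i P) = (if j = i then 1 else 0)" for i j
    by (simp add: Q mat_def)
  then show ?thesis
    by (intro eigenvalues_nonresonant[of S "\<lambda>j. Q $ j" "\<lambda>j. column j P"] eig)
qed

lemma normal_form:
  "invertible A \<and>
     ((\<exists>(P::complex^'n^'n) \<mu>. invertible P \<and> A ** P = P ** diag_mat \<mu> \<and> nonresonant \<mu> UNIV) \<or>
      (\<exists>(P::complex^'n^'n) \<mu> i0 i1. i0 \<noteq> i1 \<and> \<mu> i0 = \<mu> i1 \<and> invertible P \<and>
          A ** P = P ** jordan2_mat \<mu> i0 i1 \<and> nonresonant \<mu> (UNIV - {i1})))"
  (is "_ \<and> (?D \<or> ?J)")
proof -
  have diag: "nonresonant \<mu> UNIV" if "invertible P" "A ** P = P ** diag_mat \<mu>" for P :: "complex^'n^'n" and \<mu>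
    using that by (intro nonresonant_columns[of P]) (auto simp: matrix_mult_diag_iff)
  have jordan: "nonresonant \<mu> (UNIV - {i1})"
    if "i0 \<noteq> i1" "invertible P" "A ** P = P ** jordan2_mat \<mu> i0 i1" for P :: "complex^'n^'n" and \<mu> i0 i1
    using that by (intro nonresonant_columns[of P]) (auto simp: matrix_mult_jordan2_iff)
  from diagonal_or_jordan2 have "?D \<or> ?J"
  proof (elim disjE exE conjE)
    fix P :: "complex^'n^'n" and \<mu> assume P: "invertible P" "A ** P = P ** diag_mat \<mu>"
    show ?thesis
      by (rule disjI1, rule exI[of _ P], rule exI[of _ \<mu>], intro conjI P diag[OF P])
  next
    fix P :: "complex^'n^'n" and \<mu> i0 i1
    assume i: "i0 \<noteq> i1" "\<mu> i0 = \<mu> i1" and P: "invertible P" "A ** P = P ** jordan2_mat \<mu> i0 i1"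
    show ?thesis
      by (rule disjI2, rule exI[of _ P], rule exI[of _ \<mu>], rule exI[of _ i0], rule exI[of _ i1],
          intro conjI i P jordan[OF i(1) P])
  qed
  with invertible_matrix show ?thesis
    by (rule conjI)
qed

end

section \<open>Polynomials in a composition operator\<close>

text \<open>Normalising the direction enlarges the ball by 1 for every \<open>h\<close>, so the
  estimate bounds the operator norm of the derivative, as termwise differentiation requires.\<close>

lemma norm_dirderiv_le_mult:
  assumes f: "entire_fun f" and le: "\<And>w. norm w \<le> norm z + 1 \<Longrightarrow> cmod (f w) \<le> B"
  shows "cmod (dirderiv h f z) \<le> B * norm h"
proof (cases "h = 0")
  case True
  then show ?thesis
    by (simp add: dirderiv_def)
next
  case False
  define v where "v = complex_of_real (inverse (norm h)) *s h"
  have "norm v = 1"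
    using False by (simp add: v_def norm_scalar_mult_complex norm_inverse)
  moreover have h: "h = complex_of_real (norm h) *s v"
    using False by (simp add: v_def vec_eq_iff)
  ultimately have "cmod (dirderiv v f z) \<le> B"
    using le by (intro norm_dirderiv_le f) auto
  then have "cmod (dirderiv (complex_of_real (norm h) *s v) f z) \<le> norm h * B"
    by (simp add: dirderiv_scalar_mult[OF f] norm_mult mult_left_mono)
  then show ?thesis
    using h by (simp add: mult.commute)
qed

text \<open>Cauchy's estimate transfers the summable majorant from the functions to their
  derivatives, so the series may be differentiated term by term.\<close>

lemma entire_fun_series:
  fixes f :: "nat \<Rightarrow> complex^'n \<Rightarrow> complex"
  assumes f: "\<And>m. entire_fun (f m)"
    and bound: "\<And>R. \<exists>B. summable B \<and> (\<forall>m z. norm z \<le> R \<longrightarrow> cmod (f m z) \<le> B m)"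
  shows "entire_fun (\<lambda>z. \<Sum>m. f m z)"
proof (rule entire_funI)
  fix z0 :: "complex^'n"
  define S where "S = ball (0::complex^'n) (norm z0 + 1)"
  \<comment> \<open>The ball \<open>S\<close> has radius \<open>norm z0 + 1\<close>, and Cauchy's
    estimate costs one more.\<close>
  obtain B where B: "summable B" and le: "\<And>m z. norm z \<le> norm z0 + 2 \<Longrightarrow> cmod (f m z) \<le> B m"
    using bound by meson
  have B0: "B m \<ge> 0" for m
    by (rule order_trans[OF norm_ge_zero le[of 0 m]]) simp
  have dle: "cmod (dirderiv h (f m) z) \<le> B m * norm h" if "z \<in> S" for h m z
    using that by (intro norm_dirderiv_le_mult f le) (auto simp: S_def)
  have sumd: "summable (\<lambda>m. dirderiv h (f m) z)" if "z \<in> S" for h z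
    by (rule summable_comparison_test'[OF summable_mult2[OF B, of "norm h"]]) (use dle[OF that] in auto)
  define g' where "g' = (\<lambda>z h. \<Sum>m. dirderiv h (f m) z)"
  have z0: "z0 \<in> S"
    by (simp add: S_def)
  have sumf: "summable (\<lambda>m. f m z)" if "z \<in> S" for z
    by (rule summable_comparison_test'[OF B]) (use le that in \<open>auto simp: S_def\<close>)
  have "\<exists>g. \<forall>x\<in>S. (\<lambda>n. f n x) sums (g x) \<and> (g has_derivative g' x) (at x within S)"
  proof (rule has_derivative_series)
    show "(f n has_derivative (\<lambda>h. dirderiv h (f n) x)) (at x within S)" for n x
      by (rule has_derivative_at_withinI[OF entire_fun_has_derivative[OF f]])
    show "(\<lambda>n. f n z0) sums (\<Sum>n. f n z0)"
      using sumf[OF z0] by (rule summable_sums)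
    fix e :: real assume "e > 0"
    have "eventually (\<lambda>n. (\<Sum>m. B (m + n)) < e) sequentially"
      using order_tendstoD(2)[OF suminf_exist_split2 \<open>e > 0\<close>, of B] B B0 by simp
    then show "\<forall>\<^sub>F n in sequentially. \<forall>x\<in>S. \<forall>h. cmod ((\<Sum>i<n. dirderiv h (f i) x) - g' x h) \<le> e * norm h"
    proof eventually_elim
      case (elim n)
      show ?case
      proof (intro ballI allI)
        fix x h :: "complex^'n" assume x: "x \<in> S"
        have sB: "summable (\<lambda>m. B (m + n) * norm h)"
          using B by (intro summable_mult2) (simp add: summable_iff_shift)
        have "g' x h = (\<Sum>m. dirderiv h (f (m + n)) x) + (\<Sum>i<n. dirderiv h (f i) x)"
          unfolding g'_def by (rule suminf_split_initial_segment[OF sumd[OF x]])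
        then have "cmod ((\<Sum>i<n. dirderiv h (f i) x) - g' x h) = cmod (\<Sum>m. dirderiv h (f (m + n)) x)"
          by simp
        also have "\<dots> \<le> (\<Sum>m. B (m + n) * norm h)"
          by (rule norm_suminf_le[OF _ sB]) (rule dle[OF x])
        also have "\<dots> = (\<Sum>m. B (m + n)) * norm h"
          using B by (intro suminf_mult2[symmetric]) (simp add: summable_iff_shift)
        also have "\<dots> \<le> e * norm h"
          using elim by (intro mult_right_mono) auto
        finally show "cmod ((\<Sum>i<n. dirderiv h (f i) x) - g' x h) \<le> e * norm h" .
      qed
    qed
  qed (use z0 in \<open>auto simp: S_def\<close>)
  then obtain g where g: "\<And>x. x \<in> S \<Longrightarrow> (\<lambda>n. f n x) sums g x"
    "\<And>x. x \<in> S \<Longrightarrow> (g has_derivative g' x) (at x within S)"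
    by blast
  have "open S"
    by (simp add: S_def)
  then have "(g has_derivative g' z0) (at z0)"
    using g(2)[OF z0] at_within_open[OF z0] by simp
  then have "((\<lambda>z. \<Sum>m. f m z) has_derivative g' z0) (at z0)"
    by (rule has_derivative_transform_within_open[OF _ \<open>open S\<close> z0]) (use g(1) in \<open>auto simp: sums_iff\<close>)
  moreover have "g' z0 (c *s h) = c * g' z0 h" for c h
    unfolding g'_def using suminf_mult[OF sumd[OF z0], of c h] by (simp add: dirderiv_scalar_mult[OF f])
  ultimately show "\<exists>L. ((\<lambda>z. \<Sum>m. f m z) has_derivative L) (at z0) \<and> (\<forall>c h. L (c *s h) = c * L h)"
    by blast
qed

text \<open>The function \<open>q(T) f\<close> for \<open>T = comp_op \<phi>\<close>, written
  pointwise through the iterates of \<phi>.\<close>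

definition op_poly :: "('a \<Rightarrow> 'a) \<Rightarrow> complex poly \<Rightarrow> ('a \<Rightarrow> complex) \<Rightarrow> 'a \<Rightarrow> complex" where
  "op_poly \<phi> q f z = (\<Sum>i\<le>degree q. coeff q i * f ((\<phi> ^^ i) z))"

lemma op_poly_bound: "degree q \<le> n \<Longrightarrow> op_poly \<phi> q f z = (\<Sum>i\<le>n. coeff q i * f ((\<phi> ^^ i) z))"
  unfolding op_poly_def by (rule sum.mono_neutral_left) (auto simp: coeff_eq_0)

lemma op_poly_0 [simp]: "op_poly \<phi> 0 f z = 0"
  by (simp add: op_poly_def)

lemma op_poly_1 [simp]: "op_poly \<phi> 1 f z = f z"
  by (simp add: op_poly_def)

lemma op_poly_pCons: "op_poly \<phi> (pCons a q) f z = a * f z + op_poly \<phi> q f (\<phi> z)"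
proof -
  have "op_poly \<phi> (pCons a q) f z = (\<Sum>i\<le>Suc (degree q). coeff (pCons a q) i * f ((\<phi> ^^ i) z))"
    by (rule op_poly_bound) (rule degree_pCons_le)
  then show ?thesis
    by (subst (asm) sum.atMost_Suc_shift) (simp add: op_poly_def funpow_swap1)
qed

lemma op_poly_add: "op_poly \<phi> (q + r) f z = op_poly \<phi> q f z + op_poly \<phi> r f z"
proof -
  define n where "n = max (degree q) (degree r)"
  have "degree (q + r) \<le> n"
    by (simp add: n_def degree_add_le_max)
  then show ?thesis
    using op_poly_bound[of q n \<phi> f z] op_poly_bound[of r n \<phi> f z]
    by (simp add: op_poly_bound[of "q + r" n] n_def sum.distrib distrib_right)
qed

lemma op_poly_smult: "op_poly \<phi> (smult c q) f z = c * op_poly \<phi> q f z"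
  by (subst op_poly_bound[OF degree_smult_le]) (simp add: op_poly_def sum_distrib_left mult.assoc)

text \<open>Multiplicativity turns divisibility of polynomials into annihilation of
  functions.\<close>

lemma op_poly_mult: "op_poly \<phi> (q * r) f = op_poly \<phi> q (op_poly \<phi> r f)"
proof (induction q)
  case (pCons a q)
  show ?case
    by (rule ext) (simp add: op_poly_pCons op_poly_add op_poly_smult mult_pCons_left pCons)
qed (simp add: fun_eq_iff)

lemma op_poly_fun_add: "op_poly \<phi> q (\<lambda>z. f z + g z) z = op_poly \<phi> q f z + op_poly \<phi> q g z"
  by (simp add: op_poly_def distrib_left sum.distrib)

lemma op_poly_fun_cmult: "op_poly \<phi> q (\<lambda>z. c * f z) z = c * op_poly \<phi> q f z"
  by (simp add: op_poly_def sum_distrib_left mult_ac)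

lemma op_poly_fun_sum:
  "op_poly \<phi> q (\<lambda>z. \<Sum>i\<in>I. c i * f i z) z = (\<Sum>i\<in>I. c i * op_poly \<phi> q (f i) z)"
  unfolding op_poly_def sum_distrib_left
  by (subst sum.swap) (simp add: mult_ac)

lemma op_poly_eq_funpow: "op_poly \<phi> q f z = (\<Sum>i\<le>degree q. coeff q i * (comp_op \<phi> ^^ i) f z)"
  by (simp add: op_poly_def comp_op_funpow)

lemma op_poly_fock:
  fixes \<phi> :: "complex^'n \<Rightarrow> complex^'n"
  assumes "fock_bounded_op (comp_op \<phi>)"
  obtains M where "M \<ge> 0" "\<And>f. f \<in> fock_space \<Longrightarrow> op_poly \<phi> q f \<in> fock_space \<and>
    fock_norm (op_poly \<phi> q f) \<le> M * fock_norm f"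
proof -
  obtain M0 where T: "\<And>f. f \<in> fock_space \<Longrightarrow> comp_op \<phi> f \<in> fock_space"
    and M0: "\<And>f. f \<in> fock_space \<Longrightarrow> fock_norm (comp_op \<phi> f) \<le> M0 * fock_norm f"
    using assms by (auto simp: fock_bounded_op_def)
  \<comment> \<open>A nonnegative bound, so that its powers bound the iterates.\<close>
  define M1 where "M1 = max 0 M0"
  have "(comp_op \<phi> ^^ i) f \<in> fock_space \<and> fock_norm ((comp_op \<phi> ^^ i) f) \<le> M1 ^ i * fock_norm f"
    if f: "f \<in> fock_space" for i f
  proof (induction i)
    case (Suc i)
    have "fock_norm ((comp_op \<phi> ^^ Suc i) f) \<le> M0 * fock_norm ((comp_op \<phi> ^^ i) f)"
      using M0 Suc by simp
    also have "\<dots> \<le> M1 * fock_norm ((comp_op \<phi> ^^ i) f)"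
      by (intro mult_right_mono) (auto simp: M1_def)
    also have "\<dots> \<le> M1 * (M1 ^ i * fock_norm f)"
      using Suc by (intro mult_left_mono) (auto simp: M1_def)
    finally show ?case
      using Suc T by (simp add: mult.assoc)
  qed (use f in auto)
  note Ti = this
  define M where "M = (\<Sum>i\<le>degree q. cmod (coeff q i) * M1 ^ i)"
  show ?thesis
  proof (rule that[of M])
    show "M \<ge> 0"
      by (auto simp: M_def M1_def intro!: sum_nonneg)
    fix f :: "complex^'n \<Rightarrow> complex" assume f: "f \<in> fock_space"
    have mem: "(\<lambda>z. coeff q i * (comp_op \<phi> ^^ i) f z) \<in> fock_space" for i
      using Ti[OF f] by (intro fock_space_cmult) auto
    have eq: "op_poly \<phi> q f = (\<lambda>z. \<Sum>i\<le>degree q. coeff q i * (comp_op \<phi> ^^ i) f z)"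
      by (simp add: op_poly_eq_funpow fun_eq_iff)
    have "fock_norm (op_poly \<phi> q f) \<le> (\<Sum>i\<le>degree q. fock_norm (\<lambda>z. coeff q i * (comp_op \<phi> ^^ i) f z))"
      unfolding eq by (intro fock_norm_sum_le mem)
    also have "\<dots> \<le> (\<Sum>i\<le>degree q. cmod (coeff q i) * (M1 ^ i * fock_norm f))"
      unfolding fock_norm_cmult using Ti[OF f] by (intro sum_mono mult_left_mono) auto
    also have "\<dots> = M * fock_norm f"
      by (simp add: M_def sum_distrib_right mult.assoc)
    finally have "fock_norm (op_poly \<phi> q f) \<le> M * fock_norm f" .
    moreover have "op_poly \<phi> q f \<in> fock_space"
      unfolding eq by (intro fock_space_sum mem)
    ultimately show "op_poly \<phi> q f \<in> fock_space \<and> fock_norm (op_poly \<phi> q f) \<le> M * fock_norm f"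
      by blast
  qed
qed

text \<open>Lifting as in Hensel's lemma: adding a multiple of \<open>[:- a, 1:] ^ j\<close> to an
  inverse modulo the \<open>j\<close>-th power corrects it modulo the next one.\<close>

lemma inverse_mod_linear_power:
  fixes R :: "complex poly"
  assumes R: "poly R a \<noteq> 0"
  shows "\<exists>s. [:- a, 1:] ^ j dvd s * R - 1"
proof (induction j)
  case (Suc j)
  then obtain s q where q: "s * R - 1 = [:- a, 1:] ^ j * q"
    by (auto elim: dvdE)
  \<comment> \<open>This choice makes \<open>q + smult c R\<close> vanish at \<open>a\<close>, which
    contributes the new linear factor.\<close>
  define c where "c = - poly q a / poly R a"
  have "poly (q + smult c R) a = 0"
    using R by (simp add: c_def)
  then have "[:- a, 1:] dvd q + smult c R"
    unfolding poly_eq_0_iff_dvd .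
  then have "[:- a, 1:] ^ j * [:- a, 1:] dvd [:- a, 1:] ^ j * (q + smult c R)"
    by (rule mult_dvd_mono[OF dvd_refl])
  also have "[:- a, 1:] ^ j * (q + smult c R) = (s + smult c ([:- a, 1:] ^ j)) * R - 1"
    by (simp add: distrib_left distrib_right q[symmetric])
  finally show ?case
    unfolding power_Suc2 by blast
qed simp

text \<open>Chinese remaindering: the product of the other factors does not vanish at
  \<open>l n\<close>, hence is invertible modulo any power of \<open>[:- l n, 1:]\<close>.\<close>

lemma separating_poly:
  fixes l :: "nat \<Rightarrow> complex" and k :: "nat \<Rightarrow> nat"
  assumes "inj l"
  obtains p where "[:- l n, 1:] ^ k n dvd p - 1" "\<And>m. m < N \<Longrightarrow> m \<noteq> n \<Longrightarrow> [:- l m, 1:] ^ k m dvd p"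
proof -
  define Q where "Q = (\<lambda>m. [:- l m, 1:] ^ k m)"
  define R where "R = (\<Prod>m\<in>{..<N} - {n}. Q m)"
  have "poly R (l n) \<noteq> 0"
    using injD[OF assms] by (fastforce simp: R_def Q_def poly_prod)
  then obtain s where s: "[:- l n, 1:] ^ k n dvd s * R - 1"
    using inverse_mod_linear_power by blast
  have "[:- l m, 1:] ^ k m dvd s * R" if "m < N" "m \<noteq> n" for m
    unfolding R_def using that dvd_prodI[of "{..<N} - {n}" m Q] by (simp add: Q_def)
  with s show ?thesis
    by (rule that)
qed

section \<open>A cyclic vector from generalized eigenfunctions\<close>

definition invariant_fun_space :: "('a \<Rightarrow> 'a) \<Rightarrow> ('a \<Rightarrow> complex) set \<Rightarrow> bool" where
  "invariant_fun_space \<phi> K \<longleftrightarrow> (\<forall>g\<in>K. \<forall>h\<in>K. (\<lambda>z. g z + h z) \<in> K) \<and>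
    (\<forall>c. \<forall>g\<in>K. (\<lambda>z. c * g z) \<in> K) \<and> (\<forall>g\<in>K. g \<circ> \<phi> \<in> K)"

lemma invariant_fun_spaceD:
  assumes "invariant_fun_space \<phi> K"
  shows "g \<in> K \<Longrightarrow> h \<in> K \<Longrightarrow> (\<lambda>z. g z + h z) \<in> K" "g \<in> K \<Longrightarrow> (\<lambda>z. c * g z) \<in> K"
    "g \<in> K \<Longrightarrow> g \<circ> \<phi> \<in> K"
  using assms by (simp_all add: invariant_fun_space_def)

text \<open>The condition is applied to the closure of the span of the orbit, which boundedness
  makes invariant. Quantifying over \<open>K\<close> keeps the later arguments algebraic:
  approximation enters only through the membership rule.\<close>

lemma fock_cyclicI:
  fixes \<phi> :: "complex^'n \<Rightarrow> complex^'n"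
  assumes bdd: "fock_bounded_op (comp_op \<phi>)" and f: "f \<in> fock_space"
    and K: "\<And>K. invariant_fun_space \<phi> K \<Longrightarrow>
      (\<And>g. g \<in> fock_space \<Longrightarrow> (\<And>\<epsilon>. \<epsilon> > 0 \<Longrightarrow> \<exists>q. fock_norm (\<lambda>z. g z - op_poly \<phi> q f z) < \<epsilon>) \<Longrightarrow> g \<in> K) \<Longrightarrow>
      polyfuns \<subseteq> K"
  shows "fock_cyclic (comp_op \<phi>)"
proof -
  define Cl where "Cl = {g \<in> fock_space. \<forall>\<epsilon>>0. \<exists>q. fock_norm (\<lambda>z. g z - op_poly \<phi> q f z) < \<epsilon>}"
  have opf: "op_poly \<phi> q f \<in> fock_space" for q
    using op_poly_fock[OF bdd, of q] f by blast
  have ClI: "g \<in> Cl" if "g \<in> fock_space" "\<And>\<epsilon>. \<epsilon> > 0 \<Longrightarrow> \<exists>q. fock_norm (\<lambda>z. g z - op_poly \<phi> q f z) < \<epsilon>" for g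
    using that by (auto simp: Cl_def)
  have ClD: "g \<in> fock_space" if "g \<in> Cl" for g
    using that by (auto simp: Cl_def)
  have ClE: "\<exists>q. fock_norm (\<lambda>z. g z - op_poly \<phi> q f z) < \<epsilon>" if "g \<in> Cl" "\<epsilon> > 0" for g \<epsilon>
    using that by (auto simp: Cl_def)
  have "invariant_fun_space \<phi> Cl"
    unfolding invariant_fun_space_def
  proof (intro conjI ballI allI)
    fix g h assume g: "g \<in> Cl" and h: "h \<in> Cl"
    show "(\<lambda>z. g z + h z) \<in> Cl"
    proof (rule ClI)
      show "(\<lambda>z. g z + h z) \<in> fock_space"
        using g h by (intro fock_space_add ClD)
      fix \<epsilon> :: real assume "\<epsilon> > 0"
      then obtain q r where q: "fock_norm (\<lambda>z. g z - op_poly \<phi> q f z) < \<epsilon> / 2"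
        and r: "fock_norm (\<lambda>z. h z - op_poly \<phi> r f z) < \<epsilon> / 2"
        using ClE[OF g, of "\<epsilon> / 2"] ClE[OF h, of "\<epsilon> / 2"] by auto
      have "(\<lambda>z. g z + h z - op_poly \<phi> (q + r) f z)
          = (\<lambda>z. (g z - op_poly \<phi> q f z) + (h z - op_poly \<phi> r f z))"
        by (simp add: op_poly_add fun_eq_iff)
      then have "fock_norm (\<lambda>z. g z + h z - op_poly \<phi> (q + r) f z)
          \<le> fock_norm (\<lambda>z. g z - op_poly \<phi> q f z) + fock_norm (\<lambda>z. h z - op_poly \<phi> r f z)"
        using fock_norm_triangle[OF fock_space_diff[OF ClD[OF g] opf] fock_space_diff[OF ClD[OF h] opf]] by simp
      with q r show "\<exists>q. fock_norm (\<lambda>z. g z + h z - op_poly \<phi> q f z) < \<epsilon>"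
        by (intro exI[of _ "q + r"]) linarith
    qed
  next
    fix c g assume g: "g \<in> Cl"
    show "(\<lambda>z. c * g z) \<in> Cl"
    proof (rule ClI)
      show "(\<lambda>z. c * g z) \<in> fock_space"
        using g by (intro fock_space_cmult ClD)
      fix \<epsilon> :: real assume \<epsilon>: "\<epsilon> > 0"
      then obtain q where q: "fock_norm (\<lambda>z. g z - op_poly \<phi> q f z) < \<epsilon> / (cmod c + 1)"
        using ClE[OF g, of "\<epsilon> / (cmod c + 1)"] by (auto simp: add_nonneg_pos)
      have "(\<lambda>z. c * g z - op_poly \<phi> (smult c q) f z) = (\<lambda>z. c * (g z - op_poly \<phi> q f z))"
        by (simp add: op_poly_smult fun_eq_iff right_diff_distrib)
      then have "fock_norm (\<lambda>z. c * g z - op_poly \<phi> (smult c q) f z) = cmod c * fock_norm (\<lambda>z. g z - op_poly \<phi> q f z)"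
        by (simp only: fock_norm_cmult)
      also have "\<dots> \<le> (cmod c + 1) * fock_norm (\<lambda>z. g z - op_poly \<phi> q f z)"
        by (intro mult_right_mono) auto
      also have "\<dots> < (cmod c + 1) * (\<epsilon> / (cmod c + 1))"
        using q by (intro mult_strict_left_mono) (auto simp: add_nonneg_pos)
      also have "\<dots> = \<epsilon>"
        by (simp add: add_nonneg_pos less_imp_neq[symmetric])
      finally show "\<exists>q. fock_norm (\<lambda>z. c * g z - op_poly \<phi> q f z) < \<epsilon>"
        by blast
    qed
  next
    fix g assume g: "g \<in> Cl"
    obtain M where T: "\<And>f. f \<in> fock_space \<Longrightarrow> comp_op \<phi> f \<in> fock_space"
      and M: "\<And>f. f \<in> fock_space \<Longrightarrow> fock_norm (comp_op \<phi> f) \<le> M * fock_norm f"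
      using bdd by (auto simp: fock_bounded_op_def)
    show "g \<circ> \<phi> \<in> Cl"
    proof (rule ClI)
      show "g \<circ> \<phi> \<in> fock_space"
        using T[OF ClD[OF g]] by (simp add: comp_op_def)
      fix \<epsilon> :: real assume \<epsilon>: "\<epsilon> > 0"
      then obtain q where q: "fock_norm (\<lambda>z. g z - op_poly \<phi> q f z) < \<epsilon> / (\<bar>M\<bar> + 1)"
        using ClE[OF g, of "\<epsilon> / (\<bar>M\<bar> + 1)"] by (auto simp: add_nonneg_pos)
      have "(\<lambda>z. (g \<circ> \<phi>) z - op_poly \<phi> (pCons 0 q) f z) = comp_op \<phi> (\<lambda>z. g z - op_poly \<phi> q f z)"
        by (simp add: op_poly_pCons fun_eq_iff comp_op_def)
      then have "fock_norm (\<lambda>z. (g \<circ> \<phi>) z - op_poly \<phi> (pCons 0 q) f z) \<le> M * fock_norm (\<lambda>z. g z - op_poly \<phi> q f z)"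
        using M[OF fock_space_diff[OF ClD[OF g] opf]] by (simp only:)
      also have "\<dots> \<le> (\<bar>M\<bar> + 1) * fock_norm (\<lambda>z. g z - op_poly \<phi> q f z)"
        by (intro mult_right_mono) auto
      also have "\<dots> < (\<bar>M\<bar> + 1) * (\<epsilon> / (\<bar>M\<bar> + 1))"
        using q by (intro mult_strict_left_mono) auto
      also have "\<dots> = \<epsilon>"
        by simp
      finally show "\<exists>q. fock_norm (\<lambda>z. (g \<circ> \<phi>) z - op_poly \<phi> q f z) < \<epsilon>"
        by blast
    qed
  qed
  then have "polyfuns \<subseteq> Cl"
    by (rule K) (rule ClI)
  have "\<exists>N::nat. \<exists>c. fock_norm (\<lambda>z. g z - (\<Sum>k<N. c k * (comp_op \<phi> ^^ k) f z)) < \<epsilon>"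
    if g: "g \<in> fock_space" and \<epsilon>: "\<epsilon> > 0" for g \<epsilon>
  proof -
    obtain h where h: "h \<in> polyfuns" "fock_norm (\<lambda>z. g z - h z) < \<epsilon> / 2"
      using polyfuns_dense[OF g, of "\<epsilon> / 2"] \<epsilon> by auto
    obtain q where q: "fock_norm (\<lambda>z. h z - op_poly \<phi> q f z) < \<epsilon> / 2"
      using ClE[of h "\<epsilon> / 2"] \<open>polyfuns \<subseteq> Cl\<close> h(1) \<epsilon> by auto
    have hF: "h \<in> fock_space"
      using h(1) by (rule polyfuns_fock)
    have "(\<lambda>z. g z - op_poly \<phi> q f z) = (\<lambda>z. (g z - h z) + (h z - op_poly \<phi> q f z))"
      by simp
    then have "fock_norm (\<lambda>z. g z - op_poly \<phi> q f z) \<le> fock_norm (\<lambda>z. g z - h z) + fock_norm (\<lambda>z. h z - op_poly \<phi> q f z)"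
      using fock_norm_triangle[OF fock_space_diff[OF g hF] fock_space_diff[OF hF opf]] by (simp only:)
    with h(2) q have "fock_norm (\<lambda>z. g z - op_poly \<phi> q f z) < \<epsilon>"
      by linarith
    then have "fock_norm (\<lambda>z. g z - (\<Sum>k<Suc (degree q). coeff q k * (comp_op \<phi> ^^ k) f z)) < \<epsilon>"
      by (simp only: op_poly_eq_funpow lessThan_Suc_atMost)
    then show ?thesis by blast
  qed
  with f show ?thesis
    unfolding fock_cyclic_def by blast
qed

text \<open>The cyclic vector is \<open>\<Sum> c\<^sub>n v\<^sub>n\<close>, where \<open>c\<^sub>n\<close> decays fast compared with the norms of the operators \<open>p(T)\<close>
  that isolate \<open>v\<^sub>n\<close> among \<open>v\<^sub>0, \<dots>, v\<^sub>N\<close>.\<close>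
lemma fock_cyclic_generalized_eigenfunctions:
  fixes \<phi> :: "complex^'n \<Rightarrow> complex^'n" and v :: "nat \<Rightarrow> complex^'n \<Rightarrow> complex"
  assumes bdd: "fock_bounded_op (comp_op \<phi>)"
    and v: "\<And>n. v n \<in> polyfuns"
    and annih: "\<And>n z. op_poly \<phi> ([:- l n, 1:] ^ k n) (v n) z = 0" and "inj l"
    and gen: "\<And>K. (\<And>n. v n \<in> K) \<Longrightarrow> invariant_fun_space \<phi> K \<Longrightarrow> polyfuns \<subseteq> K"
  shows "fock_cyclic (comp_op \<phi>)"
proof -
  define E where "E = (\<lambda>z::complex^'n. exp ((norm z)\<^sup>2 / 8))"
  have E_mono: "E z \<le> exp (R\<^sup>2 / 8)" if "norm z \<le> R" for z R
    unfolding E_def using power_mono[OF that, of 2] by simp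
  have E_pos: "E z > 0" for z
    by (simp add: E_def)
  have "\<exists>K. K \<ge> 0 \<and> (\<forall>z. cmod (v m z) \<le> K * E z)" for m
    using polyfuns_growth'[OF v[of m]] unfolding E_def by metis
  then obtain D where D: "\<And>m. D m \<ge> 0" "\<And>m z. cmod (v m z) \<le> D m * E z"
    by metis
  have "\<exists>p. [:- l n, 1:] ^ k n dvd p - 1 \<and> (\<forall>m<N. m \<noteq> n \<longrightarrow> [:- l m, 1:] ^ k m dvd p)" for n N
    using separating_poly[OF \<open>inj l\<close>, of n k N] by metis
  then obtain p where p: "\<And>n N. [:- l n, 1:] ^ k n dvd p n N - 1"
    "\<And>n N m. m < N \<Longrightarrow> m \<noteq> n \<Longrightarrow> [:- l m, 1:] ^ k m dvd p n N"
    by metis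
  have "\<exists>M\<ge>0. \<forall>f\<in>fock_space. op_poly \<phi> (p n N) f \<in> fock_space \<and>
      fock_norm (op_poly \<phi> (p n N) f) \<le> M * fock_norm f" for n N
    using op_poly_fock[OF bdd, of "p n N"] by metis
  then obtain M where M: "\<And>n N. M n N \<ge> 0"
    "\<And>n N f. f \<in> fock_space \<Longrightarrow> op_poly \<phi> (p n N) f \<in> fock_space"
    "\<And>n N f. f \<in> fock_space \<Longrightarrow> fock_norm (op_poly \<phi> (p n N) f) \<le> M n N * fock_norm f"
    by metis
  \<comment> \<open>\<open>B m\<close> dominates \<open>M n N\<close> for all \<open>n\<close> and
    \<open>N\<close> up to \<open>m\<close>, so one coefficient for the \<open>m\<close>-th term
    suits every isolating operator that has this term in its tail.\<close>
  define B where "B = (\<lambda>m. 1 + (\<Sum>N\<le>m. \<Sum>n\<le>m. M n N))"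
  have B_ge: "B m \<ge> 1 + M n N" if "n \<le> m" "N \<le> m" for n N m
  proof -
    have "M n N \<le> (\<Sum>n\<le>m. M n N)"
      using that M(1) by (intro member_le_sum) auto
    also have "\<dots> \<le> (\<Sum>N\<le>m. \<Sum>n\<le>m. M n N)"
      using that M(1) by (intro member_le_sum[where f = "\<lambda>N. \<Sum>n\<le>m. M n N"] sum_nonneg) auto
    finally show ?thesis by (simp add: B_def)
  qed
  have B1: "B m \<ge> 1" for m
    using B_ge[of m m m] M(1)[of m m] by simp
  \<comment> \<open>Powers of \<open>1/2\<close> give convergence, \<open>1 + D m\<close> absorbs
    the growth of \<open>v m\<close>, and \<open>B m\<close> the norms of the isolating
    operators.\<close>
  define c where "c = (\<lambda>m. (1/2) ^ m / ((1 + D m) * B m))"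
  have c_pos: "c m > 0" for m
    using D(1)[of m] B1[of m] by (auto simp: c_def intro!: divide_pos_pos mult_pos_pos)
  define summand where "summand = (\<lambda>m z. complex_of_real (c m) * v m z)"
  have summand_poly: "summand m \<in> polyfuns" for m
    unfolding summand_def by (intro polyfuns.cmult v)
  have summand_le: "cmod (summand m z) \<le> (1/2) ^ m / B m * E z" for m z
  proof -
    have "cmod (summand m z) \<le> c m * (D m * E z)"
      unfolding summand_def norm_mult using D(2)[of m z] c_pos[of m] by (simp add: mult_left_mono)
    also have "\<dots> \<le> c m * ((1 + D m) * E z)"
      using c_pos[of m] E_pos[of z] by (intro mult_left_mono mult_right_mono) auto
    also have "\<dots> = (c m * (1 + D m)) * E z"
      by simp
    also have "c m * (1 + D m) = (1/2) ^ m / B m"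
    proof -
      have "1 + D m \<noteq> 0"
        using D(1)[of m] by linarith
      then show ?thesis by (simp add: c_def)
    qed
    finally show ?thesis .
  qed
  have summand_le1: "cmod (summand m z) \<le> (1/2) ^ m * E z" for m z
  proof -
    have "(1/2) ^ m / B m * E z \<le> (1/2) ^ m / 1 * E z"
      using B1[of m] E_pos[of z] by (intro mult_right_mono divide_left_mono) auto
    with summand_le[of m z] show ?thesis by simp
  qed
  have geo: "summable (\<lambda>m. (1/2::real) ^ m)"
    by (rule summable_geometric) simp
  have summable_summand: "summable (\<lambda>m. summand m z)" for z
    by (rule summable_comparison_test'[OF summable_mult2[OF geo, of "E z"]]) (use summand_le1 in auto)
  define x where "x = (\<lambda>z. \<Sum>m. summand m z)"
  have x_entire: "entire_fun x"
    unfolding x_def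
  proof (rule entire_fun_series)
    show "entire_fun (summand m)" for m
      by (rule polyfuns_entire[OF summand_poly])
    fix R :: real
    have "cmod (summand m z) \<le> (1/2) ^ m * exp (R\<^sup>2 / 8)" if "norm z \<le> R" for m z
      by (rule order_trans[OF summand_le1 mult_left_mono[OF E_mono[OF that]]]) simp
    then show "\<exists>B. summable B \<and> (\<forall>m z. norm z \<le> R \<longrightarrow> cmod (summand m z) \<le> B m)"
      using summable_mult2[OF geo, of "exp (R\<^sup>2 / 8)"] by blast
  qed
  define r where "r = (\<lambda>N z. x z - (\<Sum>m<N. summand m z))"
  have r_entire: "entire_fun (r N)" for N
    unfolding r_def by (intro entire_fun_diff x_entire entire_fun_sum polyfuns_entire[OF summand_poly])
  \<comment> \<open>All indices of the tail are at least \<open>N\<close>, so \<open>B\<close> is at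
    least \<open>1 + M n N\<close> there; the factor 2 is the geometric sum.\<close>
  have r_le: "cmod (r N z) \<le> (2 * (1/2) ^ N / (1 + M n N)) * E z" if "n \<le> N" for n N z
  proof -
    have "r N z = (\<Sum>m. summand (m + N) z)"
      unfolding r_def x_def using suminf_split_initial_segment[OF summable_summand, of z N] by simp
    also have "cmod \<dots> \<le> (\<Sum>m. (1/2) ^ m * ((1/2) ^ N / (1 + M n N) * E z))"
    proof (rule norm_suminf_le)
      show "summable (\<lambda>m. (1/2) ^ m * ((1/2) ^ N / (1 + M n N) * E z))"
        by (rule summable_mult2[OF geo])
      show "cmod (summand (m + N) z) \<le> (1/2) ^ m * ((1/2) ^ N / (1 + M n N) * E z)" for m
      proof -
        have "(1/2) ^ (m + N) / B (m + N) * E z \<le> (1/2) ^ (m + N) / (1 + M n N) * E z"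
          using B_ge[of n "m + N" N] that M(1)[of n N] E_pos[of z] B1[of "m + N"]
          by (intro mult_right_mono divide_left_mono) (auto simp: add_pos_nonneg)
        with summand_le[of "m + N" z] show ?thesis
          by (simp add: power_add mult.assoc)
      qed
    qed
    also have "\<dots> = 2 * ((1/2) ^ N / (1 + M n N) * E z)"
      using suminf_mult2[OF geo, of "(1/2) ^ N / (1 + M n N) * E z"] suminf_geometric[of "1/2::real"] by simp
    finally show ?thesis by simp
  qed
  obtain G where G: "G \<ge> 0" "\<And>(f::complex^'n \<Rightarrow> complex) K. entire_fun f \<Longrightarrow>
    (\<And>z. cmod (f z) \<le> K * exp ((norm z)\<^sup>2 / 8)) \<Longrightarrow> f \<in> fock_space \<and> fock_norm f \<le> K * G"
    using fock_space_dominated by metis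
  have r_fock: "r N \<in> fock_space" "fock_norm (r N) \<le> 2 * (1/2) ^ N / (1 + M n N) * G" if "n \<le> N" for n N
    using G(2)[OF r_entire r_le[OF that, unfolded E_def]] by auto
  have x: "x \<in> fock_space"
    using r_fock(1)[of 0 0] by (simp add: r_def)
  \<comment> \<open>\<open>p n N\<close> reproduces the \<open>n\<close>-th term and kills the other
    terms below \<open>N\<close>, so the error is the image of the tail \<open>r N\<close>. The
    quotient \<open>M n N / (1 + M n N)\<close>, at most 1, neutralises the operator norm.\<close>
  have approx: "fock_norm (\<lambda>z. summand n z - op_poly \<phi> (p n N) x z) \<le> 2 * G * (1/2) ^ N" if "n < N" for n N
  proof -
    have zero: "op_poly \<phi> q (v m) z = 0" if "[:- l m, 1:] ^ k m dvd q" for q m z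
    proof -
      obtain s where s: "q = s * [:- l m, 1:] ^ k m"
        using \<open>[:- l m, 1:] ^ k m dvd q\<close> by (metis dvd_div_mult_self)
      have "op_poly \<phi> ([:- l m, 1:] ^ k m) (v m) = (\<lambda>z. 0)"
        using annih by (intro ext)
      then show ?thesis
        unfolding s op_poly_mult by (simp add: op_poly_def)
    qed
    have vm: "op_poly \<phi> (p n N) (v m) z = (if m = n then v n z else 0)" if "m < N" for m z
    proof (cases "m = n")
      case True
      have "op_poly \<phi> ((p n N - 1) + 1) (v n) z = op_poly \<phi> (p n N - 1) (v n) z + op_poly \<phi> 1 (v n) z"
        by (rule op_poly_add)
      then show ?thesis
        using zero[OF p(1)] True by simp
    qed (use zero[OF p(2)[OF that]] in simp)
    have "op_poly \<phi> (p n N) x z = summand n z + op_poly \<phi> (p n N) (r N) z" for z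
    proof -
      have "x = (\<lambda>z. (\<Sum>m<N. complex_of_real (c m) * v m z) + r N z)"
        by (simp add: r_def summand_def)
      then have "op_poly \<phi> (p n N) x z
          = (\<Sum>m<N. complex_of_real (c m) * op_poly \<phi> (p n N) (v m) z) + op_poly \<phi> (p n N) (r N) z"
        by (metis op_poly_fun_add op_poly_fun_sum)
      also have "(\<Sum>m<N. complex_of_real (c m) * op_poly \<phi> (p n N) (v m) z)
          = (\<Sum>m<N. if m = n then summand n z else 0)"
        by (rule sum.cong) (auto simp: vm summand_def)
      finally show ?thesis
        using \<open>n < N\<close> by simp
    qed
    then have "(\<lambda>z. summand n z - op_poly \<phi> (p n N) x z) = (\<lambda>z. (- 1) * op_poly \<phi> (p n N) (r N) z)"
      by (simp add: fun_eq_iff)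
    then have "fock_norm (\<lambda>z. summand n z - op_poly \<phi> (p n N) x z) = fock_norm (op_poly \<phi> (p n N) (r N))"
      using fock_norm_cmult[of "-1" "op_poly \<phi> (p n N) (r N)"] by (simp only: norm_minus_cancel norm_one mult_1)
    also have "\<dots> \<le> M n N * fock_norm (r N)"
      using \<open>n < N\<close> by (intro M(3) r_fock(1)[of n]) auto
    also have "\<dots> \<le> M n N * (2 * (1/2) ^ N / (1 + M n N) * G)"
      using \<open>n < N\<close> M(1) by (intro mult_left_mono r_fock(2)) auto
    also have "\<dots> = M n N / (1 + M n N) * (2 * G * (1/2) ^ N)"
      by simp
    also have "\<dots> \<le> 1 * (2 * G * (1/2) ^ N)"
      using M(1)[of n N] G(1) by (intro mult_right_mono) auto
    finally show ?thesis by simp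
  qed
  show ?thesis
  proof (rule fock_cyclicI[OF bdd x])
    fix K :: "(complex^'n \<Rightarrow> complex) set"
    assume inv: "invariant_fun_space \<phi> K"
      and closed: "\<And>g. g \<in> fock_space \<Longrightarrow>
        (\<And>\<epsilon>. \<epsilon> > 0 \<Longrightarrow> \<exists>q. fock_norm (\<lambda>z. g z - op_poly \<phi> q x z) < \<epsilon>) \<Longrightarrow> g \<in> K"
    have "v n \<in> K" for n
    proof -
      have "summand n \<in> K"
      proof (rule closed)
        show "summand n \<in> fock_space"
          by (rule polyfuns_fock[OF summand_poly])
        fix \<epsilon> :: real assume "\<epsilon> > 0"
        have "(\<lambda>N. 2 * G * (1/2) ^ N) \<longlonglongrightarrow> 2 * G * 0"
          by (intro tendsto_intros LIMSEQ_power_zero) simp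
        then have "eventually (\<lambda>N. 2 * G * (1/2) ^ N < \<epsilon>) sequentially"
          using \<open>\<epsilon> > 0\<close> by (intro order_tendstoD(2)) auto
        then have "eventually (\<lambda>N. 2 * G * (1/2) ^ N < \<epsilon> \<and> n < N) sequentially"
          using eventually_gt_at_top eventually_conj by blast
        then obtain N where "2 * G * (1/2) ^ N < \<epsilon>" "n < N"
          by (auto simp: eventually_sequentially)
        with approx[of n N] show "\<exists>q. fock_norm (\<lambda>z. summand n z - op_poly \<phi> q x z) < \<epsilon>"
          by (intro exI[of _ "p n N"]) linarith
      qed
      then have "(\<lambda>z. complex_of_real (inverse (c n)) * summand n z) \<in> K"
        by (rule invariant_fun_spaceD[OF inv])
      moreover have "complex_of_real (inverse (c n)) * summand n z = v n z" for z
        using c_pos[of n] by (simp add: summand_def)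
      ultimately show ?thesis by simp
    qed
    then show "polyfuns \<subseteq> K"
      using inv by (rule gen)
  qed
qed

section \<open>Cyclicity in normal coordinates\<close>

text \<open>Dividing the two products would give a resonance with exponent
  \<open>\<alpha> - \<beta>\<close>.\<close>

lemma nonresonant_exponents_unique:
  fixes \<mu> :: "'n::finite \<Rightarrow> complex"
  assumes nr: "nonresonant \<mu> S" and nz: "\<And>j. \<mu> j \<noteq> 0"
    and supp: "\<And>j. j \<notin> S \<Longrightarrow> \<alpha> j = 0" "\<And>j. j \<notin> S \<Longrightarrow> \<beta> j = (0::nat)"
    and eq: "(\<Prod>j\<in>UNIV. \<mu> j ^ \<alpha> j) = (\<Prod>j\<in>UNIV. \<mu> j ^ \<beta> j)"
  shows "\<alpha> = \<beta>"
proof (rule ccontr)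
  assume "\<alpha> \<noteq> \<beta>"
  define \<gamma> where "\<gamma> = (\<lambda>j. int (\<alpha> j) - int (\<beta> j))"
  have UNIV_S: "(\<Prod>j\<in>UNIV. \<mu> j ^ \<delta> j) = (\<Prod>j\<in>S. \<mu> j ^ \<delta> j)" if "\<And>j. j \<notin> S \<Longrightarrow> \<delta> j = (0::nat)" for \<delta>
    by (rule prod.mono_neutral_right) (use that in auto)
  have "(\<Prod>j\<in>S. \<mu> j powi \<gamma> j) = (\<Prod>j\<in>S. \<mu> j ^ \<alpha> j / \<mu> j ^ \<beta> j)"
    by (rule prod.cong) (auto simp: \<gamma>_def nz power_int_diff)
  also have "\<dots> = 1"
    using eq UNIV_S[OF supp(1)] UNIV_S[OF supp(2)] by (simp add: prod_dividef nz)
  finally have one: "(\<Prod>j\<in>S. \<mu> j powi \<gamma> j) = 1" .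
  obtain j where "\<alpha> j \<noteq> \<beta> j"
    using \<open>\<alpha> \<noteq> \<beta>\<close> by blast
  moreover from this have "j \<in> S"
    using supp by metis
  ultimately have "\<exists>j\<in>S. \<gamma> j \<noteq> 0"
    by (intro bexI[of _ j]) (auto simp: \<gamma>_def)
  moreover have "\<forall>j. j \<notin> S \<longrightarrow> \<gamma> j = 0"
    by (simp add: \<gamma>_def supp)
  ultimately show False
    using nr one unfolding nonresonant_def by blast
qed

inductive_set fun_span :: "('a \<Rightarrow> complex) set \<Rightarrow> ('a \<Rightarrow> complex) set" for B where
  base: "f \<in> B \<Longrightarrow> f \<in> fun_span B"
| add: "f \<in> fun_span B \<Longrightarrow> g \<in> fun_span B \<Longrightarrow> (\<lambda>z. f z + g z) \<in> fun_span B"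
| cmult: "f \<in> fun_span B \<Longrightarrow> (\<lambda>z. c * f z) \<in> fun_span B"

text \<open>An empty sum is 0, whereas \<open>fun_span {}\<close> is empty; hence the index set has
  to be nonempty.\<close>

lemma fun_span_sum:
  assumes "finite I" "I \<noteq> {}" "\<And>i. i \<in> I \<Longrightarrow> f i \<in> fun_span B"
  shows "(\<lambda>z. \<Sum>i\<in>I. f i z) \<in> fun_span B"
  using assms by (induction I rule: finite_ne_induct) (auto intro: fun_span.add)

lemma fun_span_mult:
  assumes "f \<in> fun_span B" "\<And>g. g \<in> B \<Longrightarrow> (\<lambda>z. w z * g z) \<in> fun_span B"
  shows "(\<lambda>z. w z * f z) \<in> fun_span B"
  using assms(1)
proof (induction rule: fun_span.induct)
  case (add f g)
  then show ?case
    using fun_span.add[OF add.IH] by (simp add: distrib_left)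
next
  case (cmult f c)
  then show ?case
    using fun_span.cmult[OF cmult.IH, of c] by (simp add: mult.left_commute)
qed (use assms(2) in auto)

text \<open>As \<open>z = p + P *v (Q *v (z - p))\<close>, the original coordinates are affine
  combinations of the new ones, so stability under the latter gives stability under the generators
  of the polynomials.\<close>

lemma polyfuns_subset_fun_span:
  fixes P Q :: "complex^'n^'n"
  assumes PQ: "P ** Q = mat 1" and one: "(\<lambda>z. 1) \<in> fun_span B"
    and mult: "\<And>j g. g \<in> B \<Longrightarrow> (\<lambda>z. lform (Q $ j) (z - p) * g z) \<in> fun_span B"
  shows "polyfuns \<subseteq> fun_span B"
proof
  fix f :: "complex^'n \<Rightarrow> complex" assume "f \<in> polyfuns"
  then show "f \<in> fun_span B"
  proof (induction rule: polyfuns.induct)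
    case (coord f j)
    have coordinate: "z $ j = p $ j + (\<Sum>i\<in>UNIV. P $ j $ i * lform (Q $ i) (z - p))" for z
    proof -
      have "P *v (Q *v (z - p)) = z - p"
        by (simp add: matrix_vector_mul_assoc PQ)
      then have "(P *v (Q *v (z - p))) $ j = z $ j - p $ j"
        by simp
      moreover have "(Q *v y) $ i = lform (Q $ i) y" for i y
        by (simp add: matrix_vector_mult_def lform_def)
      ultimately show ?thesis
        by (simp add: matrix_vector_mult_def[of P])
    qed
    have summand: "(\<lambda>z. P $ j $ i * (lform (Q $ i) (z - p) * f z)) \<in> fun_span B" for i
      by (rule fun_span.cmult, rule fun_span_mult[OF coord.IH mult])
    have "(\<lambda>z. \<Sum>i\<in>UNIV. P $ j $ i * (lform (Q $ i) (z - p) * f z)) \<in> fun_span B"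
      by (rule fun_span_sum[where I = UNIV]) (simp_all add: summand)
    from fun_span.add[OF fun_span.cmult[OF coord.IH, of "p $ j"] this]
    have "(\<lambda>z. p $ j * f z + (\<Sum>i\<in>UNIV. P $ j $ i * (lform (Q $ i) (z - p) * f z))) \<in> fun_span B" .
    moreover have "z $ j * f z = p $ j * f z + (\<Sum>i\<in>UNIV. P $ j $ i * (lform (Q $ i) (z - p) * f z))" for z
    proof -
      have "z $ j * f z = (p $ j + (\<Sum>i\<in>UNIV. P $ j $ i * lform (Q $ i) (z - p))) * f z"
        by (rule arg_cong[where f = "\<lambda>t. t * f z", OF coordinate])
      then show ?thesis
        by (simp only: distrib_right sum_distrib_right mult.assoc)
    qed
    ultimately show ?case
      by (simp only:)
  qed (auto intro: one fun_span.add fun_span.cmult)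
qed

lemma fun_span_subset:
  assumes "B \<subseteq> K" "invariant_fun_space \<phi> K"
  shows "fun_span B \<subseteq> K"
proof
  fix f assume "f \<in> fun_span B"
  then show "f \<in> K"
    by (induction rule: fun_span.induct) (use assms invariant_fun_spaceD in auto)
qed

text \<open>Transport along an enumeration of the infinite countable set \<open>I\<close> of
  multi-indices.\<close>

lemma fock_cyclic_indexed:
  fixes \<phi> :: "complex^'n \<Rightarrow> complex^'n" and v :: "('n \<Rightarrow> nat) \<Rightarrow> complex^'n \<Rightarrow> complex"
  assumes bdd: "fock_bounded_op (comp_op \<phi>)" and "infinite I"
    and v: "\<And>\<alpha>. v \<alpha> \<in> polyfuns"
    and annih: "\<And>\<alpha> z. \<alpha> \<in> I \<Longrightarrow> op_poly \<phi> ([:- l \<alpha>, 1:] ^ k \<alpha>) (v \<alpha>) z = 0" and "inj_on l I"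
    and gen: "\<And>K. (\<And>\<alpha>. \<alpha> \<in> I \<Longrightarrow> v \<alpha> \<in> K) \<Longrightarrow> invariant_fun_space \<phi> K \<Longrightarrow> polyfuns \<subseteq> K"
  shows "fock_cyclic (comp_op \<phi>)"
proof -
  define n where "n = from_nat_into I"
  have n: "bij_betw n UNIV I"
    unfolding n_def using \<open>infinite I\<close> by (intro bij_betw_from_nat_into) auto
  then have nI: "n i \<in> I" for i
    by (auto simp: bij_betw_def)
  have nsurj: "\<exists>i. \<alpha> = n i" if "\<alpha> \<in> I" for \<alpha>
    using n that by (auto simp: bij_betw_def)
  show ?thesis
  proof (rule fock_cyclic_generalized_eigenfunctions[OF bdd, of "\<lambda>i. v (n i)" "\<lambda>i. l (n i)" "\<lambda>i. k (n i)"])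
    show "inj (\<lambda>i. l (n i))"
      using n \<open>inj_on l I\<close> comp_inj_on[of n UNIV l] by (auto simp: bij_betw_def o_def)
    fix K :: "(complex^'n \<Rightarrow> complex) set"
    assume vK: "\<And>i. v (n i) \<in> K"
      and K: "invariant_fun_space \<phi> K"
    have "v \<alpha> \<in> K" if "\<alpha> \<in> I" for \<alpha>
      using nsurj[OF that] vK by auto
    then show "polyfuns \<subseteq> K"
      using K by (rule gen)
  qed (auto simp: v annih nI)
qed

lemma infinite_multiindices:
  assumes "i \<notin> S"
  shows "infinite {\<alpha>::'n::finite \<Rightarrow> nat. \<forall>j\<in>S. \<alpha> j = 0}"
proof -
  have "inj (\<lambda>m. (\<lambda>j. 0)(i := m :: nat))"
    by (rule injI) (metis fun_upd_same)
  then have "infinite (range (\<lambda>m. (\<lambda>j. 0)(i := m :: nat)))"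
    by (simp add: finite_image_iff)
  then show ?thesis
    by (rule infinite_super[rotated]) (use assms in auto)
qed

locale normal_coordinates =
  fixes A :: "complex^'n^'n" and b p :: "complex^'n" and P Q J :: "complex^'n^'n"
  assumes bounded: "fock_bounded_op (comp_op (affine_map A b))"
    and fixed_point: "affine_map A b p = p"
    and conj: "A ** P = P ** J" and PQ: "P ** Q = mat 1" and QP: "Q ** P = mat 1"
begin

definition w :: "'n \<Rightarrow> complex^'n \<Rightarrow> complex" where
  "w j z = lform (Q $ j) (z - p)"

text \<open>The relation \<open>A ** P = P ** J\<close> becomes \<open>Q ** A = J ** Q\<close>; in
  coordinates centred at the fixed point the affine map is the linear map \<open>J\<close>.\<close>

lemma w_affine_map: "w j (affine_map A b z) = (\<Sum>i\<in>UNIV. J $ j $ i * w i z)"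
proof -
  have QA: "Q ** A = J ** Q"
  proof -
    have "Q ** A = Q ** (A ** (P ** Q))"
      by (simp add: PQ)
    also have "\<dots> = Q ** (A ** P) ** Q"
      by (simp add: matrix_mul_assoc)
    also have "\<dots> = (Q ** P) ** J ** Q"
      by (simp add: conj matrix_mul_assoc)
    finally show ?thesis by (simp add: QP)
  qed
  have row: "lform (M $ i) y = (M *v y) $ i" for M :: "complex^'n^'n" and i y
    by (simp add: matrix_vector_mult_def lform_def)
  have "affine_map A b z - p = A *v (z - p)"
    using fixed_point by (simp add: affine_map_def vec.diff algebra_simps)
  then have "w j (affine_map A b z) = (Q *v (A *v (z - p))) $ j"
    by (simp add: w_def row)
  also have "\<dots> = (J *v (Q *v (z - p))) $ j"
    by (simp add: matrix_vector_mul_assoc QA)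
  also have "\<dots> = (\<Sum>i\<in>UNIV. J $ j $ i * w i z)"
    unfolding w_def row by (simp add: matrix_vector_mult_def[of J])
  finally show ?thesis .
qed

lemma polyfuns_w: "w j \<in> polyfuns"
  unfolding w_def by (rule polyfuns_lform_diff)

lemma polyfuns_subset_fun_span_w:
  assumes "(\<lambda>z. 1) \<in> fun_span B" "\<And>j g. g \<in> B \<Longrightarrow> (\<lambda>z. w j z * g z) \<in> fun_span B"
  shows "polyfuns \<subseteq> fun_span B"
  using polyfuns_subset_fun_span[OF PQ assms(1), of p] assms(2) unfolding w_def by blast

end

lemma prod_power_fun_upd:
  fixes f :: "'n::finite \<Rightarrow> 'a::comm_monoid_mult"
  assumes "i \<in> S"
  shows "(\<Prod>j\<in>S. f j ^ (\<alpha>(i := Suc (\<alpha> i))) j) = f i * (\<Prod>j\<in>S. f j ^ \<alpha> j)"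
proof -
  have "(\<Prod>j\<in>S. f j ^ (\<alpha>(i := Suc (\<alpha> i))) j) = (\<Prod>j\<in>S. (if j = i then f j else 1) * f j ^ \<alpha> j)"
    by (rule prod.cong) auto
  then show ?thesis
    using assms by (simp add: prod.distrib)
qed

context normal_coordinates
begin

text \<open>Monomials in the coordinates are eigenfunctions, and nonresonance makes their
  eigenvalues distinct; every generalized eigenspace is thus a line.\<close>

lemma fock_cyclic_diagonal:
  assumes J: "J = diag_mat \<mu>" and nz: "\<And>j. \<mu> j \<noteq> 0" and nr: "nonresonant \<mu> UNIV"
  shows "fock_cyclic (comp_op (affine_map A b))"
proof -
  define e where "e = (\<lambda>\<alpha> z. \<Prod>j\<in>UNIV. w j z ^ \<alpha> j)"
  define l where "l = (\<lambda>\<alpha>::'n \<Rightarrow> nat. \<Prod>j\<in>UNIV. \<mu> j ^ \<alpha> j)"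
  have wJ: "w j (affine_map A b z) = \<mu> j * w j z" for j z
  proof -
    have "(\<Sum>i\<in>UNIV. J $ j $ i * w i z) = (\<Sum>i\<in>UNIV. if i = j then \<mu> j * w j z else 0)"
      by (rule sum.cong) (auto simp: J diag_mat_def)
    then show ?thesis by (simp add: w_affine_map)
  qed
  have e_eig: "e \<alpha> (affine_map A b z) = l \<alpha> * e \<alpha> z" for \<alpha> z
    by (simp add: e_def l_def wJ power_mult_distrib prod.distrib)
  show ?thesis
  proof (rule fock_cyclic_indexed[OF bounded, of UNIV e l "\<lambda>_. 1"])
    show "infinite (UNIV :: ('n \<Rightarrow> nat) set)"
      using infinite_multiindices[of undefined "{}"] by simp
    show "e \<alpha> \<in> polyfuns" for \<alpha>
      unfolding e_def by (intro polyfuns_prod polyfuns_power polyfuns_w)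
    show "op_poly (affine_map A b) ([:- l \<alpha>, 1:] ^ 1) (e \<alpha>) z = 0" for \<alpha> z
      by (simp add: op_poly_pCons e_eig)
    show "inj l"
      using nonresonant_exponents_unique[OF nr nz] by (auto simp: l_def intro!: injI)
    fix K :: "(complex^'n \<Rightarrow> complex) set"
    assume K: "\<And>\<alpha>. \<alpha> \<in> UNIV \<Longrightarrow> e \<alpha> \<in> K" "invariant_fun_space (affine_map A b) K"
    have "polyfuns \<subseteq> fun_span (range e)"
    proof (rule polyfuns_subset_fun_span_w)
      have "e (\<lambda>j. 0) = (\<lambda>z. 1)"
        by (simp add: e_def)
      then show "(\<lambda>z. 1) \<in> fun_span (range e)"
        by (metis fun_span.base rangeI)
      fix j g assume "g \<in> range e"
      then obtain \<alpha> where "g = e \<alpha>"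
        by blast
      moreover have "e (\<alpha>(j := Suc (\<alpha> j))) z = w j z * e \<alpha> z" for z
        unfolding e_def by (rule prod_power_fun_upd) simp
      ultimately have "(\<lambda>z. w j z * g z) = e (\<alpha>(j := Suc (\<alpha> j)))"
        by (intro ext) simp
      then show "(\<lambda>z. w j z * g z) \<in> fun_span (range e)"
        by (auto intro: fun_span.base)
    qed
    also have "\<dots> \<subseteq> K"
      using K(1) by (intro fun_span_subset[OF _ K(2)]) auto
    finally show "polyfuns \<subseteq> K" .
  qed
qed

end

text \<open>With \<open>s = \<mu> x / y\<close> this is \<open>y ^ (a + b)\<close> times the binomial coefficient of \<open>s\<close> over \<open>a\<close>; a Jordan block
  acts on \<open>s\<close> as the shift \<open>s \<mapsto> s + 1\<close>, so it acts on these functions by Pascal's rule.\<close>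
definition binomial_form :: "complex \<Rightarrow> complex \<Rightarrow> complex \<Rightarrow> nat \<Rightarrow> nat \<Rightarrow> complex" where
  "binomial_form \<mu> x y a b = y ^ b * (\<Prod>i<a. \<mu> * x - of_nat i * y) / fact a"

lemma binomial_form_mult_right: "y * binomial_form \<mu> x y a b = binomial_form \<mu> x y a (Suc b)"
  by (simp add: binomial_form_def mult.assoc)

text \<open>The next factor of the falling product is \<open>\<mu> * x - of_nat a * y\<close>;
  solving for \<open>\<mu> * x\<close> shows that the span of these forms is stable under
  multiplication by it.\<close>

lemma binomial_form_mult_left:
  "\<mu> * x * binomial_form \<mu> x y a b
    = of_nat (Suc a) * binomial_form \<mu> x y (Suc a) b + of_nat a * binomial_form \<mu> x y a (Suc b)"
proof -
  have "of_nat (Suc a) * binomial_form \<mu> x y (Suc a) b = (\<mu> * x - of_nat a * y) * binomial_form \<mu> x y a b"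
    unfolding binomial_form_def prod.lessThan_Suc fact_Suc
    by (simp add: divide_simps del: of_nat_Suc)
  then show ?thesis
    by (simp add: left_diff_distrib mult.assoc binomial_form_mult_right[symmetric])
qed

lemma binomial_form_jordan_0:
  "binomial_form \<mu> (\<mu> * x + y) (\<mu> * y) 0 b = \<mu> ^ b * binomial_form \<mu> x y 0 b"
  by (simp add: binomial_form_def power_mult_distrib)

text \<open>The shifted falling product consists of the first \<open>a\<close> old factors and the
  new one \<open>\<mu> * x + y\<close>, which is the missing old factor
  \<open>\<mu> * x - of_nat a * y\<close> plus \<open>of_nat (Suc a) * y\<close>.\<close>

lemma binomial_form_jordan_Suc:
  "binomial_form \<mu> (\<mu> * x + y) (\<mu> * y) (Suc a) b
    = \<mu> ^ (Suc a + b) * (binomial_form \<mu> x y (Suc a) b + binomial_form \<mu> x y a (Suc b))"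
proof -
  define R where "R = (\<Prod>i<a. \<mu> * x - of_nat i * y)"
  have "(\<Prod>i<Suc a. \<mu> * (\<mu> * x + y) - of_nat i * (\<mu> * y)) = \<mu> * (\<mu> * x + y) * (\<Prod>i<a. \<mu> * (\<mu> * x - of_nat i * y))"
    unfolding prod.lessThan_Suc_shift by (simp add: algebra_simps)
  also have "\<dots> = \<mu> ^ Suc a * ((\<mu> * x + y) * R)"
    by (simp add: prod.distrib R_def)
  finally have 1: "binomial_form \<mu> (\<mu> * x + y) (\<mu> * y) (Suc a) b
      = \<mu> ^ (Suc a + b) * (y ^ b * ((\<mu> * x + y) * R) / fact (Suc a))"
    by (simp add: binomial_form_def power_mult_distrib power_add)
  have 2: "binomial_form \<mu> x y (Suc a) b = y ^ b * (R * (\<mu> * x - of_nat a * y)) / fact (Suc a)"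
    by (simp add: binomial_form_def R_def)
  have "binomial_form \<mu> x y a (Suc b) = of_nat (Suc a) * (y ^ Suc b * R) / (of_nat (Suc a) * fact a)"
    unfolding binomial_form_def R_def by (simp del: of_nat_Suc)
  then have 3: "binomial_form \<mu> x y a (Suc b) = y ^ b * (of_nat (Suc a) * y * R) / fact (Suc a)"
    by (simp add: mult_ac del: of_nat_Suc)
  have "y ^ b * ((\<mu> * x + y) * R) / fact (Suc a)
      = binomial_form \<mu> x y (Suc a) b + binomial_form \<mu> x y a (Suc b)"
    unfolding 2 3 add_divide_distrib[symmetric] by (simp add: algebra_simps)
  with 1 show ?thesis by (simp only:)
qed

context normal_coordinates
begin

text \<open>With \<open>\<alpha> i0 + \<alpha> i1\<close> and the other exponents fixed, the
  functions \<open>e \<alpha>\<close> form a single chain, generated by the one with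
  \<open>\<alpha> i1 = 0\<close>. Multi-indices vanishing at \<open>i1\<close> therefore label the
  chains, and nonresonance away from \<open>i1\<close> makes their eigenvalues distinct.\<close>

lemma fock_cyclic_jordan2:
  assumes J: "J = jordan2_mat \<mu> i0 i1" and i01: "i0 \<noteq> i1" and \<mu>01: "\<mu> i0 = \<mu> i1"
    and nz: "\<And>j. \<mu> j \<noteq> 0" and nr: "nonresonant \<mu> (UNIV - {i1})"
  shows "fock_cyclic (comp_op (affine_map A b))"
proof -
  define S where "S = UNIV - {i0, i1}"
  define e where "e = (\<lambda>\<alpha> z. binomial_form (\<mu> i0) (w i0 z) (w i1 z) (\<alpha> i0) (\<alpha> i1) * (\<Prod>j\<in>S. w j z ^ \<alpha> j))"
  define l where "l = (\<lambda>\<alpha>::'n \<Rightarrow> nat. \<mu> i0 ^ (\<alpha> i0 + \<alpha> i1) * (\<Prod>j\<in>S. \<mu> j ^ \<alpha> j))"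
  \<comment> \<open>One step down the chain; it is applied only for positive
    \<open>\<alpha> i0\<close>, where the subtraction is exact.\<close>
  define shift where "shift = (\<lambda>\<alpha>::'n \<Rightarrow> nat. \<alpha>(i0 := \<alpha> i0 - 1, i1 := Suc (\<alpha> i1)))"
  have l_UNIV: "l \<alpha> = (\<Prod>j\<in>UNIV. \<mu> j ^ \<alpha> j)" for \<alpha>
  proof -
    have "(\<Prod>j\<in>UNIV. \<mu> j ^ \<alpha> j) = (\<Prod>j\<in>insert i0 (insert i1 S). \<mu> j ^ \<alpha> j)"
      by (rule prod.cong) (auto simp: S_def)
    also have "\<dots> = l \<alpha>"
      using i01 by (simp add: l_def S_def \<mu>01 power_add mult.assoc)
    finally show ?thesis ..
  qed
  have l_nz: "l \<alpha> \<noteq> 0" for \<alpha>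
    by (simp add: l_UNIV nz)
  have S_upd: "(\<Prod>j\<in>S. f j ^ (\<alpha>(i := m)) j) = (\<Prod>j\<in>S. f j ^ \<alpha> j)" if "i = i0 \<or> i = i1" for f :: "'n \<Rightarrow> complex" and \<alpha> i m
    by (rule prod.cong) (use that in \<open>auto simp: S_def\<close>)
  have wJ: "w j (affine_map A b z) = \<mu> j * w j z + (if j = i0 then w i1 z else 0)" for j z
  proof -
    have "(\<Sum>i\<in>UNIV. J $ j $ i * w i z)
        = (\<Sum>i\<in>UNIV. (if i = j then \<mu> j * w j z else 0) + (if i = i1 then if j = i0 then w i1 z else 0 else 0))"
      by (rule sum.cong) (use i01 in \<open>auto simp: J jordan2_mat_def\<close>)
    then show ?thesis by (simp add: w_affine_map sum.distrib)
  qed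
  have wJ0: "w i0 (affine_map A b z) = \<mu> i0 * w i0 z + w i1 z" and wJ1: "w i1 (affine_map A b z) = \<mu> i0 * w i1 z" for z
    using i01 by (simp_all add: wJ \<mu>01)
  have S_comp: "(\<Prod>j\<in>S. w j (affine_map A b z) ^ \<alpha> j) = (\<Prod>j\<in>S. \<mu> j ^ \<alpha> j) * (\<Prod>j\<in>S. w j z ^ \<alpha> j)" for \<alpha> z
  proof -
    have "(\<Prod>j\<in>S. w j (affine_map A b z) ^ \<alpha> j) = (\<Prod>j\<in>S. \<mu> j ^ \<alpha> j * w j z ^ \<alpha> j)"
      by (rule prod.cong) (auto simp: wJ S_def power_mult_distrib)
    then show ?thesis by (simp add: prod.distrib)
  qed
  have e_0: "e \<alpha> (affine_map A b z) = l \<alpha> * e \<alpha> z" if "\<alpha> i0 = 0" for \<alpha> z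
    by (simp add: e_def l_def S_comp wJ0 wJ1 that binomial_form_jordan_0 mult_ac)
  have e_Suc: "e \<alpha> (affine_map A b z) = l \<alpha> * (e \<alpha> z + e (shift \<alpha>) z)" if "\<alpha> i0 = Suc a" for \<alpha> z a
  proof -
    have "e (shift \<alpha>) z = binomial_form (\<mu> i0) (w i0 z) (w i1 z) a (Suc (\<alpha> i1)) * (\<Prod>j\<in>S. w j z ^ \<alpha> j)"
      using i01 that by (simp add: e_def shift_def S_upd del: fun_upd_apply) (simp add: fun_upd_apply)
    moreover have "e \<alpha> (affine_map A b z) = binomial_form (\<mu> i0) (\<mu> i0 * w i0 z + w i1 z) (\<mu> i0 * w i1 z) (Suc a) (\<alpha> i1)
        * ((\<Prod>j\<in>S. \<mu> j ^ \<alpha> j) * (\<Prod>j\<in>S. w j z ^ \<alpha> j))"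
      by (simp only: e_def S_comp wJ0 wJ1 that)
    moreover have "e \<alpha> z = binomial_form (\<mu> i0) (w i0 z) (w i1 z) (Suc a) (\<alpha> i1) * (\<Prod>j\<in>S. w j z ^ \<alpha> j)"
      by (simp add: e_def that)
    ultimately show ?thesis
      unfolding l_def that by (simp only: binomial_form_jordan_Suc distrib_right distrib_left mult_ac)
  qed
  have l_shift: "l (shift \<alpha>) = l \<alpha>" if "\<alpha> i0 = Suc a" for \<alpha> a
    using i01 that by (simp add: l_def shift_def S_upd del: fun_upd_apply) (simp add: fun_upd_apply)
  \<comment> \<open>Each linear factor lowers the exponent at \<open>i0\<close> by one, and a
    further one kills the end of the chain, hence the power \<open>Suc a\<close>.\<close>
  have annih: "op_poly (affine_map A b) ([:- l \<alpha>, 1:] ^ Suc a) (e \<alpha>) z = 0" if "\<alpha> i0 = a" for \<alpha> a z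
    using that
  proof (induction a arbitrary: \<alpha> z)
    case 0
    then show ?case by (simp add: op_poly_pCons e_0)
  next
    case (Suc a)
    have "op_poly (affine_map A b) [:- l \<alpha>, 1:] (e \<alpha>) = (\<lambda>z. l \<alpha> * e (shift \<alpha>) z)"
      by (rule ext) (simp add: op_poly_pCons e_Suc[of \<alpha> a, OF Suc.prems] distrib_left)
    then have "op_poly (affine_map A b) ([:- l \<alpha>, 1:] ^ Suc a * [:- l \<alpha>, 1:]) (e \<alpha>) z
        = l \<alpha> * op_poly (affine_map A b) ([:- l \<alpha>, 1:] ^ Suc a) (e (shift \<alpha>)) z"
      by (simp only: op_poly_mult op_poly_fun_cmult)
    also have "\<dots> = 0"
    proof -
      have "shift \<alpha> i0 = a"
        using Suc.prems i01 by (simp add: shift_def)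
      then have "op_poly (affine_map A b) ([:- l (shift \<alpha>), 1:] ^ Suc a) (e (shift \<alpha>)) z = 0"
        by (rule Suc.IH)
      then show ?thesis
        by (simp only: l_shift[of \<alpha> a, OF Suc.prems] mult_zero_right)
    qed
    finally show ?case
      by (simp only: power_Suc2[of _ "Suc a"])
  qed
  show ?thesis
  proof (rule fock_cyclic_indexed[OF bounded, of "{\<alpha>. \<forall>j\<in>{i1}. \<alpha> j = 0}" e l "\<lambda>\<alpha>. Suc (\<alpha> i0)"])
    show "infinite {\<alpha>::'n \<Rightarrow> nat. \<forall>j\<in>{i1}. \<alpha> j = 0}"
      using i01 by (intro infinite_multiindices[of i0]) simp
    show "e \<alpha> \<in> polyfuns" for \<alpha>
    proof -
      have "(\<lambda>z. w i1 z ^ \<alpha> i1 * ((\<Prod>i<\<alpha> i0. \<mu> i0 * w i0 z + (- of_nat i) * w i1 z) * inverse (fact (\<alpha> i0)))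
          * (\<Prod>j\<in>S. w j z ^ \<alpha> j)) \<in> polyfuns"
        by (intro polyfuns_mult polyfuns_prod polyfuns_power polyfuns_w polyfuns_const polyfuns.add polyfuns.cmult)
      then show ?thesis
        by (simp add: e_def binomial_form_def divide_inverse mult.assoc)
    qed
    show "op_poly (affine_map A b) ([:- l \<alpha>, 1:] ^ Suc (\<alpha> i0)) (e \<alpha>) z = 0" for \<alpha> z
      by (rule annih) simp
    show "inj_on l {\<alpha>. \<forall>j\<in>{i1}. \<alpha> j = 0}"
      by (rule inj_onI, rule nonresonant_exponents_unique[OF nr nz]) (auto simp: l_UNIV)
    fix K :: "(complex^'n \<Rightarrow> complex) set"
    assume eK: "\<And>\<alpha>. \<alpha> \<in> {\<alpha>. \<forall>j\<in>{i1}. \<alpha> j = 0} \<Longrightarrow> e \<alpha> \<in> K"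
      and inv: "invariant_fun_space (affine_map A b) K"
    have e_K: "e \<alpha> \<in> K" if "\<alpha> i1 = m" for \<alpha> m
      using that
    proof (induction m arbitrary: \<alpha>)
      case 0
      then show ?case by (intro eK) simp
    next
      case (Suc m)
      \<comment> \<open>The predecessor of \<alpha> in its chain: \<open>e \<alpha>\<close> is
        recovered from \<open>e \<beta>\<close> and its composition with the map.\<close>
      define \<beta> where "\<beta> = \<alpha>(i0 := Suc (\<alpha> i0), i1 := m)"
      have "shift \<beta> = \<alpha>"
        using i01 Suc.prems by (auto simp: shift_def \<beta>_def)
      moreover have "\<beta> i0 = Suc (\<alpha> i0)"
        using i01 by (simp add: \<beta>_def)
      ultimately have "e \<alpha> z = inverse (l \<beta>) * (e \<beta> \<circ> affine_map A b) z + (- 1) * e \<beta> z" for z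
        using l_nz[of \<beta>] by (simp add: e_Suc[of \<beta> "\<alpha> i0"] field_simps)
      moreover have "e \<beta> \<in> K"
        by (rule Suc.IH) (simp add: \<beta>_def)
      then have "(\<lambda>z. inverse (l \<beta>) * (e \<beta> \<circ> affine_map A b) z + (- 1) * e \<beta> z) \<in> K"
        by (intro invariant_fun_spaceD[OF inv])
      ultimately show ?case
        by (metis (no_types, lifting) ext)
    qed
    have "polyfuns \<subseteq> fun_span (range e)"
    proof (rule polyfuns_subset_fun_span_w)
      have "e (\<lambda>j. 0) = (\<lambda>z. 1)"
        by (simp add: e_def binomial_form_def)
      then show "(\<lambda>z. 1) \<in> fun_span (range e)"
        by (metis fun_span.base rangeI)
      fix j g assume "g \<in> range e"
      then obtain \<alpha> where g: "g = e \<alpha>"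
        by blast
      have span_e: "e \<beta> \<in> fun_span (range e)" for \<beta>
        by (intro fun_span.base rangeI)
      have w1: "w i1 z * e \<alpha> z = e (\<alpha>(i1 := Suc (\<alpha> i1))) z" for z
        using i01 by (simp add: e_def S_upd binomial_form_mult_right mult.assoc[symmetric] del: fun_upd_apply)
          (simp add: fun_upd_apply)
      consider "j = i1" | "j = i0" | "j \<in> S"
        by (auto simp: S_def)
      then show "(\<lambda>z. w j z * g z) \<in> fun_span (range e)"
      proof cases
        case 1
        have "(\<lambda>z. w j z * g z) = e (\<alpha>(i1 := Suc (\<alpha> i1)))"
          by (rule ext) (simp only: 1 g w1)
        then show ?thesis by (simp only: span_e)
      next
        case 2
        \<comment> \<open>Multiplication by this coordinate does not send generators to multiples of
          generators: the falling product absorbs it only up to a correction term.\<close>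
        have "\<mu> i0 * (w i0 z * e \<alpha> z) = of_nat (Suc (\<alpha> i0)) * e (\<alpha>(i0 := Suc (\<alpha> i0))) z
            + of_nat (\<alpha> i0) * e (\<alpha>(i1 := Suc (\<alpha> i1))) z" for z
        proof -
          have "\<mu> i0 * (w i0 z * e \<alpha> z)
              = (\<mu> i0 * w i0 z * binomial_form (\<mu> i0) (w i0 z) (w i1 z) (\<alpha> i0) (\<alpha> i1)) * (\<Prod>j\<in>S. w j z ^ \<alpha> j)"
            by (simp add: e_def mult.assoc)
          moreover have "e (\<alpha>(i0 := Suc (\<alpha> i0))) z
              = binomial_form (\<mu> i0) (w i0 z) (w i1 z) (Suc (\<alpha> i0)) (\<alpha> i1) * (\<Prod>j\<in>S. w j z ^ \<alpha> j)"
            using i01 unfolding e_def by (simp add: S_upd del: fun_upd_apply) (simp add: fun_upd_apply)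
          moreover have "e (\<alpha>(i1 := Suc (\<alpha> i1))) z
              = binomial_form (\<mu> i0) (w i0 z) (w i1 z) (\<alpha> i0) (Suc (\<alpha> i1)) * (\<Prod>j\<in>S. w j z ^ \<alpha> j)"
            using i01 unfolding e_def by (simp add: S_upd del: fun_upd_apply) (simp add: fun_upd_apply)
          ultimately show ?thesis
            unfolding binomial_form_mult_left by (simp only: distrib_right mult.assoc)
        qed
        then have "w i0 z * e \<alpha> z = inverse (\<mu> i0) * (of_nat (Suc (\<alpha> i0)) * e (\<alpha>(i0 := Suc (\<alpha> i0))) z
            + of_nat (\<alpha> i0) * e (\<alpha>(i1 := Suc (\<alpha> i1))) z)" for z
          using nz[of i0] by (metis (no_types, lifting) mult.assoc left_inverse mult_1)
        then have "(\<lambda>z. w j z * g z) = (\<lambda>z. inverse (\<mu> i0) * (of_nat (Suc (\<alpha> i0)) * e (\<alpha>(i0 := Suc (\<alpha> i0))) z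
            + of_nat (\<alpha> i0) * e (\<alpha>(i1 := Suc (\<alpha> i1))) z))"
          unfolding 2 g by (rule ext)
        then show ?thesis
          by (simp only:) (rule fun_span.cmult, rule fun_span.add; rule fun_span.cmult, rule span_e)
      next
        case 3
        then have ne: "j \<noteq> i0" "j \<noteq> i1"
          by (auto simp: S_def)
        have "w j z * e \<alpha> z = e (\<alpha>(j := Suc (\<alpha> j))) z" for z
        proof -
          have "(\<alpha>(j := Suc (\<alpha> j))) i0 = \<alpha> i0" "(\<alpha>(j := Suc (\<alpha> j))) i1 = \<alpha> i1"
            using ne by simp_all
          then show ?thesis
            unfolding e_def prod_power_fun_upd[OF 3, of "\<lambda>j. w j z" \<alpha>]
            by (simp only: mult.left_commute)
        qed
        then have "(\<lambda>z. w j z * g z) = e (\<alpha>(j := Suc (\<alpha> j)))"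
          unfolding g by (rule ext)
        then show ?thesis by (simp only: span_e)
      qed
    qed
    also have "\<dots> \<subseteq> K"
      using e_K by (intro fun_span_subset[OF _ inv]) auto
    finally show "polyfuns \<subseteq> K" .
  qed
qed

end

lemma eigenvalue_nonzero:
  fixes A P :: "complex^'n^'n"
  assumes "invertible A" "invertible P" "A *v column j P = \<mu> *s column j P"
  shows "\<mu> \<noteq> 0"
proof
  assume "\<mu> = 0"
  then have "column j P = 0"
    using assms(1,3) by (metis invertible_left_inverse matrix_left_invertible_ker vec.scale_zero_left)
  moreover have "P *v axis j 1 = column j P"
    by (simp add: matrix_vector_mult_def axis_def column_def vec_eq_iff if_distrib cong: if_cong)
  ultimately have "P *v axis j 1 = 0"
    by simp
  then have "axis j 1 = (0::complex^'n)"
    using assms(2) by (metis invertible_left_inverse matrix_left_invertible_ker)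
  then show False
    by (simp add: axis_eq_0_iff)
qed

theorem theorem1:
  fixes A :: "complex^'n^'n" and b :: "complex^'n"
  assumes "fock_bounded_op (comp_op (affine_map A b))"
  shows "fock_cyclic (comp_op (affine_map A b)) \<longleftrightarrow>
     invertible A \<and>
     ((\<exists>(P::complex^'n^'n) \<mu>. invertible P \<and> A ** P = P ** diag_mat \<mu> \<and> nonresonant \<mu> UNIV) \<or>
      (\<exists>(P::complex^'n^'n) \<mu> i0 i1. i0 \<noteq> i1 \<and> \<mu> i0 = \<mu> i1 \<and> invertible P \<and>
          A ** P = P ** jordan2_mat \<mu> i0 i1 \<and> nonresonant \<mu> (UNIV - {i1})))"
  (is "?cyclic \<longleftrightarrow> ?normal")
proof -
  obtain p where p: "affine_map A b p = p"
    using bounded_comp_op_fixed_point[OF assms] by blast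
  show ?thesis
  proof
    assume ?cyclic
    then interpret cyclic_comp_op A b p
      using assms p by unfold_locales
    show ?normal by (rule normal_form)
  next
    assume normal: ?normal
    then have A: "invertible A" by blast
    have coords: "\<exists>Q. normal_coordinates A b p P Q J" if "invertible P" "A ** P = P ** J" for P J :: "complex^'n^'n"
      using that assms p unfolding invertible_def normal_coordinates_def by blast
    from normal show ?cyclic
    proof (elim conjE disjE exE)
      fix P :: "complex^'n^'n" and \<mu>
      assume P: "invertible P" "A ** P = P ** diag_mat \<mu>" and nr: "nonresonant \<mu> UNIV"
      have "\<mu> j \<noteq> 0" for j
        using P by (intro eigenvalue_nonzero[OF A P(1), of j]) (simp add: matrix_mult_diag_iff)
      with coords[OF P] nr show ?cyclic
        using normal_coordinates.fock_cyclic_diagonal by blast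
    next
      fix P :: "complex^'n^'n" and \<mu> i0 i1
      assume i: "i0 \<noteq> i1" "\<mu> i0 = \<mu> i1" and P: "invertible P" "A ** P = P ** jordan2_mat \<mu> i0 i1"
        and nr: "nonresonant \<mu> (UNIV - {i1})"
      have nz: "\<mu> j \<noteq> 0" if "j \<noteq> i1" for j
        using P i that by (intro eigenvalue_nonzero[OF A P(1), of j]) (simp add: matrix_mult_jordan2_iff)
      \<comment> \<open>Column \<open>i1\<close> is not an eigenvector, but its diagonal entry
        equals the one at \<open>i0\<close>.\<close>
      have "\<mu> j \<noteq> 0" for j
        using nz[of j] nz[of i0] i by (cases "j = i1") auto
      with coords[OF P] i nr show ?cyclic
        using normal_coordinates.fock_cyclic_jordan2 by blast
    qed
  qed
qed

end
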